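(* Let $\mathbf{k}$ be a commutative ring, $\delta\in\mathbf{k}$, and let $p\ge0$. If $\delta$ is non-singular at ranks $\preceq p$, then there is a canonical isomorphism of algebras $$L:B(p)\xrightarrow{\ \cong\ }mB(p)\cong\bigoplus_{r\preceq p}M_{d_{p,r}}(\mathbb{S}_r),$$ where $d_{p,r}=|\mathbb{B}^{+,m}(r,p)|$, which gives a decomposition of the Brauer algebra $B(p)$ into a direct sum of matrix algebras over group algebras of symmetric groups.
   Context: **Brauer diagrams and Brauer category.** For $p,q\ge0$, a $(p,q)$-Brauer diagram is a partition of $[p]^+\sqcup[q]^-=\{1^+,\dots,p^+\}\sqcup\{1^-,\dots,q^-\}$ into unordered pairs ($i^+$ top points, $i^-$ bottom points); $\mathbb{B}(p,q)$ is their set. Upward: no pair of two top points; downward: no pair of two bottom points; level: both; monotone: $(i-k)(j-l)>0$ for any two distinct pairs $\{i^+,j^-\},\{k^+,l^-\}$. $\mathbb{B}^+,\mathbb{B}^-,\mathbb{B}^0$: upward, downward, level; $\mathbb{B}^{\pm,m}$: monotone ones. $\overline f$: exchange $i^\pm\leftrightarrow i^\mp$. $p\preceq q$ iff $p\le q$ and $q-p$ even. $B=B^{\mathbf{k},\delta}$ has objects the non-negative integers, $B(p,q)$ free on $\mathbb{B}(p,q)$, $f\circ g=\delta^{l(f,g)}f\hat\circ g$ where $g$ is placed above $f$, $l(f,g)$ is the number of closed loops and $f\hat\circ g$ the diagram after deleting loops. $B(p)=B(p,p)$ is the Brauer algebra. $\mathbb{S}_r=\mathbf{k}[\mathfrak{S}_r]$,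 identified with the span of $\mathbb{B}^0(r,r)$. Each diagram is uniquely $f=f^+f^0f^-$ with $f^\pm$ monotone upward/downward and $f^0$ level. **Matrix Brauer algebra.** $mB(p)$ is the free $\mathbf{k}$-module on $\mathbb{B}(p,p)$ with product $(f^+f^0f^-)(g^+g^0g^-)=f^+(f^0g^0)g^-$ if $\overline{f^-}=g^+$ and $0$ otherwise, and unit $\sum_{r\preceq p}\sum_{f\in\mathbb{B}^{+,m}(r,p)}f\,\overline f$. The isomorphism $mB(p)\cong\bigoplus_{r\preceq p}M_{d_{p,r}}(\mathbb{S}_r)$ sends $f^+f^0f^-$ (with middle object $r$) to $f^0$ times the matrix unit at row $f^+$ and column $\overline{f^-}$ in $\mathbb{B}^{+,m}(r,p)$. **The map $L$.** For $g\in B(p)$, $L(g)=\sum_{s\preceq p}\sum_{h\in\mathbb{B}^{+,m}(s,p)}h\circ\pi^-(\overline h\circ g)$ (composites in $B$), where $\pi^-:B(p,s)\to B(p,s)$ is the projection onto the span of downward diagrams killing non-downward diagrams. **Non-singularity.** For $s\preceq q$ and $f,g\in\mathbb{B}^{+,m}(s,q)$, over $\mathbb{Z}[x]$ with parameter $x$ let $a_{f,g}=\overline f\circ g$ if $\overline f\hat\circ g$ is level, and $0$ otherwise; $A_{s,q}=(a_{f,g})\in M_n(\mathbb{Z}[x][\mathfrak{S}_s])$, $n=|\mathbb{B}^{+,m}(s,q)|$; $\iota:M_n(\mathbb{Z}[x][\mathfrak{S}_s])\hookrightarrow M_{n\,s!}(\mathbb{Z}[x])$ induced by the left regular representation; $f_{s,q}(x)=\det\iota(A_{s,q})$.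 $\delta$ is non-singular at ranks $\preceq p$ if $f_{s,q}(\delta)$ is invertible in $\mathbf{k}$ for all $s\preceq q\preceq p$. *)

theory Defs
  imports
    "HOL-Library.Disjoint_Sets"
    "HOL-Library.FuncSet"
    "HOL-Computational_Algebra.Polynomial"
    "HOL-Algebra.Module"
    "HOL-Algebra.QuotRing"
    "HOL-Algebra.Sym_Groups"
    "Jordan_Normal_Form.Determinant"
begin

section \<open>Associative algebras over a commutative ring\<close>

text \<open>The locale \<^locale>\<open>algebra\<close> of HOL-Algebra asks the algebra itself to be commutative;
  the algebras considered here are not.\<close>

definition assoc_algebra :: "('k, 'r) ring_scheme \<Rightarrow> ('k, 'a, 'm) module_scheme \<Rightarrow> bool" where
  "assoc_algebra R A \<longleftrightarrow>
     module R A \<and> ring A \<and>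
     (\<forall>a\<in>carrier R. \<forall>x\<in>carrier A. \<forall>y\<in>carrier A.
        (a \<odot>\<^bsub>A\<^esub> x) \<otimes>\<^bsub>A\<^esub> y = a \<odot>\<^bsub>A\<^esub> (x \<otimes>\<^bsub>A\<^esub> y) \<and>
        x \<otimes>\<^bsub>A\<^esub> (a \<odot>\<^bsub>A\<^esub> y) = a \<odot>\<^bsub>A\<^esub> (x \<otimes>\<^bsub>A\<^esub> y))"

definition algebra_iso ::
  "('k, 'r) ring_scheme \<Rightarrow> ('k, 'a, 'm) module_scheme \<Rightarrow> ('k, 'b, 'n) module_scheme \<Rightarrow> ('a \<Rightarrow> 'b) set" where
  "algebra_iso R A B =
     {h \<in> ring_iso A B. assoc_algebra R A \<and> assoc_algebra R B \<and>
        (\<forall>a\<in>carrier R. \<forall>x\<in>carrier A. h (a \<odot>\<^bsub>A\<^esub> x) = a \<odot>\<^bsub>B\<^esub> h x)}"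


section \<open>Free modules, and algebras given by structure constants\<close>

text \<open>The free module on a \<^emph>\<open>finite\<close> set \<open>X\<close> consists of the coefficient functions that vanish
  off \<open>X\<close>.\<close>

definition free_carrier :: "('k, 'r) ring_scheme \<Rightarrow> 'x set \<Rightarrow> ('x \<Rightarrow> 'k) set" where
  "free_carrier R X = {v. (\<forall>x\<in>X. v x \<in> carrier R) \<and> (\<forall>x. x \<notin> X \<longrightarrow> v x = \<zero>\<^bsub>R\<^esub>)}"

definition basis :: "('k, 'r) ring_scheme \<Rightarrow> 'x \<Rightarrow> 'x \<Rightarrow> 'k" where
  "basis R x = (\<lambda>y. if y = x then \<one>\<^bsub>R\<^esub> else \<zero>\<^bsub>R\<^esub>)"

definition scale :: "('k, 'r) ring_scheme \<Rightarrow> 'k \<Rightarrow> ('x \<Rightarrow> 'k) \<Rightarrow> 'x \<Rightarrow> 'k" where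
  "scale R a v = (\<lambda>x. a \<otimes>\<^bsub>R\<^esub> v x)"

text \<open>The bilinear extension to the free modules on \<open>X\<close> and \<open>Y\<close> of a map \<open>m\<close> defined on pairs of
  basis elements.\<close>

definition bilinear_ext ::
  "('k, 'r) ring_scheme \<Rightarrow> 'x set \<Rightarrow> 'y set \<Rightarrow> ('x \<Rightarrow> 'y \<Rightarrow> 'z \<Rightarrow> 'k)
     \<Rightarrow> ('x \<Rightarrow> 'k) \<Rightarrow> ('y \<Rightarrow> 'k) \<Rightarrow> 'z \<Rightarrow> 'k" where
  "bilinear_ext R X Y m v w =
     (\<lambda>z. \<Oplus>\<^bsub>R\<^esub>x\<in>X. \<Oplus>\<^bsub>R\<^esub>y\<in>Y. v x \<otimes>\<^bsub>R\<^esub> w y \<otimes>\<^bsub>R\<^esub> m x y z)"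

definition free_algebra ::
  "('k, 'r) ring_scheme \<Rightarrow> 'x set \<Rightarrow> ('x \<Rightarrow> 'x \<Rightarrow> 'x \<Rightarrow> 'k) \<Rightarrow> ('x \<Rightarrow> 'k) \<Rightarrow> ('k, 'x \<Rightarrow> 'k) module" where
  "free_algebra R X m e =
     \<lparr>carrier = free_carrier R X,
      monoid.mult = bilinear_ext R X X m,
      one = e,
      zero = (\<lambda>x. \<zero>\<^bsub>R\<^esub>),
      add = (\<lambda>v w x. v x \<oplus>\<^bsub>R\<^esub> w x),
      module.smult = scale R\<rparr>"

definition group_algebra ::
  "('k, 'r) ring_scheme \<Rightarrow> ('g, 'm) monoid_scheme \<Rightarrow> ('k, 'g \<Rightarrow> 'k) module" where
  "group_algebra R G =
     free_algebra R (carrier G) (\<lambda>x y. basis R (x \<otimes>\<^bsub>G\<^esub> y)) (basis R \<one>\<^bsub>G\<^esub>)"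


section \<open>Matrix algebras and direct sums of algebras\<close>

text \<open>Square matrices over the algebra \<open>A\<close> with rows and columns indexed by the finite set \<open>I\<close>,
  that is, the algebra of \<open>n\<close> by \<open>n\<close> matrices with \<open>n = card I\<close>.\<close>

definition matrix_algebra ::
  "'i set \<Rightarrow> ('k, 'a, 'm) module_scheme \<Rightarrow> ('k, 'i \<times> 'i \<Rightarrow> 'a) module" where
  "matrix_algebra I A =
     \<lparr>carrier = (I \<times> I) \<rightarrow>\<^sub>E carrier A,
      monoid.mult = (\<lambda>M N. \<lambda>(i, k)\<in>I \<times> I. \<Oplus>\<^bsub>A\<^esub>j\<in>I. M (i, j) \<otimes>\<^bsub>A\<^esub> N (j, k)),
      one = (\<lambda>(i, j)\<in>I \<times> I. if i = j then \<one>\<^bsub>A\<^esub> else \<zero>\<^bsub>A\<^esub>),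
      zero = (\<lambda>_\<in>I \<times> I. \<zero>\<^bsub>A\<^esub>),
      add = (\<lambda>M N. \<lambda>ij\<in>I \<times> I. M ij \<oplus>\<^bsub>A\<^esub> N ij),
      module.smult = (\<lambda>a M. \<lambda>ij\<in>I \<times> I. a \<odot>\<^bsub>A\<^esub> M ij)\<rparr>"

definition elem_matrix ::
  "'i set \<Rightarrow> ('k, 'a, 'm) module_scheme \<Rightarrow> 'i \<Rightarrow> 'i \<Rightarrow> 'a \<Rightarrow> 'i \<times> 'i \<Rightarrow> 'a" where
  "elem_matrix I A i j x = (\<lambda>ij\<in>I \<times> I. if ij = (i, j) then x else \<zero>\<^bsub>A\<^esub>)"

text \<open>The direct sum over a finite index set, with componentwise operations.\<close>

definition direct_sum_algebra ::
  "'i set \<Rightarrow> ('i \<Rightarrow> ('k, 'a, 'm) module_scheme) \<Rightarrow> ('k, 'i \<Rightarrow> 'a) module" where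
  "direct_sum_algebra I A =
     \<lparr>carrier = (\<Pi>\<^sub>E i\<in>I. carrier (A i)),
      monoid.mult = (\<lambda>x y. \<lambda>i\<in>I. x i \<otimes>\<^bsub>A i\<^esub> y i),
      one = (\<lambda>i\<in>I. \<one>\<^bsub>A i\<^esub>),
      zero = (\<lambda>i\<in>I. \<zero>\<^bsub>A i\<^esub>),
      add = (\<lambda>x y. \<lambda>i\<in>I. x i \<oplus>\<^bsub>A i\<^esub> y i),
      module.smult = (\<lambda>a x. \<lambda>i\<in>I. a \<odot>\<^bsub>A i\<^esub> x i)\<rparr>"

definition summand_inj ::
  "'i set \<Rightarrow> ('i \<Rightarrow> ('k, 'a, 'm) module_scheme) \<Rightarrow> 'i \<Rightarrow> 'a \<Rightarrow> 'i \<Rightarrow> 'a" where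
  "summand_inj I A i x = (\<lambda>j\<in>I. if j = i then x else \<zero>\<^bsub>A j\<^esub>)"


section \<open>Brauer diagrams\<close>

datatype point = Top nat | Bot nat

type_synonym diagram = "point set set"

definition points :: "nat \<Rightarrow> nat \<Rightarrow> point set" where
  "points p q = Top ` {1..p} \<union> Bot ` {1..q}"

definition brauer :: "nat \<Rightarrow> nat \<Rightarrow> diagram set" where
  "brauer p q = {d. partition_on (points p q) d \<and> (\<forall>b\<in>d. card b = 2)}"

definition upward :: "diagram \<Rightarrow> bool" where
  "upward d \<longleftrightarrow> \<not> (\<exists>i j. {Top i, Top j} \<in> d)"

definition downward :: "diagram \<Rightarrow> bool" where
  "downward d \<longleftrightarrow> \<not> (\<exists>i j. {Bot i, Bot j} \<in> d)"

definition level :: "diagram \<Rightarrow> bool" where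
  "level d \<longleftrightarrow> upward d \<and> downward d"

definition monotone_diagram :: "diagram \<Rightarrow> bool" where
  "monotone_diagram d \<longleftrightarrow>
     (\<forall>i j k l. {Top i, Bot j} \<in> d \<longrightarrow> {Top k, Bot l} \<in> d \<longrightarrow> {Top i, Bot j} \<noteq> {Top k, Bot l} \<longrightarrow>
        (int i - int k) * (int j - int l) > 0)"

definition level_diagrams :: "nat \<Rightarrow> diagram set" where
  "level_diagrams r = {d \<in> brauer r r. level d}"

definition up_mono :: "nat \<Rightarrow> nat \<Rightarrow> diagram set" where
  "up_mono p q = {d \<in> brauer p q. upward d \<and> monotone_diagram d}"

definition down_mono :: "nat \<Rightarrow> nat \<Rightarrow> diagram set" where
  "down_mono p q = {d \<in> brauer p q. downward d \<and> monotone_diagram d}"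

fun flip_point :: "point \<Rightarrow> point" where
  "flip_point (Top i) = Bot i"
| "flip_point (Bot i) = Top i"

definition flip :: "diagram \<Rightarrow> diagram" where
  "flip d = (\<lambda>b. flip_point ` b) ` d"

definition preceq :: "nat \<Rightarrow> nat \<Rightarrow> bool"  (infix \<open>\<preceq>\<close> 50) where
  "p \<preceq> q \<longleftrightarrow> p \<le> q \<and> even (q - p)"


section \<open>Composition of diagrams\<close>

text \<open>To compose \<open>f\<close> with \<open>g\<close>, the diagram \<open>g\<close> is placed above \<open>f\<close>: the bottom points of \<open>g\<close> and
  the top points of \<open>f\<close> become the common middle row. Each connected component of the glued graph
  is either a path between two outer (upper or lower) points, giving a pair of the composite, or a
  cycle through middle points only, that is, a closed loop.\<close>

datatype glued_point = Upper nat | Middle nat | Lower nat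

fun glue_above :: "point \<Rightarrow> glued_point" where
  "glue_above (Top i) = Upper i"
| "glue_above (Bot i) = Middle i"

fun glue_below :: "point \<Rightarrow> glued_point" where
  "glue_below (Top i) = Middle i"
| "glue_below (Bot i) = Lower i"

fun outer :: "point \<Rightarrow> glued_point" where
  "outer (Top i) = Upper i"
| "outer (Bot i) = Lower i"

definition glued_edges :: "diagram \<Rightarrow> diagram \<Rightarrow> glued_point set set" where
  "glued_edges f g = (\<lambda>b. glue_above ` b) ` g \<union> (\<lambda>b. glue_below ` b) ` f"

definition glued_components :: "diagram \<Rightarrow> diagram \<Rightarrow> glued_point set set" where
  "glued_components f g =
     \<Union>(glued_edges f g) // {(x, y). \<exists>b\<in>glued_edges f g. x \<in> b \<and> y \<in> b}\<^sup>*"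

definition diagram_comp :: "diagram \<Rightarrow> diagram \<Rightarrow> diagram"  (infixr \<open>\<bullet>\<^sub>B\<close> 75) where
  "f \<bullet>\<^sub>B g = (\<lambda>C. outer -` C) ` glued_components f g - {{}}"

definition loops :: "diagram \<Rightarrow> diagram \<Rightarrow> nat" where
  "loops f g = card {C \<in> glued_components f g. outer -` C = {}}"


section \<open>The Brauer category and the Brauer algebra\<close>

text \<open>The composite of \<open>u \<in> B(q, r)\<close> with \<open>v \<in> B(p, q)\<close>.\<close>

definition brauer_mult ::
  "('k, 'r) ring_scheme \<Rightarrow> 'k \<Rightarrow> nat \<Rightarrow> nat \<Rightarrow> nat
     \<Rightarrow> (diagram \<Rightarrow> 'k) \<Rightarrow> (diagram \<Rightarrow> 'k) \<Rightarrow> diagram \<Rightarrow> 'k" where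
  "brauer_mult R \<delta> p q r =
     bilinear_ext R (brauer q r) (brauer p q)
       (\<lambda>f g. scale R (\<delta> [^]\<^bsub>R\<^esub> loops f g) (basis R (f \<bullet>\<^sub>B g)))"

definition id_diagram :: "nat \<Rightarrow> diagram" where
  "id_diagram p = (\<lambda>i. {Top i, Bot i}) ` {1..p}"

definition brauer_algebra ::
  "('k, 'r) ring_scheme \<Rightarrow> 'k \<Rightarrow> nat \<Rightarrow> ('k, diagram \<Rightarrow> 'k) module" where
  "brauer_algebra R \<delta> p =
     free_algebra R (brauer p p)
       (\<lambda>f g. scale R (\<delta> [^]\<^bsub>R\<^esub> loops f g) (basis R (f \<bullet>\<^sub>B g)))
       (basis R (id_diagram p))"


section \<open>The matrix Brauer algebra\<close>

text \<open>The unique factorization \<open>f = f\<^sup>+ f\<^sup>0 f\<^sup>-\<close> of a \<open>(p, q)\<close>-diagram, together with its middle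
  object \<open>r\<close>.\<close>

definition factorization :: "nat \<Rightarrow> nat \<Rightarrow> diagram \<Rightarrow> nat \<times> diagram \<times> diagram \<times> diagram" where
  "factorization p q f =
     (THE (r, a, b, c). a \<in> up_mono r q \<and> b \<in> level_diagrams r \<and> c \<in> down_mono p r \<and>
        f = a \<bullet>\<^sub>B b \<bullet>\<^sub>B c)"

definition matrix_brauer_algebra ::
  "('k, 'r) ring_scheme \<Rightarrow> nat \<Rightarrow> ('k, diagram \<Rightarrow> 'k) module" where
  "matrix_brauer_algebra R p =
     free_algebra R (brauer p p)
       (\<lambda>f g. case factorization p p f of (r, fu, f0, fd) \<Rightarrow>
              case factorization p p g of (s, gu, g0, gd) \<Rightarrow>
                if flip fd = gu then basis R (fu \<bullet>\<^sub>B (f0 \<bullet>\<^sub>B g0) \<bullet>\<^sub>B gd) else (\<lambda>_. \<zero>\<^bsub>R\<^esub>))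
       (\<lambda>d. \<Oplus>\<^bsub>R\<^esub>r\<in>{r. r \<preceq> p}. \<Oplus>\<^bsub>R\<^esub>f\<in>up_mono r p. basis R (f \<bullet>\<^sub>B flip f) d)"

text \<open>A permutation \<open>\<sigma>\<close> corresponds to the level diagram joining the top point \<open>i\<close> to the bottom
  point \<open>\<sigma> i\<close>; since the right-hand factor of a product is placed on top, this is compatible with
  composition.\<close>

definition perm_diagram :: "nat \<Rightarrow> (nat \<Rightarrow> nat) \<Rightarrow> diagram" where
  "perm_diagram r \<sigma> = (\<lambda>i. {Top i, Bot (\<sigma> i)}) ` {1..r}"

definition diagram_perm :: "nat \<Rightarrow> diagram \<Rightarrow> nat \<Rightarrow> nat" where
  "diagram_perm r = inv_into (carrier (sym_group r)) (perm_diagram r)"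

definition matrix_summand ::
  "('k, 'r) ring_scheme \<Rightarrow> nat \<Rightarrow> nat \<Rightarrow> ('k, diagram \<times> diagram \<Rightarrow> (nat \<Rightarrow> nat) \<Rightarrow> 'k) module" where
  "matrix_summand R p r = matrix_algebra (up_mono r p) (group_algebra R (sym_group r))"

definition matrix_sum_algebra ::
  "('k, 'r) ring_scheme \<Rightarrow> nat \<Rightarrow> ('k, nat \<Rightarrow> diagram \<times> diagram \<Rightarrow> (nat \<Rightarrow> nat) \<Rightarrow> 'k) module" where
  "matrix_sum_algebra R p = direct_sum_algebra {r. r \<preceq> p} (matrix_summand R p)"

definition to_matrices ::
  "('k, 'r) ring_scheme \<Rightarrow> nat \<Rightarrow> (diagram \<Rightarrow> 'k)
     \<Rightarrow> nat \<Rightarrow> diagram \<times> diagram \<Rightarrow> (nat \<Rightarrow> nat) \<Rightarrow> 'k" where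
  "to_matrices R p v =
     (\<Oplus>\<^bsub>matrix_sum_algebra R p\<^esub>f\<in>brauer p p. v f \<odot>\<^bsub>matrix_sum_algebra R p\<^esub>
        (case factorization p p f of (r, fu, f0, fd) \<Rightarrow>
           summand_inj {r. r \<preceq> p} (matrix_summand R p) r
             (elem_matrix (up_mono r p) (group_algebra R (sym_group r)) fu (flip fd)
                (basis R (diagram_perm r f0)))))"


section \<open>The map \<open>L\<close>\<close>

definition proj_down :: "('k, 'r) ring_scheme \<Rightarrow> (diagram \<Rightarrow> 'k) \<Rightarrow> diagram \<Rightarrow> 'k" where
  "proj_down R v = (\<lambda>d. if downward d then v d else \<zero>\<^bsub>R\<^esub>)"

definition L_map ::
  "('k, 'r) ring_scheme \<Rightarrow> 'k \<Rightarrow> nat \<Rightarrow> (diagram \<Rightarrow> 'k) \<Rightarrow> diagram \<Rightarrow> 'k" where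
  "L_map R \<delta> p g =
     (\<Oplus>\<^bsub>matrix_brauer_algebra R p\<^esub>s\<in>{s. s \<preceq> p}.
        \<Oplus>\<^bsub>matrix_brauer_algebra R p\<^esub>h\<in>up_mono s p.
          brauer_mult R \<delta> p s p (basis R h)
            (proj_down R (brauer_mult R \<delta> p p s (basis R (flip h)) g)))"


section \<open>Non-singularity\<close>

definition Zx_ring :: "int poly ring" where
  "Zx_ring = \<lparr>carrier = UNIV, monoid.mult = (*), one = 1, zero = 0, add = (+)\<rparr>"

definition gram_entry :: "nat \<Rightarrow> diagram \<Rightarrow> diagram \<Rightarrow> (nat \<Rightarrow> nat) \<Rightarrow> int poly" where
  "gram_entry s f g =
     (if level (flip f \<bullet>\<^sub>B g)
      then scale Zx_ring ([:0, 1:] ^ loops (flip f) g) (basis Zx_ring (diagram_perm s (flip f \<bullet>\<^sub>B g)))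
      else (\<lambda>_. 0))"

text \<open>Rows and columns of the matrix obtained from the left regular representation are indexed by
  pairs \<open>(f, \<sigma>)\<close>: the column of \<open>\<tau>\<close> contains the coefficients of \<open>a \<tau>\<close>. The determinant does not
  depend on the order in which the pairs are listed, which is therefore chosen arbitrarily.\<close>

definition gram_entry_regular :: "nat \<Rightarrow> diagram \<times> (nat \<Rightarrow> nat) \<Rightarrow> diagram \<times> (nat \<Rightarrow> nat) \<Rightarrow> int poly" where
  "gram_entry_regular s = (\<lambda>(f, \<sigma>) (g, \<tau>).
     (gram_entry s f g \<otimes>\<^bsub>group_algebra Zx_ring (sym_group s)\<^esub> basis Zx_ring \<tau>) \<sigma>)"

definition gram_index :: "nat \<Rightarrow> nat \<Rightarrow> (diagram \<times> (nat \<Rightarrow> nat)) list" where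
  "gram_index s q = (SOME xs. distinct xs \<and> set xs = up_mono s q \<times> carrier (sym_group s))"

definition gram_poly :: "nat \<Rightarrow> nat \<Rightarrow> int poly" where
  "gram_poly s q =
     (let xs = gram_index s q; n = length xs
      in det (mat n n (\<lambda>(i, j). gram_entry_regular s (xs ! i) (xs ! j))))"

definition eval_int_poly :: "('k, 'r) ring_scheme \<Rightarrow> 'k \<Rightarrow> int poly \<Rightarrow> 'k" where
  "eval_int_poly R a f = (\<Oplus>\<^bsub>R\<^esub>i\<in>{..degree f}. [coeff f i] \<cdot>\<^bsub>R\<^esub> (a [^]\<^bsub>R\<^esub> i))"

definition non_singular :: "('k, 'r) ring_scheme \<Rightarrow> 'k \<Rightarrow> nat \<Rightarrow> bool" where
  "non_singular R \<delta> p \<longleftrightarrow>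
     (\<forall>q s. q \<preceq> p \<longrightarrow> s \<preceq> q \<longrightarrow> eval_int_poly R \<delta> (gram_poly s q) \<in> Units R)"

end

theory Submission
  imports Defs
begin

text \<open>
The map \<open>L\<close> is multiplicative for every \<open>\<delta>\<close>. A pair of bottom points of \<open>h' \<circ> f\<close>, with \<open>h'\<close> the flip of
  \<open>h\<close>, survives in \<open>h' \<circ> f \<circ> g\<close>, so nothing is lost by projecting \<open>h' \<circ> f\<close> to downward diagrams first. If
  \<open>h' \<circ> f\<close> is downward, it is \<open>d0 \<circ> d\<close> with \<open>d0\<close> level and \<open>d\<close> monotone downward, and in the matrix
  Brauer algebra it only meets the summand of \<open>L g\<close> belonging to the flip of \<open>d\<close>.

  Bijectivity is a matter of ranks (numbers of through strands): if \<open>h\<close> has rank \<open>s\<close> and \<open>h' \<circ> g\<close> is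
  downward, then \<open>s\<close> is at most the rank of \<open>g\<close>. Hence \<open>L\<close> is block triangular, and its diagonal
  blocks, one for each rank and each monotone downward factor, are the Gram matrices in the left
  regular representation, evaluated at \<open>\<delta>\<close>. Over \<open>\<int>[x]\<close> the adjugate inverts a Gram matrix up to its
  determinant, which becomes a unit at \<open>\<delta>\<close>.

  Associativity of the composition, together with the count of loops, holds because diagrams may be
  glued in stages: a part of the glued graph may be replaced by the traces of its components on the
  points where the rest is attached. The map to matrices merely relabels coefficients along the
  unique factorization of a diagram, and the algebra axioms of the target are transported along it.
\<close>

section \<open>Connected components\<close>

text \<open>Closed sets stand in for paths. A component is a minimal nonempty closed set, so two
  ends lie in the same component once every closed set containing the one contains the other;
  following a strand through a glued diagram becomes a chain of equivalent memberships.

  Apart from products with identities, composites are worked out explicitly only for an upward left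
  factor, where every middle point runs on to the bottom row and no loop can close. A product such
  as \<open>flip h \<bullet>\<^sub>B g\<close>, in which loops do arise, is never worked out:
  associativity, additivity of the loop count and uniqueness of the factorization tell all that is
  needed about it.

  The blocks off the diagonal of L need not vanish, since composing with \<open>flip h\<close> may
  lower the rank. Hence inverting the Gram matrices is not yet inverting L, and an elimination by
  rank is required. Within one rank, \<open>flip h\<close> times the upward factor is forced to be
  level; this separates the monotone downward factors and leaves the regular representation.\<close>

definition comps :: "'a set set \<Rightarrow> 'a set set" where
  "comps E = \<Union>E // {(x, y). \<exists>b\<in>E. x \<in> b \<and> y \<in> b}\<^sup>*"

text \<open>These are the unions of components, up to points outside
  \<open>\<Union>E\<close>.\<close>

definition closed_under :: "'a set set \<Rightarrow> 'a set \<Rightarrow> bool" where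
  "closed_under E X \<longleftrightarrow> (\<forall>b\<in>E. b \<inter> X \<noteq> {} \<longrightarrow> b \<subseteq> X)"

text \<open>Members that miss \<open>W\<close>, such as closed loops, leave nothing behind; loops
  therefore have to be counted separately.\<close>

definition trace :: "'a set \<Rightarrow> 'a set set \<Rightarrow> 'a set set" where
  "trace W P = (\<lambda>C. C \<inter> W) ` P - {{}}"

lemma closed_underD: "closed_under E X \<Longrightarrow> b \<in> E \<Longrightarrow> x \<in> b \<Longrightarrow> x \<in> X \<Longrightarrow> b \<subseteq> X"
  unfolding closed_under_def by blast

lemma closed_under_subset: "closed_under E X \<Longrightarrow> b \<in> E \<Longrightarrow> b \<inter> X \<noteq> {} \<Longrightarrow> b \<subseteq> X"
  unfolding closed_under_def by blast

text \<open>The only induction along paths. It translates equivalence classes of the reflexive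
  transitive closure into closed sets.\<close>

lemma rtrancl_class_closed:
  fixes E :: "'a set set"
  defines "R \<equiv> {(x, y). \<exists>b\<in>E. x \<in> b \<and> y \<in> b}\<^sup>*"
  shows "closed_under E (R `` {x})"
    and "closed_under E X \<Longrightarrow> y \<in> X \<Longrightarrow> R `` {y} \<subseteq> X"
    and "y \<in> R `` {x} \<Longrightarrow> R `` {y} = R `` {x}"
proof -
  show "closed_under E (R `` {x})"
    unfolding closed_under_def
  proof (intro ballI impI subsetI)
    fix b y assume b: "b \<in> E" "b \<inter> R `` {x} \<noteq> {}" "y \<in> b"
    then obtain z where "z \<in> b" "(x, z) \<in> R" by auto
    moreover have "(z, y) \<in> {(x, y). \<exists>b\<in>E. x \<in> b \<and> y \<in> b}" using b \<open>z \<in> b\<close> by auto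
    ultimately show "y \<in> R `` {x}" unfolding R_def by (auto intro: rtrancl_into_rtrancl)
  qed
  show "R `` {y} \<subseteq> X" if "closed_under E X" "y \<in> X" for X y
  proof
    fix z assume "z \<in> R `` {y}"
    then have "(y, z) \<in> R" by auto
    then show "z \<in> X" unfolding R_def
      by (induction rule: rtrancl_induct) (use that in \<open>auto simp: closed_under_def\<close>)
  qed
  have sym: "sym R" unfolding R_def by (rule sym_rtrancl) (auto intro: symI)
  have tr: "trans R" unfolding R_def by (rule trans_rtrancl)
  show "R `` {y} = R `` {x}" if "y \<in> R `` {x}"
    using sym tr that by (blast dest: symD transD)
qed

text \<open>Together these three facts characterize the components, by \<open>comps_eqI\<close>, and
  replace the closure relation from here on.\<close>

lemma comps_partition: "partition_on (\<Union>E) (comps E)"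
  and comps_closed: "C \<in> comps E \<Longrightarrow> closed_under E C"
  and comps_min: "C \<in> comps E \<Longrightarrow> closed_under E X \<Longrightarrow> C \<inter> X \<noteq> {} \<Longrightarrow> C \<subseteq> X"
proof -
  note cl = rtrancl_class_closed[where E = E]
  let ?R = "{(x, y). \<exists>b\<in>E. x \<in> b \<and> y \<in> b}\<^sup>*"
  have sub: "?R `` {x} \<subseteq> \<Union>E" if "x \<in> \<Union>E" for x
    using cl(2)[of "\<Union>E" x] that by (auto simp: closed_under_def)
  show "partition_on (\<Union>E) (comps E)"
  proof (rule partition_onI)
    show "\<Union>(comps E) = \<Union>E"
      using sub unfolding comps_def quotient_def by auto
    show "disjnt C D" if "C \<in> comps E" "D \<in> comps E" "C \<noteq> D" for C D
    proof -
      obtain x y where "C = ?R `` {x}" "D = ?R `` {y}"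
        using \<open>C \<in> comps E\<close> \<open>D \<in> comps E\<close> unfolding comps_def quotient_def by blast
      moreover have "C = D" if "z \<in> C" "z \<in> D" for z
        using cl(3)[of z x] cl(3)[of z y] that calculation by simp
      ultimately show ?thesis
        using \<open>C \<noteq> D\<close> unfolding disjnt_iff by blast
    qed
    show "{} \<notin> comps E" unfolding comps_def quotient_def by auto
  qed
  show "closed_under E C" if "C \<in> comps E" for C
    using that cl(1) unfolding comps_def quotient_def by blast
  show "C \<subseteq> X" if C: "C \<in> comps E" and X: "closed_under E X" "C \<inter> X \<noteq> {}" for C X
  proof -
    obtain x where x: "C = ?R `` {x}" using C unfolding comps_def quotient_def by blast
    obtain z where "z \<in> C" "z \<in> X" using X by auto
    then show ?thesis using cl(3)[of z x] cl(2)[of X z] X x by simp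
  qed
qed

text \<open>Minimality on both sides: a component and a member of \<open>P\<close> that share a
  point contain each other.\<close>

lemma comps_eqI:
  assumes P: "partition_on (\<Union>E) P" and cl: "\<And>C. C \<in> P \<Longrightarrow> closed_under E C"
    and mn: "\<And>C X. C \<in> P \<Longrightarrow> closed_under E X \<Longrightarrow> C \<inter> X \<noteq> {} \<Longrightarrow> C \<subseteq> X"
  shows "comps E = P"
proof -
  note Q = comps_partition[of E]
  have eq: "C = D" if "C \<in> comps E" "D \<in> P" "x \<in> C" "x \<in> D" for C D x
    using comps_min[OF that(1) cl[OF that(2)]] mn[OF that(2) comps_closed[OF that(1)]] that by auto
  have un: "\<Union>(comps E) = \<Union>P" using P Q by (simp add: partition_on_def)
  have ne: "{} \<notin> P" "{} \<notin> comps E" using P Q by (auto simp: partition_on_def)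
  show ?thesis
  proof (rule subset_antisym; rule subsetI)
    fix C assume C: "C \<in> comps E"
    then obtain x where x: "x \<in> C" using ne by (metis ex_in_conv)
    then obtain D where "D \<in> P" "x \<in> D" using C un by blast
    then show "C \<in> P" using eq[OF C _ x] by simp
  next
    fix D assume D: "D \<in> P"
    then obtain x where x: "x \<in> D" using ne by (metis ex_in_conv)
    then obtain C where "C \<in> comps E" "x \<in> C" using D un by blast
    then show "D \<in> comps E" using eq[OF _ D _ x] by simp
  qed
qed

lemma Union_comps: "\<Union>(comps E) = \<Union>E"
  using comps_partition[of E] by (simp add: partition_on_def)

lemma comps_eq_member:
  assumes "C \<in> comps E" "D \<in> comps E" "x \<in> C" "x \<in> D"
  shows "C = D"
proof -
  have "C \<inter> D \<noteq> {}" using assms(3,4) by blast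
  then show ?thesis
    using disjointD[OF partition_onD2[OF comps_partition] assms(1,2)] by blast
qed

lemma comps_coverE:
  assumes "x \<in> \<Union>E" obtains C where "C \<in> comps E" "x \<in> C"
  using assms Union_comps[of E] by (metis UnionE)

lemma comps_cover: "x \<in> b \<Longrightarrow> b \<in> E \<Longrightarrow> \<exists>C\<in>comps E. x \<in> C"
  by (rule comps_coverE[of x E]) auto

lemma comps_subset: "C \<in> comps E \<Longrightarrow> C \<subseteq> \<Union>E"
  using Union_upper[of C "comps E"] by (simp add: Union_comps)

lemma comps_nonempty: "C \<in> comps E \<Longrightarrow> C \<noteq> {}"
  using comps_partition[of E] by (auto simp: partition_on_def)

lemma comps_disjoint:
  assumes "partition_on V E" shows "comps E = E"
proof (rule comps_eqI)
  show "partition_on (\<Union>E) E" using assms by (simp add: partition_on_def)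
  show "closed_under E C" if "C \<in> E" for C
    using assms that unfolding closed_under_def partition_on_def disjoint_def by blast
  show "C \<subseteq> X" if "C \<in> E" "closed_under E X" "C \<inter> X \<noteq> {}" for C X
    using that unfolding closed_under_def by blast
qed

lemma comps_image:
  assumes "inj \<phi>"
  shows "comps ((`) \<phi> ` E) = (`) \<phi> ` comps E"
proof (rule comps_eqI)
  have "partition_on (\<phi> ` \<Union>E) ((`) \<phi> ` comps E - {{}})"
    by (rule partition_on_inj_image[OF comps_partition]) (meson assms inj_on_subset subset_UNIV)
  moreover have "{} \<notin> (`) \<phi> ` comps E" using comps_nonempty by blast
  moreover have "\<phi> ` \<Union>E = \<Union>((`) \<phi> ` E)" by blast
  ultimately show "partition_on (\<Union>((`) \<phi> ` E)) ((`) \<phi> ` comps E)" by simp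
  show "closed_under ((`) \<phi> ` E) D" if D: "D \<in> (`) \<phi> ` comps E" for D
  proof -
    obtain C where C: "C \<in> comps E" "D = \<phi> ` C" using D by blast
    show ?thesis using comps_closed[OF C(1)] assms unfolding C closed_under_def
      by (auto dest: injD)
  qed
  show "D \<subseteq> X" if D: "D \<in> (`) \<phi> ` comps E" and X: "closed_under ((`) \<phi> ` E) X" and ne: "D \<inter> X \<noteq> {}" for D X
  proof -
    obtain C where C: "C \<in> comps E" "D = \<phi> ` C" using D by blast
    have "closed_under E (\<phi> -` X)" 
      unfolding closed_under_def
    proof (intro ballI impI)
      fix b assume "b \<in> E" "b \<inter> \<phi> -` X \<noteq> {}"
      then have "\<phi> ` b \<in> (`) \<phi> ` E" "\<phi> ` b \<inter> X \<noteq> {}" by auto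
      then have "\<phi> ` b \<subseteq> X" using X unfolding closed_under_def by blast
      then show "b \<subseteq> \<phi> -` X" by auto
    qed
    then have "C \<subseteq> \<phi> -` X" by (rule comps_min[OF C(1)]) (use ne C in auto)
    then show ?thesis using C by auto
  qed
qed

section \<open>Traces of components and gluing in stages\<close>

lemma Union_trace: "\<Union>(trace W P) = \<Union>P \<inter> W"
  unfolding trace_def by auto

lemma mem_trace: "X \<in> trace W P \<longleftrightarrow> X \<noteq> {} \<and> (\<exists>C\<in>P. X = C \<inter> W)"
  unfolding trace_def by (simp add: image_iff conj_commute)

lemma trace_trace:
  assumes "V \<subseteq> W" shows "trace V (trace W P) = trace V P"
proof -
  have *: "C \<inter> W \<inter> V = C \<inter> V" for C using assms by blast
  show ?thesis
  proof (rule subset_antisym; rule subsetI)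
    fix X assume "X \<in> trace V (trace W P)"
    then show "X \<in> trace V P" using * by (metis mem_trace)
  next
    fix X assume "X \<in> trace V P"
    then obtain C where C: "X \<noteq> {}" "C \<in> P" "X = C \<inter> V" by (metis mem_trace)
    moreover have "C \<inter> W \<noteq> {}" using C assms by blast
    ultimately have "C \<inter> W \<in> trace W P" by (metis mem_trace)
    then show "X \<in> trace V (trace W P)" using C * by (metis mem_trace)
  qed
qed

lemma trace_cong: "(\<And>C. C \<in> P \<Longrightarrow> C \<inter> W = C \<inter> W') \<Longrightarrow> trace W P = trace W' P"
  unfolding trace_def by (simp cong: image_cong)

text \<open>Gluing may be done in stages: \<open>E1\<close> may be replaced by the traces of its components on any
  set \<open>U\<close> of vertices through which it is attached to \<open>E2\<close>.\<close>

lemma comps_trace: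
  assumes U: "\<Union>E1 \<inter> \<Union>E2 \<subseteq> U"
  shows "comps (trace U (comps E1) \<union> E2) = trace (U \<union> \<Union>E2) (comps (E1 \<union> E2))"
proof (rule comps_eqI)
  let ?W = "U \<union> \<Union>E2" and ?Q = "trace U (comps E1)"
  let ?P = "trace ?W (comps (E1 \<union> E2))"
  have un1: "\<Union>(comps E1) = \<Union>E1" using comps_partition[of E1] by (simp add: partition_on_def)
  have un12: "\<Union>(comps (E1 \<union> E2)) = \<Union>E1 \<union> \<Union>E2"
    using comps_partition[of "E1 \<union> E2"] by (auto simp: partition_on_def)
  show "partition_on (\<Union>(?Q \<union> E2)) ?P"
  proof (rule partition_onI)
    show "\<Union>?P = \<Union>(?Q \<union> E2)" using U by (auto simp: Union_trace un1 un12)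
    show "disjnt C D" if CD: "C \<in> ?P" "D \<in> ?P" "C \<noteq> D" for C D
    proof -
      obtain C' D' where *: "C' \<in> comps (E1 \<union> E2)" "D' \<in> comps (E1 \<union> E2)" "C = C' \<inter> ?W" "D = D' \<inter> ?W"
        using CD unfolding trace_def by blast
      then have "C' \<inter> D' = {}" using comps_eq_member[OF *(1,2)] CD by blast
      then show ?thesis using * unfolding disjnt_def by blast
    qed
    show "{} \<notin> ?P" by (simp add: trace_def)
  qed
  fix D assume "D \<in> ?P"
  then obtain C where C: "C \<in> comps (E1 \<union> E2)" "D = C \<inter> ?W" unfolding trace_def by auto
  have clC: "closed_under E1 C" "closed_under E2 C"
    using comps_closed[OF C(1)] by (auto simp: closed_under_def)
  show "closed_under (?Q \<union> E2) D"
    unfolding closed_under_def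
  proof (intro ballI impI)
    fix b assume b: "b \<in> ?Q \<union> E2" "b \<inter> D \<noteq> {}"
    show "b \<subseteq> D"
    proof (cases "b \<in> E2")
      case True then show ?thesis using b clC C unfolding closed_under_def by blast
    next
      case False
      then obtain B where B: "B \<in> comps E1" "b = B \<inter> U" using b unfolding trace_def by auto
      have "B \<subseteq> C" using comps_min[OF B(1) clC(1)] b B C by blast
      then show ?thesis using B C by blast
    qed
  qed
  fix X assume X: "closed_under (?Q \<union> E2) X" and ne: "D \<inter> X \<noteq> {}"
  \<comment> \<open>\<open>X'\<close> lifts \<open>X\<close> to the full graph: whole components of
    \<open>E1\<close> that \<open>X\<close> meets at the interface, together with the vertices of
    \<open>X\<close> on \<open>E2\<close>. It is closed for \<open>E1 \<union> E2\<close> and cuts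
    back into \<open>X\<close>, so minimality of \<open>C\<close> yields minimality of its
    trace.\<close>
  define X' where "X' = \<Union>{B \<in> comps E1. B \<inter> U \<inter> X \<noteq> {}} \<union> (X \<inter> \<Union>E2)"
  have BX: "B \<inter> U \<subseteq> X" if B: "B \<in> comps E1" "B \<inter> U \<inter> X \<noteq> {}" for B
  proof -
    have "B \<inter> U \<in> ?Q" using B unfolding trace_def by blast
    then show ?thesis by (rule closed_under_subset[OF X UnI1 B(2)])
  qed
  have "closed_under E1 X'"
    unfolding closed_under_def
  proof (intro ballI impI)
    fix b assume b: "b \<in> E1" "b \<inter> X' \<noteq> {}"
    then obtain y where y: "y \<in> b" "y \<in> X'" by auto
    obtain B where B: "B \<in> comps E1" "y \<in> B" using comps_cover[OF y(1) b(1)] by auto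
    have bB: "b \<subseteq> B" using closed_underD[OF comps_closed[OF B(1)] b(1) y(1) B(2)] .
    have "B \<inter> U \<inter> X \<noteq> {}"
    proof (cases "y \<in> X \<inter> \<Union>E2")
      case True then show ?thesis using B y b U by blast
    next
      case False
      then obtain B' where "B' \<in> comps E1" "B' \<inter> U \<inter> X \<noteq> {}" "y \<in> B'" using y unfolding X'_def by auto
      then show ?thesis using comps_eq_member[OF B(1) _ B(2)] by metis
    qed
    then show "b \<subseteq> X'" using bB B unfolding X'_def by blast
  qed
  moreover have "closed_under E2 X'"
    unfolding closed_under_def
  proof (intro ballI impI)
    fix b assume b: "b \<in> E2" "b \<inter> X' \<noteq> {}"
    then obtain y where y: "y \<in> b" "y \<in> X'" by auto
    have "y \<in> X"
    proof (cases "y \<in> X \<inter> \<Union>E2")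
      case False
      then obtain B where B: "B \<in> comps E1" "B \<inter> U \<inter> X \<noteq> {}" "y \<in> B" using y unfolding X'_def by auto
      then show ?thesis using BX[OF B(1,2)] comps_subset[OF B(1)] U y b by blast
    qed auto
    then have "b \<subseteq> X" using closed_underD[OF X UnI2[OF b(1)] y(1)] by simp
    then show "b \<subseteq> X'" using b unfolding X'_def by blast
  qed
  ultimately have "closed_under (E1 \<union> E2) X'" unfolding closed_under_def by blast
  moreover have "C \<inter> X' \<noteq> {}"
  proof -
    obtain z where z: "z \<in> C" "z \<in> ?W" "z \<in> X" using ne C by auto
    have "z \<in> X'"
    proof (cases "z \<in> \<Union>E2")
      case False
      then have "z \<in> U" "z \<in> \<Union>E1" using z comps_subset[OF C(1)] by auto
      then obtain B where "B \<in> comps E1" "z \<in> B" using un1 by (metis UnionE)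
      then show ?thesis using z \<open>z \<in> U\<close> unfolding X'_def by auto
    qed (use z in \<open>auto simp: X'_def\<close>)
    then show ?thesis using z by blast
  qed
  ultimately have "C \<subseteq> X'" by (rule comps_min[OF C(1)])
  moreover have "X' \<inter> ?W \<subseteq> X"
  proof
    fix w assume w: "w \<in> X' \<inter> ?W"
    show "w \<in> X"
    proof (cases "w \<in> X \<inter> \<Union>E2")
      case False
      then obtain B where B: "B \<in> comps E1" "B \<inter> U \<inter> X \<noteq> {}" "w \<in> B" using w unfolding X'_def by auto
      then have "w \<in> U" using comps_subset[OF B(1)] w U by blast
      then show ?thesis using BX[OF B(1,2)] B by auto
    qed auto
  qed
  ultimately show "D \<subseteq> X" using C by blast
qed

text \<open>A component that touches neither the interface nor \<open>E2\<close> has nothing glued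
  to it, so it is complete after the first stage. In the application these are the loops closed in
  that stage.\<close>

lemma comps_avoiding:
  assumes U: "\<Union>E1 \<inter> \<Union>E2 \<subseteq> U"
  shows "{C \<in> comps (E1 \<union> E2). C \<inter> (U \<union> \<Union>E2) = {}} = {C \<in> comps E1. C \<inter> U = {}}"
proof (rule subset_antisym; rule subsetI)
  fix C assume "C \<in> {C \<in> comps (E1 \<union> E2). C \<inter> (U \<union> \<Union>E2) = {}}"
  then have C: "C \<in> comps (E1 \<union> E2)" "C \<inter> (U \<union> \<Union>E2) = {}" by auto
  obtain x where x: "x \<in> C" using comps_nonempty[OF C(1)] by auto
  then have "x \<in> \<Union>E1" using comps_subset[OF C(1)] C by blast
  then obtain B where B: "B \<in> comps E1" "x \<in> B" by (rule comps_coverE)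
  have "closed_under E1 C" using comps_closed[OF C(1)] by (auto simp: closed_under_def)
  then have "B \<subseteq> C" using comps_min[OF B(1)] B x by blast
  then have "closed_under (E1 \<union> E2) B"
    using comps_closed[OF B(1)] C unfolding closed_under_def by blast
  then have "C \<subseteq> B" using comps_min[OF C(1)] B x by blast
  then show "C \<in> {C \<in> comps E1. C \<inter> U = {}}" using B \<open>B \<subseteq> C\<close> C by auto
next
  fix C assume "C \<in> {C \<in> comps E1. C \<inter> U = {}}"
  then have C: "C \<in> comps E1" "C \<inter> U = {}" by auto
  have dis: "C \<inter> \<Union>E2 = {}" using comps_subset[OF C(1)] C U by blast
  then have cl: "closed_under (E1 \<union> E2) C"
    using comps_closed[OF C(1)] unfolding closed_under_def by blast
  obtain x where x: "x \<in> C" using comps_nonempty[OF C(1)] by auto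
  then have "x \<in> \<Union>(E1 \<union> E2)" using comps_subset[OF C(1)] by auto
  then obtain B where B: "B \<in> comps (E1 \<union> E2)" "x \<in> B" by (rule comps_coverE)
  have "closed_under E1 B" using comps_closed[OF B(1)] by (auto simp: closed_under_def)
  then have "C \<subseteq> B" using comps_min[OF C(1)] B x by blast
  moreover have "B \<subseteq> C" using comps_min[OF B(1) cl] B x by blast
  ultimately have "B = C" by simp
  moreover have "C \<inter> (U \<union> \<Union>E2) = {}" using C(2) dis by (simp add: Int_Un_distrib)
  ultimately show "C \<in> {C \<in> comps (E1 \<union> E2). C \<inter> (U \<union> \<Union>E2) = {}}" using B(1) by simp
qed

text \<open>A member avoiding \<open>V'\<close> either misses \<open>W\<close> altogether or leaves
  a nonempty trace; disjointness of the members makes nonempty traces distinct, so the second kind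
  is counted by its traces.\<close>

lemma card_trace_avoiding:
  assumes P: "partition_on V P" and VW: "V' \<subseteq> W" and fin: "finite P"
  shows "card {C \<in> P. C \<inter> V' = {}} = card {C \<in> P. C \<inter> W = {}} + card {D \<in> trace W P. D \<inter> V' = {}}"
proof -
  let ?A = "{C \<in> P. C \<inter> V' = {} \<and> C \<inter> W \<noteq> {}}"
  have "{C \<in> P. C \<inter> V' = {}} = {C \<in> P. C \<inter> W = {}} \<union> ?A" using VW by auto
  then have "card {C \<in> P. C \<inter> V' = {}} = card {C \<in> P. C \<inter> W = {}} + card ?A"
    by (simp add: card_Un_disjoint fin disjoint_iff)
  moreover have "bij_betw (\<lambda>C. C \<inter> W) ?A {D \<in> trace W P. D \<inter> V' = {}}"
  proof (rule bij_betwI')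
    show "(C \<inter> W = D \<inter> W) = (C = D)" if "C \<in> ?A" "D \<in> ?A" for C D
    proof
      assume "C \<inter> W = D \<inter> W"
      then have "\<not> disjnt C D" using that unfolding disjnt_def by blast
      then show "C = D" using that P unfolding partition_on_def by (metis (mono_tags, lifting) mem_Collect_eq pairwiseD)
    qed simp
    show "C \<inter> W \<in> {D \<in> trace W P. D \<inter> V' = {}}" if "C \<in> ?A" for C
      using that by (auto simp: trace_def)
    show "\<exists>C\<in>?A. D = C \<inter> W" if D: "D \<in> {D \<in> trace W P. D \<inter> V' = {}}" for D
    proof -
      obtain C where C: "C \<in> P" "D = C \<inter> W" using D unfolding trace_def by blast
      then have "C \<inter> V' = {}" "C \<inter> W \<noteq> {}" using D VW unfolding trace_def by blast+
      then show ?thesis using C by blast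
    qed
  qed
  ultimately show ?thesis by (simp add: bij_betw_same_card)
qed

section \<open>Composition of diagrams\<close>

text \<open>For gluing several diagrams, \<open>place a b d\<close> puts the top points of \<open>d\<close> on level \<open>a\<close> and the
  bottom points on level \<open>b\<close>.\<close>

definition place :: "nat \<Rightarrow> nat \<Rightarrow> diagram \<Rightarrow> (nat \<times> nat) set set" where
  "place a b d = (`) (case_point (Pair a) (Pair b)) ` d"

lemma inj_case_point: "a \<noteq> b \<Longrightarrow> inj (case_point (Pair a) (Pair b))"
  by (auto simp: inj_def split: point.splits)

lemma inj_image: "inj f \<Longrightarrow> inj ((`) f)"
  by (rule injI) (simp only: inj_image_eq_iff)

lemma place_inject: "a \<noteq> b \<Longrightarrow> place a b d = place a b d' \<Longrightarrow> d = d'"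
  unfolding place_def by (simp add: inj_image_eq_iff inj_image inj_case_point)

lemma Union_place: "\<Union>(place a b d) \<subseteq> {a, b} \<times> UNIV"
  unfolding place_def by (auto split: point.splits)

lemma image_minus_empty: "(`) f ` (A - {{}}) = (`) f ` A - {{}}"
  by (auto simp del: ex_simps)

lemma place_comp:
  assumes abc: "a \<noteq> b" "b \<noteq> c" "a \<noteq> c"
  shows place_diagram_comp:
      "place a c (f \<bullet>\<^sub>B g) = trace ({a, c} \<times> UNIV) (comps (place a b g \<union> place b c f))"
    and loops_eq_card:
      "loops f g = card {C \<in> comps (place a b g \<union> place b c f). C \<inter> {a, c} \<times> UNIV = {}}"
proof -
  define \<phi> where "\<phi> = case_glued_point (Pair a) (Pair b) (Pair c)"
  have inj: "inj \<phi>" using abc by (auto simp: inj_def \<phi>_def split: glued_point.splits)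
  have above: "\<phi> (glue_above x) = case_point (Pair a) (Pair b) x"
    and below: "\<phi> (glue_below x) = case_point (Pair b) (Pair c) x"
    and out: "\<phi> (outer x) = case_point (Pair a) (Pair c) x" for x
    by (auto simp: \<phi>_def split: point.splits)
  have edges: "(`) \<phi> ` glued_edges f g = place a b g \<union> place b c f"
    unfolding glued_edges_def place_def image_Un image_image above below ..
  then have comps: "comps (place a b g \<union> place b c f) = (`) \<phi> ` glued_components f g"
    using comps_image[OF inj, of "glued_edges f g"]
    by (simp add: glued_components_def comps_def)
  have rng: "x \<in> range outer \<longleftrightarrow> \<phi> x \<in> {a, c} \<times> UNIV" for x
  proof (cases x)
    case (Upper i)
    then have "x \<in> range outer" by (metis outer.simps(1) rangeI)
    then show ?thesis using Upper by (simp add: \<phi>_def)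
  next
    case (Middle i)
    have "outer y \<noteq> Middle i" for y by (cases y) auto
    then have "x \<notin> range outer" using Middle by (metis rangeE)
    then show ?thesis using Middle abc by (simp add: \<phi>_def)
  next
    case (Lower i)
    then have "x \<in> range outer" by (metis outer.simps(2) rangeI)
    then show ?thesis using Lower by (simp add: \<phi>_def)
  qed
  have key: "case_point (Pair a) (Pair c) ` (outer -` C) = \<phi> ` C \<inter> {a, c} \<times> UNIV" for C
  proof -
    have "case_point (Pair a) (Pair c) ` (outer -` C) = \<phi> ` (outer ` (outer -` C))"
      by (simp only: image_image out)
    also have "outer ` (outer -` C) = C \<inter> range outer" by auto
    also have "\<phi> ` (C \<inter> range outer) = \<phi> ` C \<inter> {a, c} \<times> UNIV"
    proof (rule subset_antisym; rule subsetI)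
      fix y assume "y \<in> \<phi> ` (C \<inter> range outer)"
      then obtain x where "x \<in> C" "x \<in> range outer" "y = \<phi> x" by blast
      then show "y \<in> \<phi> ` C \<inter> {a, c} \<times> UNIV" using rng[of x] by simp
    next
      fix y assume y: "y \<in> \<phi> ` C \<inter> {a, c} \<times> UNIV"
      then obtain x where "x \<in> C" "y = \<phi> x" by (elim IntE imageE)
      then have "x \<in> C \<inter> range outer" using rng[of x] y by simp
      then show "y \<in> \<phi> ` (C \<inter> range outer)" using \<open>y = \<phi> x\<close> by (rule rev_image_eqI)
    qed
    finally show ?thesis .
  qed
  have "place a c (f \<bullet>\<^sub>B g) = (\<lambda>C. case_point (Pair a) (Pair c) ` (outer -` C)) ` glued_components f g - {{}}"
    unfolding place_def diagram_comp_def image_minus_empty image_image ..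
  then show "place a c (f \<bullet>\<^sub>B g) = trace ({a, c} \<times> UNIV) (comps (place a b g \<union> place b c f))"
    unfolding trace_def comps image_image key .
  have "{C \<in> comps (place a b g \<union> place b c f). C \<inter> {a, c} \<times> UNIV = {}}
      = (`) \<phi> ` {C \<in> glued_components f g. outer -` C = {}}"
  proof -
    have "outer -` C = {} \<longleftrightarrow> \<phi> ` C \<inter> {a, c} \<times> UNIV = {}" for C
      unfolding key[symmetric] by simp
    then have "{D \<in> (`) \<phi> ` K. D \<inter> {a, c} \<times> UNIV = {}} = (`) \<phi> ` {C \<in> K. outer -` C = {}}" for K
      by auto
    then show ?thesis unfolding comps .
  qed
  moreover have "inj ((`) \<phi>)" by (rule inj_image[OF inj])
  ultimately show "loops f g = card {C \<in> comps (place a b g \<union> place b c f). C \<inter> {a, c} \<times> UNIV = {}}"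
    unfolding loops_def by (simp add: card_image inj_on_subset)
qed

text \<open>\<open>D\<close> and \<open>B\<close> are the levels used by the two stages,
  \<open>A\<close> the levels still visible after the first, \<open>V\<close> those visible at the
  end. Since \<open>D \<inter> B \<subseteq> A\<close>, the second stage attaches only to visible
  levels, and each loop closes in exactly one of the two stages.\<close>

lemma glue_stage:
  fixes E1 E2 :: "('a \<times> 'b) set set"
  assumes E1: "\<Union>E1 \<subseteq> D \<times> UNIV" and E2: "\<Union>E2 \<subseteq> B \<times> UNIV" and DB: "D \<inter> B \<subseteq> A" and V: "V \<subseteq> A \<union> B"
  defines "F \<equiv> trace (A \<times> UNIV) (comps E1) \<union> E2"
  shows trace_glue_stage: "trace (V \<times> UNIV) (comps F) = trace (V \<times> UNIV) (comps (E1 \<union> E2))"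
    and card_glue_stage: "finite (\<Union>(E1 \<union> E2)) \<Longrightarrow>
      card {C \<in> comps (E1 \<union> E2). C \<inter> V \<times> UNIV = {}} =
      card {C \<in> comps E1. C \<inter> A \<times> UNIV = {}} + card {C \<in> comps F. C \<inter> V \<times> UNIV = {}}"
proof -
  let ?U = "A \<times> (UNIV :: 'b set)" and ?W = "(A \<union> B) \<times> (UNIV :: 'b set)"
  have U: "\<Union>E1 \<inter> \<Union>E2 \<subseteq> ?U" using E1 E2 DB by blast
  \<comment> \<open>\<open>comps_trace\<close> cuts with actual vertices of \<open>E2\<close>; on
    components this agrees with cutting with whole levels.\<close>
  have W: "C \<inter> (?U \<union> \<Union>E2) = C \<inter> ?W" if "C \<in> comps (E1 \<union> E2)" for C
  proof -
    have "C \<subseteq> \<Union>E1 \<union> \<Union>E2" using comps_subset[OF that] by simp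
    moreover have "\<Union>E1 \<inter> ?W \<subseteq> ?U" using E1 DB by blast
    moreover have "\<Union>E2 \<subseteq> ?W" "?U \<subseteq> ?W" using E2 by blast+
    ultimately show ?thesis by blast
  qed
  have F: "comps F = trace ?W (comps (E1 \<union> E2))"
    unfolding F_def comps_trace[OF U] using W by (rule trace_cong)
  have VW: "V \<times> UNIV \<subseteq> ?W" using V by blast
  show "trace (V \<times> UNIV) (comps F) = trace (V \<times> UNIV) (comps (E1 \<union> E2))"
    unfolding F by (rule trace_trace[OF VW])
  assume "finite (\<Union>(E1 \<union> E2))"
  moreover have "comps (E1 \<union> E2) \<subseteq> Pow (\<Union>(E1 \<union> E2))" using comps_subset by blast
  ultimately have "finite (comps (E1 \<union> E2))" by (meson finite_Pow_iff finite_subset)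
  then have "card {C \<in> comps (E1 \<union> E2). C \<inter> V \<times> UNIV = {}} =
      card {C \<in> comps (E1 \<union> E2). C \<inter> ?W = {}} + card {C \<in> comps F. C \<inter> V \<times> UNIV = {}}"
    unfolding F by (rule card_trace_avoiding[OF comps_partition VW])
  moreover have "{C \<in> comps (E1 \<union> E2). C \<inter> ?W = {}} = {C \<in> comps E1. C \<inter> ?U = {}}"
    using comps_avoiding[OF U] W by (simp cong: conj_cong)
  ultimately show "card {C \<in> comps (E1 \<union> E2). C \<inter> V \<times> UNIV = {}} =
      card {C \<in> comps E1. C \<inter> ?U = {}} + card {C \<in> comps F. C \<inter> V \<times> UNIV = {}}" by simp
qed

text \<open>Levels 0 to 3 run from the top of \<open>h\<close> to the bottom of \<open>f\<close>.
  Both bracketings are compared with the single graph \<open>T\<close>; they differ only in whether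
  level 2 or level 1 disappears first.\<close>

lemma diagram_comp_stages:
  fixes f g h :: diagram
  defines "T \<equiv> comps (place 0 1 h \<union> place 1 2 g \<union> place 2 3 f)"
  shows "place 0 3 ((f \<bullet>\<^sub>B g) \<bullet>\<^sub>B h) = trace ({0, 3} \<times> UNIV) T" (is ?A)
    and "place 0 3 (f \<bullet>\<^sub>B (g \<bullet>\<^sub>B h)) = trace ({0, 3} \<times> UNIV) T" (is ?B)
    and "finite (\<Union>f) \<Longrightarrow> finite (\<Union>g) \<Longrightarrow> finite (\<Union>h) \<Longrightarrow>
      card {C \<in> T. C \<inter> {0, 3} \<times> UNIV = {}} = loops f g + loops (f \<bullet>\<^sub>B g) h" (is "_ \<Longrightarrow> _ \<Longrightarrow> _ \<Longrightarrow> ?C")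
    and "finite (\<Union>f) \<Longrightarrow> finite (\<Union>g) \<Longrightarrow> finite (\<Union>h) \<Longrightarrow>
      card {C \<in> T. C \<inter> {0, 3} \<times> UNIV = {}} = loops g h + loops f (g \<bullet>\<^sub>B h)" (is "_ \<Longrightarrow> _ \<Longrightarrow> _ \<Longrightarrow> ?D")
proof -
  let ?h = "place 0 1 h" and ?g = "place 1 2 g" and ?f = "place 2 3 f"
  have T1: "T = comps (?g \<union> ?f \<union> ?h)" and T2: "T = comps (?h \<union> ?g \<union> ?f)"
    unfolding T_def by (simp_all add: ac_simps)
  have fg: "trace ({1, 3} \<times> UNIV) (comps (?g \<union> ?f)) = place 1 3 (f \<bullet>\<^sub>B g)"
    by (rule place_diagram_comp[symmetric]) auto
  have gh: "trace ({0, 2} \<times> UNIV) (comps (?h \<union> ?g)) = place 0 2 (g \<bullet>\<^sub>B h)"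
    by (rule place_diagram_comp[symmetric]) auto
  have l: "\<Union>(?g \<union> ?f) \<subseteq> {1, 2, 3} \<times> UNIV" "\<Union>(?h \<union> ?g) \<subseteq> {0, 1, 2} \<times> UNIV"
    using Union_place[of 1 2 g] Union_place[of 2 3 f] Union_place[of 0 1 h] by blast+
  have s1: "place 0 3 ((f \<bullet>\<^sub>B g) \<bullet>\<^sub>B h) = trace ({0, 3} \<times> UNIV) (comps (place 1 3 (f \<bullet>\<^sub>B g) \<union> ?h))"
    using place_diagram_comp[of 0 1 3 "f \<bullet>\<^sub>B g" h] by (simp add: Un_commute)
  have s2: "place 0 3 (f \<bullet>\<^sub>B (g \<bullet>\<^sub>B h)) = trace ({0, 3} \<times> UNIV) (comps (place 0 2 (g \<bullet>\<^sub>B h) \<union> ?f))"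
    using place_diagram_comp[of 0 2 3 f "g \<bullet>\<^sub>B h"] by (simp add: Un_commute)
  show ?A unfolding s1 T1 fg[symmetric]
    by (rule trace_glue_stage[OF l(1) Union_place]) auto
  show ?B unfolding s2 T2 gh[symmetric]
    by (rule trace_glue_stage[OF l(2) Union_place]) auto
  assume fin: "finite (\<Union>f)" "finite (\<Union>g)" "finite (\<Union>h)"
  have finp: "finite (\<Union>(place a b d))" if "finite (\<Union>d)" for a b d
  proof -
    have "\<Union>(place a b d) = case_point (Pair a) (Pair b) ` \<Union>d" unfolding place_def by blast
    then show ?thesis using that by simp
  qed
  have finT: "finite (\<Union>(?g \<union> ?f \<union> ?h))" "finite (\<Union>(?h \<union> ?g \<union> ?f))"
    using finp fin by auto
  have c1: "loops f g = card {C \<in> comps (?g \<union> ?f). C \<inter> {1, 3} \<times> UNIV = {}}"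
    and c2: "loops g h = card {C \<in> comps (?h \<union> ?g). C \<inter> {0, 2} \<times> UNIV = {}}"
    by (rule loops_eq_card; simp)+
  have c3: "loops (f \<bullet>\<^sub>B g) h = card {C \<in> comps (place 1 3 (f \<bullet>\<^sub>B g) \<union> ?h). C \<inter> {0, 3} \<times> UNIV = {}}"
    using loops_eq_card[of 0 1 3 "f \<bullet>\<^sub>B g" h] by (simp add: Un_commute)
  have c4: "loops f (g \<bullet>\<^sub>B h) = card {C \<in> comps (place 0 2 (g \<bullet>\<^sub>B h) \<union> ?f). C \<inter> {0, 3} \<times> UNIV = {}}"
    using loops_eq_card[of 0 2 3 f "g \<bullet>\<^sub>B h"] by (simp add: Un_commute)
  show ?C unfolding c1 c3 T1 fg[symmetric]
    by (rule card_glue_stage[OF l(1) Union_place _ _ finT(1)]) auto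
  show ?D unfolding c2 c4 T2 gh[symmetric]
    by (rule card_glue_stage[OF l(2) Union_place _ _ finT(2)]) auto
qed

lemma diagram_comp_assoc: "(f \<bullet>\<^sub>B g) \<bullet>\<^sub>B h = f \<bullet>\<^sub>B (g \<bullet>\<^sub>B h)"
  by (rule place_inject[of 0 3]) (simp_all add: diagram_comp_stages)

lemma loops_assoc:
  assumes "finite (\<Union>f)" "finite (\<Union>g)" "finite (\<Union>h)"
  shows "loops f g + loops (f \<bullet>\<^sub>B g) h = loops g h + loops f (g \<bullet>\<^sub>B h)"
  using diagram_comp_stages(3,4)[OF assms] by simp

section \<open>Brauer diagrams are closed under composition\<close>

definition is_match :: "'a set \<Rightarrow> 'a set set \<Rightarrow> bool" where
  "is_match S P \<longleftrightarrow> partition_on S P \<and> (\<forall>b\<in>P. card b = 2)"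

lemma brauer_is_match: "brauer p q = {d. is_match (points p q) d}"
  by (simp add: brauer_def is_match_def)

lemma is_match_Union: "is_match S P \<Longrightarrow> \<Union>P = S"
  by (simp add: is_match_def partition_on_def)

lemma is_match_eq: "is_match S P \<Longrightarrow> b \<in> P \<Longrightarrow> c \<in> P \<Longrightarrow> x \<in> b \<Longrightarrow> x \<in> c \<Longrightarrow> b = c"
  unfolding is_match_def using disjointD[OF partition_onD2, of S P b c] by auto

lemma is_matchI:
  assumes "\<Union>P = S" "\<And>b c x. b \<in> P \<Longrightarrow> c \<in> P \<Longrightarrow> x \<in> b \<Longrightarrow> x \<in> c \<Longrightarrow> b = c"
    "\<And>b. b \<in> P \<Longrightarrow> card b = 2"
  shows "is_match S P"
proof -
  have "{} \<notin> P" using assms(3)[of "{}"] by auto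
  moreover have "disjoint P" using assms(2) by (intro disjointI) blast
  ultimately show ?thesis unfolding is_match_def partition_on_def using assms(1,3) by simp
qed

lemma is_match_partner:
  assumes "is_match S P" "x \<in> S" obtains y where "{x, y} \<in> P" "x \<noteq> y" "y \<in> S"
proof -
  obtain b where b: "b \<in> P" "x \<in> b" using assms is_match_Union by (metis UnionE)
  then have "card b = 2" using assms by (simp add: is_match_def)
  then obtain u v where uv: "b = {u, v}" "u \<noteq> v" by (meson card_2_iff)
  have "b \<subseteq> S" using b(1) is_match_Union[OF assms(1)] by blast
  then show thesis using that[of u] that[of v] b uv by (auto simp: insert_commute)
qed

lemma is_match_nonempty: "is_match S P \<Longrightarrow> b \<in> P \<Longrightarrow> b \<noteq> {}"
  unfolding is_match_def by auto

lemma is_match_subset: "is_match S P \<Longrightarrow> b \<in> P \<Longrightarrow> b \<subseteq> S"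
  using is_match_Union by (metis Union_upper)

lemma is_match_image_on:
  assumes "inj_on \<phi> S" and m: "is_match S P"
  shows "is_match (\<phi> ` S) ((`) \<phi> ` P)"
proof (rule is_matchI)
  show "\<Union>((`) \<phi> ` P) = \<phi> ` S" using is_match_Union[OF m] by (metis image_Union)
  show "b = c" if bc: "b \<in> (`) \<phi> ` P" "c \<in> (`) \<phi> ` P" "x \<in> b" "x \<in> c" for b c x
  proof -
    obtain b' c' where *: "b' \<in> P" "c' \<in> P" "b = \<phi> ` b'" "c = \<phi> ` c'" using bc by blast
    obtain y z where yz: "y \<in> b'" "x = \<phi> y" "z \<in> c'" "x = \<phi> z" using bc * by blast
    then have "y = z" using * is_match_subset[OF m] assms(1) by (metis inj_onD subsetD)
    then show "b = c" using * yz is_match_eq[OF m *(1,2)] by metis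
  qed
  show "card b = 2" if "b \<in> (`) \<phi> ` P" for b
  proof -
    obtain b' where b': "b' \<in> P" "b = \<phi> ` b'" using \<open>b \<in> (`) \<phi> ` P\<close> by blast
    then have "inj_on \<phi> b'" using assms is_match_subset inj_on_subset by metis
    then show ?thesis using b' m by (simp add: is_match_def card_image)
  qed
qed

lemma is_match_image:
  assumes "inj \<phi>" shows "is_match (\<phi> ` S) ((`) \<phi> ` P) \<longleftrightarrow> is_match S P"
proof
  assume "is_match (\<phi> ` S) ((`) \<phi> ` P)"
  then have "is_match (Hilbert_Choice.inv \<phi> ` \<phi> ` S) ((`) (Hilbert_Choice.inv \<phi>) ` (`) \<phi> ` P)"
    by (rule is_match_image_on[rotated]) (auto intro: inj_on_inv_into)
  then show "is_match S P" using assms by (simp add: image_image)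
next
  assume "is_match S P"
  then show "is_match (\<phi> ` S) ((`) \<phi> ` P)"
    by (rule is_match_image_on[rotated]) (rule inj_on_subset[OF assms subset_UNIV])
qed

text \<open>A new edge fuses exactly the old blocks that meet it: that union is already closed,
  because the blocks are disjoint. The remaining components are old blocks away from
  \<open>e\<close>.\<close>

lemma comps_insert_star:
  assumes Q: "is_match B Q" and e: "e \<noteq> {}" and C: "C \<in> comps (insert e Q)" and ne: "C \<notin> Q \<or> C \<inter> e \<noteq> {}"
  shows "C = e \<union> \<Union>{b \<in> Q. b \<inter> e \<noteq> {}}" (is "_ = ?K")
proof -
  have clC: "closed_under (insert e Q) C" by (rule comps_closed[OF C])
  have eC: "C \<inter> e \<noteq> {}"
  proof (rule ccontr)
    assume dis: "\<not> C \<inter> e \<noteq> {}"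
    obtain x where x: "x \<in> C" using comps_nonempty[OF C] by blast
    then obtain b where b: "b \<in> Q" "x \<in> b" using comps_subset[OF C] dis by blast
    have bC: "b \<subseteq> C" using closed_underD[OF clC _ b(2) x] b by simp
    have "closed_under (insert e Q) b"
      unfolding closed_under_def
    proof (intro ballI impI)
      fix c assume c: "c \<in> insert e Q" "c \<inter> b \<noteq> {}"
      then have "c \<in> Q" using bC dis by blast
      then show "c \<subseteq> b" using is_match_eq[OF Q _ b(1)] c by blast
    qed
    then have "C \<subseteq> b" using comps_min[OF C] x b by blast
    then show False using ne b bC dis by (metis subset_antisym)
  qed
  have "e \<subseteq> C" using closed_under_subset[OF clC, of e] eC by (simp add: Int_commute)
  moreover have "b \<subseteq> C" if "b \<in> Q" "b \<inter> e \<noteq> {}" for b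
    using closed_under_subset[OF clC, of b] that \<open>e \<subseteq> C\<close> by blast
  ultimately have "?K \<subseteq> C" by blast
  moreover have "closed_under (insert e Q) ?K"
    unfolding closed_under_def
  proof (intro ballI impI)
    fix c assume c: "c \<in> insert e Q" "c \<inter> ?K \<noteq> {}"
    show "c \<subseteq> ?K"
    proof (cases "c = e \<or> c \<inter> e \<noteq> {}")
      case True then show ?thesis using c by blast
    next
      case False
      then obtain x b where "x \<in> c" "x \<in> b" "b \<in> Q" "b \<inter> e \<noteq> {}" using c by blast
      then have "c = b" using is_match_eq[OF Q] c False by blast
      then show ?thesis using False \<open>b \<inter> e \<noteq> {}\<close> by blast
    qed
  qed
  then have "C \<subseteq> ?K" using comps_min[OF C] eC by blast
  ultimately show ?thesis by blast
qed

text \<open>The ends of \<open>e\<close> decide: with no end in \<open>B\<close> the edge is a new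
  pair, with one end in \<open>B\<close> it prolongs a block, with both ends in \<open>B\<close> it
  joins two blocks into one or closes a block into a loop, which has empty trace. A vertex lying in
  both \<open>B\<close> and \<open>e\<close> becomes interior.\<close>

lemma match_step:
  assumes Q: "is_match B Q" and e: "card e = 2"
  defines "W \<equiv> (B - e) \<union> (e - B)"
  shows "is_match W (trace W (comps (insert e Q)))"
proof (rule is_matchI)
  have "\<Union>(insert e Q) = B \<union> e" using is_match_Union[OF Q] by auto
  then show "\<Union>(trace W (comps (insert e Q))) = W" unfolding Union_trace Union_comps W_def by auto
  show "b = c" if bc: "b \<in> trace W (comps (insert e Q))" "c \<in> trace W (comps (insert e Q))" "x \<in> b" "x \<in> c" for b c x
  proof -
    obtain b' c' where "b' \<in> comps (insert e Q)" "b = b' \<inter> W" "c' \<in> comps (insert e Q)" "c = c' \<inter> W"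
      using bc by (metis mem_trace)
    then show "b = c" using comps_eq_member bc by (metis IntD1)
  qed
  fix D assume D: "D \<in> trace W (comps (insert e Q))"
  then obtain C where C: "C \<in> comps (insert e Q)" "D = C \<inter> W" "D \<noteq> {}" by (metis mem_trace)
  obtain x y where xy: "e = {x, y}" "x \<noteq> y" using e by (meson card_2_iff)
  show "card D = 2"
  proof (cases "C \<notin> Q \<or> C \<inter> e \<noteq> {}")
    case False
    then have "C \<subseteq> W" using is_match_Union[OF Q] unfolding W_def by blast
    then have "D = C" using C by blast
    then show ?thesis using Q False unfolding is_match_def by blast
  next
    case True
    then have K: "C = e \<union> \<Union>{b \<in> Q. b \<inter> e \<noteq> {}}"
      by (rule comps_insert_star[OF Q _ C(1), rotated]) (use xy in auto)
    have QB: "\<And>b. b \<in> Q \<Longrightarrow> b \<subseteq> B" using is_match_Union[OF Q] by blast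
    have one: "card D = 2" if "u \<in> B" "v \<notin> B" "e = {u, v}" for u v
    proof -
      obtain a where a: "{u, a} \<in> Q" "u \<noteq> a" "a \<in> B" using is_match_partner[OF Q \<open>u \<in> B\<close>] .
      have "b = {u, a}" if "b \<in> Q" "b \<inter> e \<noteq> {}" for b
        using that is_match_eq[OF Q _ a(1), of b u] QB[of b] \<open>v \<notin> B\<close> \<open>e = {u, v}\<close> by auto
      then have "C = {u, v, a}" unfolding K using a \<open>e = {u, v}\<close> by auto
      then have "D = {v, a}" using C that a unfolding W_def by auto
      then show ?thesis using a that by (metis card_2_iff)
    qed
    consider "x \<notin> B" "y \<notin> B" | "x \<in> B" "y \<notin> B" | "x \<notin> B" "y \<in> B" | "x \<in> B" "y \<in> B" by blast
    then show ?thesis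
    proof cases
      case 1
      then have "\<And>b. b \<in> Q \<Longrightarrow> b \<inter> e = {}" using QB xy by blast
      then have "C = e" unfolding K by blast
      then have "D = e" using C 1 xy unfolding W_def by auto
      then show ?thesis using e by simp
    next
      case 2 then show ?thesis using one[of x y] xy by simp
    next
      case 3 then show ?thesis using one[of y x] xy by (simp add: insert_commute)
    next
      case 4
      obtain a where a: "{x, a} \<in> Q" "x \<noteq> a" "a \<in> B" using is_match_partner[OF Q 4(1)] .
      obtain b where b: "{y, b} \<in> Q" "y \<noteq> b" "b \<in> B" using is_match_partner[OF Q 4(2)] .
      have "c = {x, a} \<or> c = {y, b}" if "c \<in> Q" "c \<inter> e \<noteq> {}" for c
        using that is_match_eq[OF Q _ a(1), of c x] is_match_eq[OF Q _ b(1), of c y] xy by auto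
      then have Ce: "C = {x, y, a, b}" unfolding K using a b xy by auto
      \<comment> \<open>Otherwise \<open>e\<close> would close the single block
        \<open>{x, y}\<close> into a loop, whose trace is empty, contrary to
        \<open>C(3)\<close>.\<close>
      have "a \<noteq> y"
      proof
        assume "a = y"
        then have "{x, a} = {y, b}" using is_match_eq[OF Q a(1) b(1)] by blast
        then have "b = x" using \<open>a = y\<close> b by auto
        then have "D = {}" using C Ce \<open>a = y\<close> xy 4 unfolding W_def by auto
        then show False using C by simp
      qed
      have neq: "{x, a} \<noteq> {y, b}" using xy \<open>a \<noteq> y\<close> by auto
      then have "a \<noteq> b" "b \<noteq> x" using is_match_eq[OF Q a(1) b(1)] by blast+
      then have "D = {a, b}" using C Ce a b \<open>a \<noteq> y\<close> 4 xy unfolding W_def by auto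
      then show ?thesis using \<open>a \<noteq> b\<close> by simp
    qed
  qed
qed

text \<open>The blocks of \<open>F\<close> are glued on one at a time; each changes the set of loose ends by a symmetric
  difference.\<close>

lemma match_glue:
  assumes Q: "is_match B Q" and "finite F" and "is_match S F"
  shows "is_match ((B - S) \<union> (S - B)) (trace ((B - S) \<union> (S - B)) (comps (Q \<union> F)))"
  using assms(2,3)
proof (induction F arbitrary: S rule: finite_induct)
  case empty
  then have "S = {}" using is_match_Union by fastforce
  moreover have "comps Q = Q" using Q comps_disjoint unfolding is_match_def by blast
  moreover have "trace B Q = Q"
  proof -
    have "C \<inter> B = C" "C \<noteq> {}" if "C \<in> Q" for C
      using is_match_Union[OF Q] that Q unfolding is_match_def partition_on_def by blast+
    then have "(\<lambda>C. C \<inter> B) ` Q = Q" by (simp cong: image_cong)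
    then show ?thesis unfolding trace_def using \<open>\<And>C. C \<in> Q \<Longrightarrow> C \<noteq> {}\<close> by blast
  qed
  ultimately show ?case using Q by simp
next
  case (insert e F)
  define S' where "S' = \<Union>F"
  define U where "U = (B - S') \<union> (S' - B)"
  have m: "is_match S' F"
  proof (rule is_matchI)
    show "\<Union>F = S'" by (simp add: S'_def)
    show "b = c" if "b \<in> F" "c \<in> F" "x \<in> b" "x \<in> c" for b c x
      using is_match_eq[OF insert.prems, of b c x] that by simp
    show "card b = 2" if "b \<in> F" for b
      using insert.prems that by (simp add: is_match_def)
  qed
  have e2: "card e = 2" using insert.prems by (simp add: is_match_def)
  have dis: "e \<inter> S' = {}"
    using is_match_eq[OF insert.prems, of e] insert.hyps unfolding S'_def by blast
  have S: "S = e \<union> S'" using is_match_Union[OF insert.prems] unfolding S'_def by simp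
  have IH: "is_match U (trace U (comps (Q \<union> F)))" using insert.IH[OF m] unfolding U_def .
  let ?W = "(U - e) \<union> (e - U)"
  have W: "?W = (B - S) \<union> (S - B)" using dis unfolding U_def S by blast
  \<comment> \<open>The new block is disjoint from the earlier blocks of \<open>F\<close>, so it can
    meet the graph built so far only in ends that are still loose.\<close>
  have "\<Union>(Q \<union> F) \<inter> \<Union>{e} \<subseteq> U"
    using is_match_Union[OF Q] is_match_Union[OF m] dis unfolding U_def by auto
  from comps_trace[OF this]
  have "trace ?W (comps (insert e (trace U (comps (Q \<union> F))))) = trace ?W (comps (Q \<union> insert e F))"
    using trace_trace[of ?W "U \<union> e"] by auto
  then show ?case using match_step[OF IH e2] unfolding W by simp
qed

section \<open>Composites of Brauer diagrams are Brauer diagrams\<close>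

lemma finite_points: "finite (points p q)"
  by (simp add: points_def)

lemma place_points: "case_point (Pair a) (Pair b) ` points p q = {a} \<times> {1..p} \<union> {b} \<times> {1..q}"
  unfolding points_def by (force simp: image_Un image_image)

lemma finite_brauer: "finite (brauer p q)" and brauer_finite: "d \<in> brauer p q \<Longrightarrow> finite d"
  and brauer_Union: "d \<in> brauer p q \<Longrightarrow> \<Union>d = points p q"
proof -
  show U: "\<Union>d = points p q" if "d \<in> brauer p q" for d
    using that is_match_Union by (simp add: brauer_is_match)
  then have s: "brauer p q \<subseteq> Pow (Pow (points p q))" by blast
  then show "finite (brauer p q)" by (rule finite_subset) (simp add: finite_points)
  show "finite d" if "d \<in> brauer p q" for d
    using s that by (meson PowD finite_Pow_iff finite_points finite_subset subsetD)
qed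

lemma brauer_comp:
  assumes f: "f \<in> brauer q r" and g: "g \<in> brauer p q"
  shows "f \<bullet>\<^sub>B g \<in> brauer p r"
proof -
  have inj: "inj (case_point (Pair (0::nat)) (Pair (Suc 0)))" "inj (case_point (Pair (0::nat)) (Pair 2))"
    "inj (case_point (Pair (Suc 0)) (Pair 2))"
    by (rule inj_case_point; simp)+
  let ?B = "{0} \<times> {1..p} \<union> {Suc 0} \<times> {1..q}" and ?S = "{Suc 0} \<times> {1..q} \<union> {2} \<times> {1..r}"
  let ?W = "{0} \<times> {1..p} \<union> {2} \<times> {1..r}"
  have G: "is_match ?B (place 0 1 g)"
    using g is_match_image[OF inj(1), of "points p q" g] by (simp add: brauer_is_match place_def place_points)
  have F: "is_match ?S (place 1 2 f)"
    using f is_match_image[OF inj(3), of "points q r" f] by (simp add: brauer_is_match place_def place_points)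
  have fin: "finite (place 1 2 f)" using brauer_finite[OF f] by (simp add: place_def)
  \<comment> \<open>The middle row belongs to both matchings and cancels in the symmetric
    difference.\<close>
  have W: "(?B - ?S) \<union> (?S - ?B) = ?W" by auto
  have m: "is_match ?W (trace ?W (comps (place 0 1 g \<union> place 1 2 f)))"
    using match_glue[OF G fin F] unfolding W .
  have "trace ?W (comps (place 0 1 g \<union> place 1 2 f)) = trace ({0, 2} \<times> UNIV) (comps (place 0 1 g \<union> place 1 2 f))"
  proof (rule trace_cong)
    fix C assume "C \<in> comps (place 0 1 g \<union> place 1 2 f)"
    then have "C \<subseteq> ?B \<union> ?S"
      using comps_subset[of C] is_match_Union[OF G] is_match_Union[OF F] by (metis Union_Un_distrib)
    then show "C \<inter> ?W = C \<inter> {0, 2} \<times> UNIV" by auto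
  qed
  also have "\<dots> = place 0 2 (f \<bullet>\<^sub>B g)" by (rule place_diagram_comp[symmetric]) auto
  finally have "is_match ?W (place 0 2 (f \<bullet>\<^sub>B g))" using m by simp
  then show ?thesis
    using is_match_image[OF inj(2), of "points p r" "f \<bullet>\<^sub>B g"] by (simp add: brauer_is_match place_def place_points)
qed

section \<open>Recognizing a composite by means of closed sets\<close>

lemma comp_memI:
  assumes f: "f \<in> brauer q r" and g: "g \<in> brauer p q" and u: "u \<in> points p r" "u \<noteq> v"
    and conn: "\<And>X. closed_under (glued_edges f g) X \<Longrightarrow> outer u \<in> X \<Longrightarrow> outer v \<in> X"
  shows "{u, v} \<in> f \<bullet>\<^sub>B g"
proof -
  have m: "is_match (points p r) (f \<bullet>\<^sub>B g)"
    using brauer_comp[OF f g] by (simp add: brauer_is_match)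
  obtain w where w: "{u, w} \<in> f \<bullet>\<^sub>B g" "u \<noteq> w" using is_match_partner[OF m u(1)] .
  then obtain C where C: "C \<in> comps (glued_edges f g)" "{u, w} = outer -` C"
    unfolding diagram_comp_def glued_components_def comps_def by auto
  \<comment> \<open>The only outer ends of this component are those of \<open>u\<close> and
    \<open>w\<close>, so \<open>v\<close> has to be \<open>w\<close>.\<close>
  have "outer u \<in> C" using C(2) by blast
  then have "outer v \<in> C" using conn comps_closed[OF C(1)] by simp
  then have "v \<in> {u, w}" using C(2) by simp
  then show ?thesis using u(2) w by simp
qed

lemma match_subset_eq:
  assumes "is_match S P" "is_match S Q" "P \<subseteq> Q" shows "P = Q"
proof (rule subset_antisym[OF assms(3)], rule subsetI)
  fix b assume b: "b \<in> Q"
  then have "card b = 2" using assms(2) by (simp add: is_match_def)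
  then obtain x where x: "x \<in> b" by fastforce
  then have "x \<in> S" using b is_match_Union[OF assms(2)] by blast
  then obtain c where c: "c \<in> P" "x \<in> c" using is_match_Union[OF assms(1)] by (metis UnionE)
  then show "b \<in> P" using is_match_eq[OF assms(2) b _ x] assms(3) by (metis subsetD)
qed

text \<open>One inclusion is enough, because no perfect matching is properly contained in another
  one of the same set. So it suffices to follow each strand of the proposed composite.\<close>

lemma comp_eqI:
  assumes f: "f \<in> brauer q r" and g: "g \<in> brauer p q" and d: "d \<in> brauer p r"
    and conn: "\<And>u v X. {u, v} \<in> d \<Longrightarrow> closed_under (glued_edges f g) X \<Longrightarrow> outer u \<in> X \<Longrightarrow> outer v \<in> X"
  shows "f \<bullet>\<^sub>B g = d"
proof -
  have "d \<subseteq> f \<bullet>\<^sub>B g"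
  proof
    fix b assume b: "b \<in> d"
    then have "card b = 2" using d by (simp add: brauer_def)
    then obtain u v where uv: "b = {u, v}" "u \<noteq> v" by (meson card_2_iff)
    have "u \<in> points p r" using b uv brauer_Union[OF d] by blast
    then show "b \<in> f \<bullet>\<^sub>B g" using comp_memI[OF f g _ uv(2)] conn b uv by blast
  qed
  then show ?thesis
    using match_subset_eq[of "points p r" d "f \<bullet>\<^sub>B g"] d brauer_comp[OF f g] by (simp add: brauer_is_match)
qed

lemma glued_edges_above: 
  "{glue_above x, glue_above y} \<in> glued_edges f g" if "{x, y} \<in> g" for x y
  using that unfolding glued_edges_def by (intro UnI1 image_eqI[of _ _ "{x, y}"]) auto

lemma glued_edges_below: 
  "{glue_below x, glue_below y} \<in> glued_edges f g" if "{x, y} \<in> f" for x y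
  using that unfolding glued_edges_def by (intro UnI2 image_eqI[of _ _ "{x, y}"]) auto

lemma closed_under_glued:
  assumes "closed_under (glued_edges f g) X"
  shows "{x, y} \<in> g \<Longrightarrow> glue_above x \<in> X \<longleftrightarrow> glue_above y \<in> X"
    and "{x, y} \<in> f \<Longrightarrow> glue_below x \<in> X \<longleftrightarrow> glue_below y \<in> X"
  using closed_underD[OF assms glued_edges_above] closed_underD[OF assms glued_edges_below]
  by (metis insertCI insert_subset)+

section \<open>Explicit description of Brauer diagrams\<close>

text \<open>A normal form covering every diagram (\<open>brauer_diag\<close>). The values of
  \<open>\<theta>\<close> off \<open>I\<close> are irrelevant, so equality of diagrams determines it
  only on \<open>I\<close>.\<close>

definition diag :: "nat set set \<Rightarrow> nat set \<Rightarrow> (nat \<Rightarrow> nat) \<Rightarrow> nat set set \<Rightarrow> diagram" where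
  "diag M I \<theta> N = (`) Top ` M \<union> (\<lambda>i. {Top i, Bot (\<theta> i)}) ` I \<union> (`) Bot ` N"

definition valid_diag :: "nat \<Rightarrow> nat \<Rightarrow> nat set set \<Rightarrow> nat set \<Rightarrow> (nat \<Rightarrow> nat) \<Rightarrow> nat set set \<Rightarrow> bool" where
  "valid_diag p q M I \<theta> N \<longleftrightarrow> I \<subseteq> {1..p} \<and> inj_on \<theta> I \<and> \<theta> ` I \<subseteq> {1..q} \<and>
     is_match ({1..p} - I) M \<and> is_match ({1..q} - \<theta> ` I) N"

text \<open>The empty block has to be excluded since its images under \<open>Top\<close> and
  \<open>Bot\<close> coincide; this is the only overlap between the two kinds of horizontal
  pairs.\<close>

lemma diag_mem:
  shows diag_mem_through: "{Top i, Bot j} \<in> diag M I \<theta> N \<longleftrightarrow> i \<in> I \<and> j = \<theta> i"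
    and diag_mem_top: "{} \<notin> N \<Longrightarrow> Top ` m \<in> diag M I \<theta> N \<longleftrightarrow> m \<in> M"
    and diag_mem_bot: "{} \<notin> M \<Longrightarrow> Bot ` m \<in> diag M I \<theta> N \<longleftrightarrow> m \<in> N"
proof -
  have inj: "inj Top" "inj Bot" by (auto simp: inj_def)
  have eq_iff_swap: "(a = b \<longleftrightarrow> Q) \<Longrightarrow> (b = a \<longleftrightarrow> Q)" for a b :: "point set" and Q by blast
  have 1: "{Top i, Bot j} \<noteq> Top ` m" "{Top i, Bot j} \<noteq> Bot ` m" for i j m by auto
  have 2: "Top ` m = Bot ` n \<longleftrightarrow> m = {} \<and> n = {}" for m n by auto
  have 3: "{Top i, Bot j} = {Top k, Bot l} \<longleftrightarrow> i = k \<and> j = l" for i j k l by (auto simp: doubleton_eq_iff)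
  show "{Top i, Bot j} \<in> diag M I \<theta> N \<longleftrightarrow> i \<in> I \<and> j = \<theta> i"
    unfolding diag_def Un_iff image_iff using 1 3 by auto
  show "{} \<notin> N \<Longrightarrow> Top ` m \<in> diag M I \<theta> N \<longleftrightarrow> m \<in> M"
    unfolding diag_def Un_iff image_iff using 1(1)[of _ _ m] 2 by (auto simp: inj_image_eq_iff[OF inj(1)])
  show "{} \<notin> M \<Longrightarrow> Bot ` m \<in> diag M I \<theta> N \<longleftrightarrow> m \<in> N"
    unfolding diag_def Un_iff image_iff using 1(2)[of _ _ m] 2[THEN eq_iff_swap] by (auto simp: inj_image_eq_iff[OF inj(2)])
qed

lemma valid_nonempty: "valid_diag p q M I \<theta> N \<Longrightarrow> {} \<notin> M" "valid_diag p q M I \<theta> N \<Longrightarrow> {} \<notin> N"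
  unfolding valid_diag_def by (metis is_match_nonempty)+

lemma diag_inject:
  assumes v: "valid_diag p q M I \<theta> N" and v': "valid_diag p' q' M' I' \<theta>' N'"
    and eq: "diag M I \<theta> N = diag M' I' \<theta>' N'"
  shows "M = M'" "I = I'" "N = N'" "i \<in> I \<Longrightarrow> \<theta> i = \<theta>' i"
proof -
  note ne = valid_nonempty[OF v] valid_nonempty[OF v']
  have "m \<in> M \<longleftrightarrow> m \<in> M'" for m
    using diag_mem_top[OF ne(2), of m M I \<theta>] diag_mem_top[OF ne(4), of m M' I' \<theta>'] eq by simp
  then show "M = M'" by blast
  have "m \<in> N \<longleftrightarrow> m \<in> N'" for m
    using diag_mem_bot[OF ne(1), of m I \<theta> N] diag_mem_bot[OF ne(3), of m I' \<theta>' N'] eq by simp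
  then show "N = N'" by blast
  have th: "i \<in> I \<and> j = \<theta> i \<longleftrightarrow> i \<in> I' \<and> j = \<theta>' i" for i j
    using diag_mem_through[of i j M I \<theta> N] diag_mem_through[of i j M' I' \<theta>' N'] eq by simp
  show "I = I'" using th by blast
  show "i \<in> I \<Longrightarrow> \<theta> i = \<theta>' i" using th by blast
qed

lemma diag_cong: "(\<And>i. i \<in> I \<Longrightarrow> \<theta> i = \<theta>' i) \<Longrightarrow> diag M I \<theta> N = diag M I \<theta>' N"
  unfolding diag_def by (simp cong: image_cong)

lemma is_match_Un:
  assumes "is_match S P" "is_match T Q" "S \<inter> T = {}"
  shows "is_match (S \<union> T) (P \<union> Q)"
proof (rule is_matchI)
  show "\<Union>(P \<union> Q) = S \<union> T" using assms is_match_Union by (metis Union_Un_distrib)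
  show "card b = 2" if "b \<in> P \<union> Q" for b using that assms by (auto simp: is_match_def)
  show "b = c" if "b \<in> P \<union> Q" "c \<in> P \<union> Q" "x \<in> b" "x \<in> c" for b c x
  proof -
    have "x \<in> S" if "x \<in> d" "d \<in> P" for d using is_match_subset[OF assms(1)] that by blast
    moreover have "x \<in> T" if "x \<in> d" "d \<in> Q" for d using is_match_subset[OF assms(2)] that by blast
    ultimately show ?thesis
      using that is_match_eq[OF assms(1), of b c x] is_match_eq[OF assms(2), of b c x] assms(3) by blast
  qed
qed

lemma diag_brauer:
  assumes v: "valid_diag p q M I \<theta> N"
  shows "diag M I \<theta> N \<in> brauer p q"
proof -
  let ?T = "(\<lambda>i. {Top i, Bot (\<theta> i)}) ` I"
  have inj: "inj_on Top X" "inj_on Bot X" for X by (auto simp: inj_on_def)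
  have I: "I \<subseteq> {1..p}" "inj_on \<theta> I" "\<theta> ` I \<subseteq> {1..q}"
    and M: "is_match ({1..p} - I) M" and N: "is_match ({1..q} - \<theta> ` I) N"
    using v by (simp_all add: valid_diag_def)
  have T: "is_match (Top ` I \<union> Bot ` \<theta> ` I) ?T"
  proof (rule is_matchI)
    show "\<Union>?T = Top ` I \<union> Bot ` \<theta> ` I" by auto
    show "b = c" if "b \<in> ?T" "c \<in> ?T" "x \<in> b" "x \<in> c" for b c x
      using that inj_onD[OF I(2)] by auto
    show "card b = 2" if "b \<in> ?T" for b using that by auto
  qed
  have "is_match (Top ` ({1..p} - I) \<union> (Top ` I \<union> Bot ` \<theta> ` I)) ((`) Top ` M \<union> ?T)"
    by (rule is_match_Un[OF is_match_image_on[OF inj(1) M] T]) auto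
  then have "is_match ((Top ` ({1..p} - I) \<union> (Top ` I \<union> Bot ` \<theta> ` I)) \<union> Bot ` ({1..q} - \<theta> ` I)) (((`) Top ` M \<union> ?T) \<union> (`) Bot ` N)"
    by (rule is_match_Un[OF _ is_match_image_on[OF inj(2) N]]) auto
  moreover have "(Top ` ({1..p} - I) \<union> (Top ` I \<union> Bot ` \<theta> ` I)) \<union> Bot ` ({1..q} - \<theta> ` I) = points p q"
  proof -
    have "Top ` ({1..p} - I) \<union> Top ` I = Top ` {1..p}" "Bot ` \<theta> ` I \<union> Bot ` ({1..q} - \<theta> ` I) = Bot ` {1..q}"
      using I by (simp_all add: image_Un[symmetric] Un_absorb1 Un_absorb2 del: image_Un)
    then show ?thesis unfolding points_def by blast
  qed
  ultimately show ?thesis by (simp add: brauer_is_match diag_def)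
qed

lemma brauer_mem_cases:
  assumes "d \<in> brauer p q" "b \<in> d"
  obtains (top) i j where "b = {Top i, Top j}" "i \<noteq> j" "i \<in> {1..p}" "j \<in> {1..p}"
    | (bot) i j where "b = {Bot i, Bot j}" "i \<noteq> j" "i \<in> {1..q}" "j \<in> {1..q}"
    | (through) i j where "b = {Top i, Bot j}" "i \<in> {1..p}" "j \<in> {1..q}"
proof -
  have m: "is_match (points p q) d" using assms by (simp add: brauer_is_match)
  then have "card b = 2" using assms(2) by (simp add: is_match_def)
  then obtain x y where xy: "b = {x, y}" "x \<noteq> y" by (meson card_2_iff)
  have pt: "x \<in> points p q" "y \<in> points p q" using is_match_subset[OF m assms(2)] xy by auto
  have pp: "Top i \<in> points p q \<longleftrightarrow> i \<in> {1..p}" "Bot i \<in> points p q \<longleftrightarrow> i \<in> {1..q}" for i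
    by (auto simp: points_def)
  show thesis
  proof (cases x; cases y)
    fix i j assume "x = Top i" "y = Top j" then show thesis using top xy pt pp by auto
  next
    fix i j assume "x = Top i" "y = Bot j" then show thesis using through xy pt pp by auto
  next
    fix i j assume "x = Bot i" "y = Top j" then show thesis using through[of j i] xy pt pp by (auto simp: insert_commute)
  next
    fix i j assume "x = Bot i" "y = Bot j" then show thesis using bot xy pt pp by auto
  qed
qed

lemma brauer_diag:
  assumes d: "d \<in> brauer p q"
  obtains M I \<theta> N where "valid_diag p q M I \<theta> N" "d = diag M I \<theta> N"
proof -
  have m: "is_match (points p q) d" using d by (simp add: brauer_is_match)
  define M where "M = {b. Top ` b \<in> d}"
  define N where "N = {b. Bot ` b \<in> d}"
  define I where "I = {i. \<exists>j. {Top i, Bot j} \<in> d}"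
  define \<theta> where "\<theta> i = (SOME j. {Top i, Bot j} \<in> d)" for i
  have th: "{Top i, Bot (\<theta> i)} \<in> d" if "i \<in> I" for i
    using that unfolding I_def \<theta>_def by (auto intro: someI)
  have th': "i \<in> I \<and> j = \<theta> i" if "{Top i, Bot j} \<in> d" for i j
  proof -
    have i: "i \<in> I" using that unfolding I_def by blast
    then have "{Top i, Bot j} = {Top i, Bot (\<theta> i)}" using is_match_eq[OF m that th] by blast
    then show ?thesis using i by (auto simp: doubleton_eq_iff)
  qed
  have inj: "inj Top" "inj Bot" by (auto simp: inj_def)
  have eq: "d = diag M I \<theta> N"
  proof (rule subset_antisym; rule subsetI)
    fix b assume b: "b \<in> d"
    from d b show "b \<in> diag M I \<theta> N"
    proof (cases rule: brauer_mem_cases)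
      case (top i j)
      then have "b = Top ` {i, j}" by simp
      then show ?thesis using b unfolding diag_def M_def by blast
    next
      case (bot i j)
      then have "b = Bot ` {i, j}" by simp
      then show ?thesis using b unfolding diag_def N_def by blast
    next
      case (through i j)
      then show ?thesis using th'[of i j] b by (simp add: diag_mem_through)
    qed
  next
    fix b assume "b \<in> diag M I \<theta> N" then show "b \<in> d"
      unfolding diag_def M_def N_def using th by auto
  qed
  have Ip: "i \<in> {1..p}" "\<theta> i \<in> {1..q}" if "i \<in> I" for i
    using is_match_subset[OF m th[OF that]] by (auto simp: points_def)
  have injth: "inj_on \<theta> I"
  proof (rule inj_onI)
    fix i k assume ik: "i \<in> I" "k \<in> I" "\<theta> i = \<theta> k"
    then have "{Top i, Bot (\<theta> i)} = {Top k, Bot (\<theta> k)}" using is_match_eq[OF m th th, of i k "Bot (\<theta> i)"] by simp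
    then show "i = k" by (auto simp: doubleton_eq_iff)
  qed
  have part: "\<exists>b\<in>d. x \<in> b" if "x \<in> points p q" for x
    using that is_match_Union[OF m] by blast
  have Mm: "is_match ({1..p} - I) M"
  proof (rule is_matchI)
    show "\<Union>M = {1..p} - I"
    proof (rule subset_antisym; rule subsetI)
      fix i assume "i \<in> \<Union>M"
      then obtain b where b: "i \<in> b" "Top ` b \<in> d" unfolding M_def by blast
      then have "i \<in> {1..p}" using is_match_subset[OF m b(2)] by (auto simp: points_def)
      moreover have "i \<notin> I"
      proof
        assume i: "i \<in> I"
        then have "Top ` b = {Top i, Bot (\<theta> i)}" using is_match_eq[OF m b(2) th, of i "Top i"] b by simp
        then show False by auto
      qed
      ultimately show "i \<in> {1..p} - I" by simp
    next
      fix i assume i: "i \<in> {1..p} - I"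
      then have "Top i \<in> points p q" by (simp add: points_def)
      then obtain b where b: "b \<in> d" "Top i \<in> b" using part by blast
      from d b(1) show "i \<in> \<Union>M"
      proof (cases rule: brauer_mem_cases)
        case (top k j)
        then have "b = Top ` {k, j}" by simp
        then show ?thesis using b unfolding M_def by blast
      next
        case (bot k j) then show ?thesis using b by simp
      next
        case (through k j) then show ?thesis using b i th' by auto
      qed
    qed
    show "b = c" if "b \<in> M" "c \<in> M" "x \<in> b" "x \<in> c" for b c x
      using is_match_eq[OF m, of "Top ` b" "Top ` c" "Top x"] that unfolding M_def
      by (simp add: inj_image_eq_iff[OF inj(1)])
    show "card b = 2" if "b \<in> M" for b
      using that m card_image[of Top b] inj_on_subset[OF inj(1)] unfolding M_def is_match_def by simp
  qed
  have Nm: "is_match ({1..q} - \<theta> ` I) N"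
  proof (rule is_matchI)
    show "\<Union>N = {1..q} - \<theta> ` I"
    proof (rule subset_antisym; rule subsetI)
      fix i assume "i \<in> \<Union>N"
      then obtain b where b: "i \<in> b" "Bot ` b \<in> d" unfolding N_def by blast
      then have "i \<in> {1..q}" using is_match_subset[OF m b(2)] by (auto simp: points_def)
      moreover have "i \<notin> \<theta> ` I"
      proof
        assume "i \<in> \<theta> ` I"
        then obtain k where k: "k \<in> I" "i = \<theta> k" by blast
        then have "Bot ` b = {Top k, Bot (\<theta> k)}" using is_match_eq[OF m b(2) th, of k "Bot i"] b by simp
        then show False by auto
      qed
      ultimately show "i \<in> {1..q} - \<theta> ` I" by simp
    next
      fix i assume i: "i \<in> {1..q} - \<theta> ` I"
      then have "Bot i \<in> points p q" by (simp add: points_def)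
      then obtain b where b: "b \<in> d" "Bot i \<in> b" using part by blast
      from d b(1) show "i \<in> \<Union>N"
      proof (cases rule: brauer_mem_cases)
        case (bot k j)
        then have "b = Bot ` {k, j}" by simp
        then show ?thesis using b unfolding N_def by blast
      next
        case (top k j) then show ?thesis using b by simp
      next
        case (through k j) then show ?thesis using b i th' by auto
      qed
    qed
    show "b = c" if "b \<in> N" "c \<in> N" "x \<in> b" "x \<in> c" for b c x
      using is_match_eq[OF m, of "Bot ` b" "Bot ` c" "Bot x"] that unfolding N_def
      by (simp add: inj_image_eq_iff[OF inj(2)])
    show "card b = 2" if "b \<in> N" for b
      using that m card_image[of Bot b] inj_on_subset[OF inj(2)] unfolding N_def is_match_def by simp
  qed
  have "valid_diag p q M I \<theta> N" unfolding valid_diag_def using Ip injth Mm Nm by auto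
  then show thesis using eq that by blast
qed

section \<open>Upward, downward and monotone diagrams in normal form\<close>

lemma match_empty_iff: "is_match S {} \<longleftrightarrow> S = {}"
  using is_match_Union[of S "{}"] by (auto simp: is_match_def partition_on_def)

lemma match_witness:
  assumes "is_match S P" "P \<noteq> {}" obtains i j where "{i, j} \<in> P"
  using assms unfolding is_match_def by (metis card_2_iff ex_in_conv)

lemma diag_upward: "valid_diag p q M I \<theta> N \<Longrightarrow> upward (diag M I \<theta> N) \<longleftrightarrow> M = {}"
  and diag_downward: "valid_diag p q M I \<theta> N \<Longrightarrow> downward (diag M I \<theta> N) \<longleftrightarrow> N = {}"
proof -
  assume v: "valid_diag p q M I \<theta> N"
  have "is_match ({1..p} - I) M" "is_match ({1..q} - \<theta> ` I) N" using v by (simp_all add: valid_diag_def)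
  have t: "{Top i, Top j} \<in> diag M I \<theta> N \<longleftrightarrow> {i, j} \<in> M"
    and b: "{Bot i, Bot j} \<in> diag M I \<theta> N \<longleftrightarrow> {i, j} \<in> N" for i j
    using diag_mem_top[OF valid_nonempty(2)[OF v], of "{i, j}"] diag_mem_bot[OF valid_nonempty(1)[OF v], of "{i, j}"]
    by simp_all
  show "upward (diag M I \<theta> N) \<longleftrightarrow> M = {}"
    unfolding upward_def t using match_witness[OF \<open>is_match _ M\<close>] by (metis ex_in_conv)
  show "downward (diag M I \<theta> N) \<longleftrightarrow> N = {}"
    unfolding downward_def b using match_witness[OF \<open>is_match _ N\<close>] by (metis ex_in_conv)
qed

lemma diag_monotone: "monotone_diagram (diag M I \<theta> N) \<longleftrightarrow> strict_mono_on I \<theta>"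
proof
  assume m: "monotone_diagram (diag M I \<theta> N)"
  show "strict_mono_on I \<theta>"
  proof (rule strict_mono_onI)
    fix i k assume ik: "i \<in> I" "k \<in> I" "i < k"
    then have "{Top i, Bot (\<theta> i)} \<noteq> {Top k, Bot (\<theta> k)}" by (auto simp: doubleton_eq_iff)
    then have "(int i - int k) * (int (\<theta> i) - int (\<theta> k)) > 0"
      using m ik unfolding monotone_diagram_def by (simp add: diag_mem_through)
    then show "\<theta> i < \<theta> k" using ik by (simp add: zero_less_mult_iff)
  qed
next
  assume m: "strict_mono_on I \<theta>"
  show "monotone_diagram (diag M I \<theta> N)"
    unfolding monotone_diagram_def diag_mem_through
  proof (intro allI impI)
    fix i j k l assume ij: "i \<in> I \<and> j = \<theta> i" "k \<in> I \<and> l = \<theta> k" "{Top i, Bot j} \<noteq> {Top k, Bot l}"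
    then have "i \<noteq> k" by blast
    then consider "i < k" | "k < i" by linarith
    then show "(int i - int k) * (int j - int l) > 0"
      using strict_mono_onD[OF m, of i k] strict_mono_onD[OF m, of k i] ij
      by cases (simp_all add: zero_less_mult_iff)
  qed
qed

lemma valid_up: "valid_diag p q {} I \<theta> N \<longleftrightarrow> I = {1..p} \<and> inj_on \<theta> {1..p} \<and> \<theta> ` {1..p} \<subseteq> {1..q} \<and> is_match ({1..q} - \<theta> ` {1..p}) N"
  unfolding valid_diag_def match_empty_iff by auto

lemma valid_down: "valid_diag p q M I \<theta> {} \<longleftrightarrow> I \<subseteq> {1..p} \<and> inj_on \<theta> I \<and> \<theta> ` I = {1..q} \<and> is_match ({1..p} - I) M"
  unfolding valid_diag_def match_empty_iff by auto

lemma upward_diag: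
  assumes "d \<in> brauer p q" "upward d"
  obtains \<theta> N where "valid_diag p q {} {1..p} \<theta> N" "d = diag {} {1..p} \<theta> N"
proof -
  obtain M I \<theta> N where v: "valid_diag p q M I \<theta> N" "d = diag M I \<theta> N" using brauer_diag[OF assms(1)] .
  then have "M = {}" using assms(2) diag_upward by blast
  then show thesis using that v valid_up by metis
qed

lemma downward_diag:
  assumes "d \<in> brauer p q" "downward d"
  obtains M I \<theta> where "valid_diag p q M I \<theta> {}" "d = diag M I \<theta> {}"
proof -
  obtain M I \<theta> N where v: "valid_diag p q M I \<theta> N" "d = diag M I \<theta> N" using brauer_diag[OF assms(1)] .
  then have "N = {}" using assms(2) diag_downward by blast
  then show thesis using that v by metis
qed

text \<open>Every middle point continues through \<open>\<phi>\<close> to the bottom row. Hence the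
  top pairs of the right factor stay, its bottom ends are renamed by \<open>\<phi>\<close>, and the
  bottom pairs of the left factor are added.\<close>

lemma up_comp:
  assumes vf: "valid_diag q r {} {1..q} \<phi> N" and vg: "valid_diag p q M I \<theta> N'"
  shows valid_up_comp: "valid_diag p r M I (\<phi> \<circ> \<theta>) ((`) \<phi> ` N' \<union> N)"
    and diag_up_comp: "diag {} {1..q} \<phi> N \<bullet>\<^sub>B diag M I \<theta> N' = diag M I (\<phi> \<circ> \<theta>) ((`) \<phi> ` N' \<union> N)"
proof -
  have \<phi>: "inj_on \<phi> {1..q}" "\<phi> ` {1..q} \<subseteq> {1..r}" "is_match ({1..r} - \<phi> ` {1..q}) N"
    using vf by (simp_all add: valid_up)
  have \<theta>: "I \<subseteq> {1..p}" "inj_on \<theta> I" "\<theta> ` I \<subseteq> {1..q}" "is_match ({1..p} - I) M" "is_match ({1..q} - \<theta> ` I) N'"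
    using vg by (simp_all add: valid_diag_def)
  have "is_match (\<phi> ` ({1..q} - \<theta> ` I)) ((`) \<phi> ` N')"
    using is_match_image_on[OF inj_on_subset[OF \<phi>(1)] \<theta>(5)] by blast
  then have "is_match (\<phi> ` ({1..q} - \<theta> ` I) \<union> ({1..r} - \<phi> ` {1..q})) ((`) \<phi> ` N' \<union> N)"
    by (rule is_match_Un[OF _ \<phi>(3)]) blast
  \<comment> \<open>The bottom points off the through strands come from two sources: images of such
    points of the right factor, and points that \<open>\<phi>\<close> misses.\<close>
  moreover have "\<phi> ` ({1..q} - \<theta> ` I) \<union> ({1..r} - \<phi> ` {1..q}) = {1..r} - (\<phi> \<circ> \<theta>) ` I"
  proof -
    have "\<phi> ` ({1..q} - \<theta> ` I) = \<phi> ` {1..q} - \<phi> ` \<theta> ` I"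
      by (rule inj_on_image_set_diff[OF \<phi>(1)]) (use \<theta>(3) in auto)
    moreover have "\<phi> ` \<theta> ` I \<subseteq> \<phi> ` {1..q}" by (rule image_mono[OF \<theta>(3)])
    ultimately show ?thesis using \<phi>(2) by (auto simp: image_comp)
  qed
  ultimately have N: "is_match ({1..r} - (\<phi> \<circ> \<theta>) ` I) ((`) \<phi> ` N' \<union> N)" by simp
  have inj: "inj_on (\<phi> \<circ> \<theta>) I" by (rule comp_inj_on[OF \<theta>(2) inj_on_subset[OF \<phi>(1) \<theta>(3)]])
  have "(\<phi> \<circ> \<theta>) ` I \<subseteq> {1..r}"
    unfolding image_comp[symmetric] using image_mono[OF \<theta>(3)] \<phi>(2) by (rule subset_trans)
  then show v: "valid_diag p r M I (\<phi> \<circ> \<theta>) ((`) \<phi> ` N' \<union> N)" unfolding valid_diag_def using \<theta>(1,4) inj N by blast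
  let ?f = "diag {} {1..q} \<phi> N" and ?g = "diag M I \<theta> N'"
  show "?f \<bullet>\<^sub>B ?g = diag M I (\<phi> \<circ> \<theta>) ((`) \<phi> ` N' \<union> N)"
  proof (rule comp_eqI[OF diag_brauer[OF vf] diag_brauer[OF vg] diag_brauer[OF v]])
    fix u v' X assume uv: "{u, v'} \<in> diag M I (\<phi> \<circ> \<theta>) ((`) \<phi> ` N' \<union> N)"
      and X: "closed_under (glued_edges ?f ?g) X" and u: "outer u \<in> X"
    have f: "Middle i \<in> X \<longleftrightarrow> Lower (\<phi> i) \<in> X" if "i \<in> {1..q}" for i
      using closed_under_glued(2)[OF X, of "Top i" "Bot (\<phi> i)"] that by (simp add: diag_mem_through)
    have g: "Upper i \<in> X \<longleftrightarrow> Middle (\<theta> i) \<in> X" if "i \<in> I" for i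
      using closed_under_glued(1)[OF X, of "Top i" "Bot (\<theta> i)"] that by (simp add: diag_mem_through)
    consider m where "m \<in> M" "{u, v'} = Top ` m" | i where "i \<in> I" "{u, v'} = {Top i, Bot (\<phi> (\<theta> i))}"
      | m where "m \<in> N'" "{u, v'} = Bot ` \<phi> ` m" | m where "m \<in> N" "{u, v'} = Bot ` m"
      using uv unfolding diag_def by (auto simp: image_iff)
    then show "outer v' \<in> X"
    proof cases
      case 1
      then have "u \<in> Top ` m" "v' \<in> Top ` m" by auto
      then obtain i j where ij: "u = Top i" "v' = Top j" by blast
      then have "{u, v'} \<in> ?g" using 1 unfolding diag_def by blast
      then show ?thesis using closed_under_glued(1)[OF X, of u v'] u ij by simp
    next
      case 2
      have "\<theta> i \<in> {1..q}" using 2 \<theta>(3) by blast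
      then have "Upper i \<in> X \<longleftrightarrow> Lower (\<phi> (\<theta> i)) \<in> X" using f g 2 by simp
      then show ?thesis using 2 u by (auto simp: doubleton_eq_iff)
    next
      case 3
      then have "u \<in> Bot ` \<phi> ` m" "v' \<in> Bot ` \<phi> ` m" by auto
      then obtain i j where ij: "u = Bot (\<phi> i)" "v' = Bot (\<phi> j)" "i \<in> m" "j \<in> m" by blast
      have m: "m \<subseteq> {1..q}" "card m = 2" using is_match_subset[OF \<theta>(5) 3(1)] \<theta>(5) 3(1) by (auto simp: is_match_def)
      show ?thesis
      proof (cases "i = j")
        case True then show ?thesis using ij u by simp
      next
        case False
        then have "m = {i, j}" using m(2) ij by (metis card_2_iff insert_iff singletonD insert_commute)
        then have "Bot ` {i, j} \<in> ?g" using 3(1) diag_mem_bot[OF valid_nonempty(1)[OF vg], of m] by simp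
        then have "Middle i \<in> X \<longleftrightarrow> Middle j \<in> X" using closed_under_glued(1)[OF X, of "Bot i" "Bot j"] by simp
        then show ?thesis using f[of i] f[of j] m ij u by auto
      qed
    next
      case 4
      then have "u \<in> Bot ` m" "v' \<in> Bot ` m" by auto
      then obtain i j where ij: "u = Bot i" "v' = Bot j" by blast
      then have "{u, v'} \<in> ?f" using 4 unfolding diag_def by blast
      then show ?thesis using closed_under_glued(2)[OF X, of u v'] u ij by simp
    qed
  qed
qed

section \<open>Identity, permutation and flipped diagrams\<close>

lemma id_diagram_eq: "id_diagram p = perm_diagram p id"
  by (simp add: id_diagram_def perm_diagram_def)

lemma perm_diagram_diag: "perm_diagram r \<sigma> = diag {} {1..r} \<sigma> {}"
  by (simp add: perm_diagram_def diag_def)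

lemma valid_perm: "\<sigma> permutes {1..r} \<Longrightarrow> valid_diag r r {} {1..r} \<sigma> {}"
  by (simp add: valid_up permutes_image match_empty_iff permutes_inj_on)

lemma level_iff_perm: "d \<in> level_diagrams r \<longleftrightarrow> (\<exists>\<sigma>. \<sigma> permutes {1..r} \<and> d = perm_diagram r \<sigma>)"
proof
  assume d: "d \<in> level_diagrams r"
  then obtain \<theta> N where v: "valid_diag r r {} {1..r} \<theta> N" "d = diag {} {1..r} \<theta> N"
    using upward_diag[of d r r] unfolding level_diagrams_def level_def by blast
  then have "N = {}" using d diag_downward[OF v(1)] by (simp add: level_diagrams_def level_def)
  then have \<theta>: "inj_on \<theta> {1..r}" "\<theta> ` {1..r} = {1..r}" using v(1) by (auto simp: valid_up match_empty_iff)
  \<comment> \<open>\<open>permutes\<close> asks for a function fixing everything outside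
    \<open>{1..r}\<close>, where \<open>\<theta>\<close> is arbitrary.\<close>
  define \<sigma> where "\<sigma> i = (if i \<in> {1..r} then \<theta> i else i)" for i
  have "bij_betw \<sigma> {1..r} {1..r} \<longleftrightarrow> bij_betw \<theta> {1..r} {1..r}"
    by (rule bij_betw_cong) (simp add: \<sigma>_def)
  then have "bij_betw \<sigma> {1..r} {1..r}" using \<theta> by (simp only: bij_betw_def)
  then have "\<sigma> permutes {1..r}" by (rule bij_imp_permutes) (simp only: \<sigma>_def if_False)
  moreover have "d = perm_diagram r \<sigma>"
    unfolding v(2) perm_diagram_diag \<open>N = {}\<close> by (rule diag_cong) (simp add: \<sigma>_def)
  ultimately show "\<exists>\<sigma>. \<sigma> permutes {1..r} \<and> d = perm_diagram r \<sigma>" by blast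
next
  assume "\<exists>\<sigma>. \<sigma> permutes {1..r} \<and> d = perm_diagram r \<sigma>"
  then obtain \<sigma> where \<sigma>: "\<sigma> permutes {1..r}" "d = perm_diagram r \<sigma>" by blast
  then show "d \<in> level_diagrams r"
    using diag_brauer[OF valid_perm[OF \<sigma>(1)]] diag_upward[OF valid_perm[OF \<sigma>(1)]] diag_downward[OF valid_perm[OF \<sigma>(1)]]
    by (simp add: level_diagrams_def level_def perm_diagram_diag)
qed

lemma perm_diagram_level: "\<sigma> permutes {1..r} \<Longrightarrow> perm_diagram r \<sigma> \<in> level_diagrams r"
  using level_iff_perm by blast

lemma perm_diagram_inject:
  assumes "\<sigma> permutes {1..r}" "\<tau> permutes {1..r}" "perm_diagram r \<sigma> = perm_diagram r \<tau>"
  shows "\<sigma> = \<tau>"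
proof
  fix i
  show "\<sigma> i = \<tau> i"
    using diag_inject(4)[OF valid_perm[OF assms(1)] valid_perm[OF assms(2)], of i] assms
    by (cases "i \<in> {1..r}") (auto simp: perm_diagram_diag permutes_def)
qed

lemma diagram_perm_perm_diagram:
  assumes "\<sigma> permutes {1..r}" shows "diagram_perm r (perm_diagram r \<sigma>) = \<sigma>"
  unfolding diagram_perm_def
proof (rule inv_into_f_f)
  show "inj_on (perm_diagram r) (carrier (sym_group r))"
    by (rule inj_onI) (simp add: perm_diagram_inject sym_group_carrier)
qed (simp only: assms sym_group_carrier)

lemma perm_diagram_comp_diag:
  assumes "\<sigma> permutes {1..q}" "valid_diag p q M I \<theta> N"
  shows "perm_diagram q \<sigma> \<bullet>\<^sub>B diag M I \<theta> N = diag M I (\<sigma> \<circ> \<theta>) ((`) \<sigma> ` N)"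
    and "valid_diag p q M I (\<sigma> \<circ> \<theta>) ((`) \<sigma> ` N)"
  using up_comp[OF valid_perm[OF assms(1)] assms(2)] by (simp_all add: perm_diagram_diag)

lemma perm_diagram_comp:
  assumes "\<sigma> permutes {1..r}" "\<tau> permutes {1..r}"
  shows "perm_diagram r \<sigma> \<bullet>\<^sub>B perm_diagram r \<tau> = perm_diagram r (\<sigma> \<circ> \<tau>)"
  using perm_diagram_comp_diag(1)[OF assms(1) valid_perm[OF assms(2)]] by (simp add: perm_diagram_diag)

lemma level_brauer: "d \<in> level_diagrams r \<Longrightarrow> d \<in> brauer r r"
  by (simp add: level_diagrams_def)

lemma up_mono_brauer: "d \<in> up_mono p q \<Longrightarrow> d \<in> brauer p q"
  by (simp add: up_mono_def)

lemma down_mono_brauer: "d \<in> down_mono p q \<Longrightarrow> d \<in> brauer p q"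
  by (simp add: down_mono_def)

lemma level_comp: "d \<in> level_diagrams r \<Longrightarrow> e \<in> level_diagrams r \<Longrightarrow> d \<bullet>\<^sub>B e \<in> level_diagrams r"
  by (metis level_iff_perm perm_diagram_comp permutes_compose)

lemma id_level: "id_diagram p \<in> level_diagrams p"
  by (simp add: id_diagram_eq perm_diagram_level permutes_id)

lemma id_comp: "g \<in> brauer p q \<Longrightarrow> id_diagram q \<bullet>\<^sub>B g = g"
  using perm_diagram_comp_diag(1)[OF permutes_id] by (metis (no_types, lifting) brauer_diag id_comp id_diagram_eq image_cong image_ident image_id id_def)

text \<open>Here the left factor need not be upward, so \<open>up_comp\<close> does not apply;
  instead the closed set criterion identifies each middle point with the outer point above
  it.\<close>

lemma comp_id:
  assumes f: "f \<in> brauer p q" shows "f \<bullet>\<^sub>B id_diagram p = f"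
proof (rule comp_eqI[OF f level_brauer[OF id_level] f])
  fix u v X assume uv: "{u, v} \<in> f" and X: "closed_under (glued_edges f (id_diagram p)) X" and u: "outer u \<in> X"
  have out: "outer w \<in> X \<longleftrightarrow> glue_below w \<in> X" if "w \<in> points p q" for w
  proof (cases w)
    case (Top i)
    then have "i \<in> {1..p}" using that by (auto simp: points_def)
    then have "{Top i, Bot i} \<in> id_diagram p" by (simp add: id_diagram_def)
    then show ?thesis using closed_under_glued(1)[OF X] Top by fastforce
  qed simp
  have "u \<in> points p q" "v \<in> points p q" using uv brauer_Union[OF f] by auto
  then show "outer v \<in> X" using out u closed_under_glued(2)[OF X uv] by simp
qed

text \<open>A loop consists of middle points only, but a middle point on a through strand of either
  factor has an outer point in its component.\<close>

lemma loops_eq_0: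
  assumes f: "f \<in> brauer q r" and g: "g \<in> brauer p q"
    and through: "\<And>i. i \<in> {1..q} \<Longrightarrow> \<exists>j. {Top i, Bot j} \<in> f \<or> {Top j, Bot i} \<in> g"
  shows "loops f g = 0"
proof -
  have "outer -` C \<noteq> {}" if C: "C \<in> glued_components f g" for C
  proof
    assume e: "outer -` C = {}"
    have C': "C \<in> comps (glued_edges f g)" using C by (simp add: glued_components_def comps_def)
    obtain x where x: "x \<in> C" using comps_nonempty[OF C'] by blast
    have out: "outer y \<noteq> x" for y using e x by blast
    then obtain i where i: "x = Middle i" by (metis glued_point.exhaust outer.simps)
    obtain b where b: "b \<in> glued_edges f g" "x \<in> b" using comps_subset[OF C'] x by blast
    have "i \<in> {1..q}"
    proof (cases "b \<in> (`) glue_above ` g")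
      case True
      then obtain c y where "c \<in> g" "y \<in> c" "glue_above y = Middle i" using b i by auto
      then have "y \<in> points p q" "y = Bot i" using brauer_Union[OF g] by (auto, cases y, auto)
      then show ?thesis by (auto simp: points_def)
    next
      case False
      then obtain c y where "c \<in> f" "y \<in> c" "glue_below y = Middle i" using b i unfolding glued_edges_def by auto
      then have "y \<in> points q r" "y = Top i" using brauer_Union[OF f] by (auto, cases y, auto)
      then show ?thesis by (auto simp: points_def)
    qed
    then obtain j where "{Top i, Bot j} \<in> f \<or> {Top j, Bot i} \<in> g" using through by blast
    then have "outer (Bot j) \<in> C \<or> outer (Top j) \<in> C"
      using closed_under_glued(1)[OF comps_closed[OF C'], of "Top j" "Bot i"]
        closed_under_glued(2)[OF comps_closed[OF C'], of "Top i" "Bot j"] x i by auto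
    then show False using e by blast
  qed
  then have "{C \<in> glued_components f g. outer -` C = {}} = {}" by blast
  then show ?thesis unfolding loops_def by (metis card.empty)
qed

lemma loops_upward:
  assumes f: "f \<in> brauer q r" "upward f" and g: "g \<in> brauer p q"
  shows "loops f g = 0"
proof (rule loops_eq_0[OF f(1) g])
  obtain \<theta> N where "f = diag {} {1..q} \<theta> N" using upward_diag[OF f] by blast
  then have "{Top i, Bot (\<theta> i)} \<in> f" if "i \<in> {1..q}" for i
    using that by (simp add: diag_mem_through)
  then show "\<exists>j. {Top i, Bot j} \<in> f \<or> {Top j, Bot i} \<in> g" if "i \<in> {1..q}" for i
    using that by blast
qed

lemma loops_downward:
  assumes g: "g \<in> brauer p q" "downward g" and f: "f \<in> brauer q r"
  shows "loops f g = 0"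
proof (rule loops_eq_0[OF f g(1)])
  obtain M I \<theta> where v: "valid_diag p q M I \<theta> {}" "g = diag M I \<theta> {}" using downward_diag[OF g] by blast
  fix i assume "i \<in> {1..q}"
  moreover have "\<theta> ` I = {1..q}" using v(1) by (simp only: valid_down)
  ultimately obtain k where "k \<in> I" "i = \<theta> k" by (metis imageE)
  then show "\<exists>j. {Top i, Bot j} \<in> f \<or> {Top j, Bot i} \<in> g" using v by (auto simp: diag_mem_through)
qed

section \<open>Downward diagrams under composition\<close>

lemma downward_compD:
  assumes f: "f \<in> brauer q r" and g: "g \<in> brauer p q" and dw: "downward (f \<bullet>\<^sub>B g)"
  shows "downward f"
  unfolding downward_def
proof
  assume "\<exists>i j. {Bot i, Bot j} \<in> f"
  then obtain i j where ij: "{Bot i, Bot j} \<in> f" by blast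
  have "card {Bot i, Bot j} = 2" using f ij by (simp add: brauer_def)
  then have neq: "Bot i \<noteq> Bot j" by auto
  have "Bot i \<in> points q r" using ij brauer_Union[OF f] by blast
  then have pt: "Bot i \<in> points p r" by (auto simp: points_def)
  have "{Bot i, Bot j} \<in> f \<bullet>\<^sub>B g"
    by (rule comp_memI[OF f g pt neq]) (use closed_under_glued(2)[OF _ ij] in simp)
  then show False using dw unfolding downward_def by blast
qed

lemma downward_level_comp:
  assumes d: "d \<in> level_diagrams s" and x: "x \<in> brauer p s"
  shows "downward (d \<bullet>\<^sub>B x) \<longleftrightarrow> downward x"
proof -
  obtain \<sigma> where \<sigma>: "\<sigma> permutes {1..s}" "d = perm_diagram s \<sigma>" using d level_iff_perm by blast
  obtain M I \<theta> N where v: "valid_diag p s M I \<theta> N" "x = diag M I \<theta> N" using brauer_diag[OF x] .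
  show ?thesis
    using diag_downward[OF v(1)] diag_downward[OF perm_diagram_comp_diag(2)[OF \<sigma>(1) v(1)]]
      perm_diagram_comp_diag(1)[OF \<sigma>(1) v(1)] v \<sigma> by simp
qed

text \<open>All \<open>s\<close> bottom points lie on through strands, which need \<open>s\<close>
  distinct top points; if \<open>s = r\<close>, no top point remains to be paired. This is the
  source of both the triangularity of L and the level condition in the Gram matrices.\<close>

lemma downward_rank:
  assumes d: "d \<in> brauer r s" "downward d"
  shows "s \<le> r" and "s = r \<Longrightarrow> level d"
proof -
  obtain M I \<theta> where v: "valid_diag r s M I \<theta> {}" "d = diag M I \<theta> {}" using downward_diag[OF d] .
  have I: "I \<subseteq> {1..r}" "card I = s" using v(1) card_image[of \<theta> I] by (auto simp: valid_down)
  show "s \<le> r" using card_mono[OF _ I(1)] I(2) by simp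
  assume "s = r"
  then have "I = {1..r}" using card_subset_eq[OF _ I(1)] I(2) by simp
  then have "M = {}" using v(1) is_match_Union by (fastforce simp: valid_down is_match_def partition_on_def)
  then show "level d" using diag_upward[OF v(1)] d v(2) by (simp add: level_def)
qed

section \<open>Flipping diagrams\<close>

lemma flip_flip: "flip (flip d) = d"
proof -
  have "flip_point (flip_point x) = x" for x by (cases x) auto
  then show ?thesis unfolding flip_def by (simp add: image_image)
qed

lemma flip_mem: "b \<in> flip d \<longleftrightarrow> flip_point ` b \<in> d"
proof -
  have *: "flip_point ` flip_point ` c = c" for c
  proof -
    have "flip_point (flip_point x) = x" for x by (cases x) auto
    then show ?thesis by (simp add: image_image)
  qed
  then show ?thesis unfolding flip_def by (metis image_iff)
qed

lemma flip_brauer: "d \<in> brauer p q \<Longrightarrow> flip d \<in> brauer q p"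
proof -
  assume "d \<in> brauer p q"
  then have m: "is_match (points p q) d" by (simp add: brauer_is_match)
  have "inj_on flip_point (points p q)"
    by (rule inj_on_inverseI[where g = flip_point]) (metis flip_point.simps point.exhaust)
  from is_match_image_on[OF this m]
  have "is_match (flip_point ` points p q) (flip d)" by (simp add: flip_def)
  moreover have "flip_point ` points p q = points q p"
    unfolding points_def by (simp add: image_Un image_image Un_commute)
  ultimately show ?thesis by (simp add: brauer_is_match)
qed

lemma flip_upward: "upward (flip d) \<longleftrightarrow> downward d" and flip_downward: "downward (flip d) \<longleftrightarrow> upward d"
  unfolding upward_def downward_def by (simp_all add: flip_mem)

lemma flip_monotone: "monotone_diagram d \<Longrightarrow> monotone_diagram (flip d)"
  unfolding monotone_diagram_def
proof (intro allI impI)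
  fix i j k l
  assume m: "\<forall>i j k l. {Top i, Bot j} \<in> d \<longrightarrow> {Top k, Bot l} \<in> d \<longrightarrow> {Top i, Bot j} \<noteq> {Top k, Bot l} \<longrightarrow>
      0 < (int i - int k) * (int j - int l)"
    and a: "{Top i, Bot j} \<in> flip d" "{Top k, Bot l} \<in> flip d" "{Top i, Bot j} \<noteq> {Top k, Bot l}"
  have "{Top j, Bot i} \<in> d" "{Top l, Bot k} \<in> d" using a(1,2) by (simp_all add: flip_mem insert_commute)
  moreover have "{Top j, Bot i} \<noteq> {Top l, Bot k}" using a(3) by (auto simp: doubleton_eq_iff)
  ultimately have "0 < (int j - int l) * (int i - int k)" using m by blast
  then show "0 < (int i - int k) * (int j - int l)" by (simp add: mult.commute)
qed

lemma flip_up_mono: "d \<in> up_mono p q \<Longrightarrow> flip d \<in> down_mono q p"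
  and flip_down_mono: "d \<in> down_mono p q \<Longrightarrow> flip d \<in> up_mono q p"
  by (simp_all add: up_mono_def down_mono_def flip_brauer flip_monotone flip_upward flip_downward)

section \<open>The factorization of a diagram\<close>

text \<open>The position of \<open>i\<close> in the increasing enumeration of \<open>I\<close>,
  counted from 1 to fit the numbering of the points.\<close>

definition rank_in :: "nat set \<Rightarrow> nat \<Rightarrow> nat" where
  "rank_in I i = card {j \<in> I. j \<le> i}"

lemma rank_in_strict_mono:
  assumes "finite I" shows "strict_mono_on I (rank_in I)"
proof (rule strict_mono_onI)
  fix i k assume ik: "i \<in> I" "k \<in> I" "i < k"
  have "k \<in> {j \<in> I. j \<le> k}" "k \<notin> {j \<in> I. j \<le> i}" "{j \<in> I. j \<le> i} \<subseteq> {j \<in> I. j \<le> k}" using ik by auto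
  then have "{j \<in> I. j \<le> i} \<subset> {j \<in> I. j \<le> k}" by blast
  then show "rank_in I i < rank_in I k" unfolding rank_in_def using assms by (intro psubset_card_mono) auto
qed

lemma rank_in_image:
  assumes "finite I" shows "rank_in I ` I = {1..card I}"
proof (rule card_subset_eq)
  show "rank_in I ` I \<subseteq> {1..card I}"
  proof
    fix x assume "x \<in> rank_in I ` I"
    then obtain i where i: "i \<in> I" "x = rank_in I i" by blast
    have "{j \<in> I. j \<le> i} \<noteq> {}" using i by blast
    then have "x \<noteq> 0" using assms i by (simp add: rank_in_def)
    moreover have "x \<le> card I" unfolding i rank_in_def by (rule card_mono[OF assms]) blast
    ultimately show "x \<in> {1..card I}" by simp
  qed
  show "card (rank_in I ` I) = card {1..card I}"
    using card_image[OF strict_mono_on_imp_inj_on[OF rank_in_strict_mono[OF assms]]] by simp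
qed simp

text \<open>An increasing map onto an initial segment sends the elements of \<open>I\<close> up to
  \<open>i\<close> onto \<open>{1..\<theta> i}\<close>; counting them gives the value.\<close>

lemma rank_in_unique:
  assumes m: "strict_mono_on I \<theta>" and im: "\<theta> ` I = {1..r}" and i: "i \<in> I"
  shows "\<theta> i = rank_in I i"
proof -
  have "\<theta> ` {j \<in> I. j \<le> i} = {1..\<theta> i}"
  proof (rule subset_antisym; rule subsetI)
    fix x assume "x \<in> \<theta> ` {j \<in> I. j \<le> i}"
    then obtain j where j: "j \<in> I" "j \<le> i" "x = \<theta> j" by blast
    then have "x \<le> \<theta> i" using strict_mono_onD[OF m j(1) i] by (cases "j = i") auto
    moreover have "x \<in> {1..r}" using j im by blast
    ultimately show "x \<in> {1..\<theta> i}" by simp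
  next
    fix x assume x: "x \<in> {1..\<theta> i}"
    have "\<theta> i \<in> {1..r}" using im i by blast
    then have "x \<in> \<theta> ` I" using x im by auto
    then obtain j where j: "j \<in> I" "x = \<theta> j" by blast
    have "\<not> i < j" using strict_mono_onD[OF m i j(1)] x j by auto
    then show "x \<in> \<theta> ` {j \<in> I. j \<le> i}" using j by auto
  qed
  moreover have "inj_on \<theta> {j \<in> I. j \<le> i}" by (rule inj_on_subset[OF strict_mono_on_imp_inj_on[OF m]]) blast
  ultimately show ?thesis unfolding rank_in_def using card_image by fastforce
qed

section \<open>Normal forms of monotone diagrams\<close>

lemma up_mono_diag:
  assumes "a \<in> up_mono r q"
  obtains \<phi> N where "valid_diag r q {} {1..r} \<phi> N" "a = diag {} {1..r} \<phi> N" "strict_mono_on {1..r} \<phi>"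
proof -
  obtain \<phi> N where v: "valid_diag r q {} {1..r} \<phi> N" "a = diag {} {1..r} \<phi> N"
    using upward_diag[of a r q] assms unfolding up_mono_def by blast
  then show thesis using that assms diag_monotone unfolding up_mono_def by blast
qed

lemma down_mono_diag:
  assumes "c \<in> down_mono p r"
  obtains M I where "valid_diag p r M I (rank_in I) {}" "c = diag M I (rank_in I) {}"
proof -
  obtain M I \<theta> where v: "valid_diag p r M I \<theta> {}" "c = diag M I \<theta> {}"
    using downward_diag[of c p r] assms unfolding down_mono_def by blast
  have m: "strict_mono_on I \<theta>" using assms v diag_monotone unfolding down_mono_def by blast
  have I: "I \<subseteq> {1..p}" "\<theta> ` I = {1..r}" "is_match ({1..p} - I) M" using v(1) by (simp_all add: valid_down)
  have eq: "\<theta> i = rank_in I i" if "i \<in> I" for i using rank_in_unique[OF m I(2) that] .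
  have "valid_diag p r M I (rank_in I) {}"
    using v(1) eq unfolding valid_down by (simp cong: inj_on_cong image_cong)
  moreover have "c = diag M I (rank_in I) {}" unfolding v(2) using eq by (rule diag_cong)
  ultimately show thesis using that by blast
qed

text \<open>The strictly increasing \<open>\<phi>\<close> is determined by its image, the complement of the points paired
  by \<open>N\<close>.\<close>

lemma up_mono_unique:
  assumes v: "valid_diag r q {} {1..r} \<phi> N" "strict_mono_on {1..r} \<phi>"
    and v': "valid_diag r' q {} {1..r'} \<phi>' N" "strict_mono_on {1..r'} \<phi>'"
  shows "r = r'" and "i \<in> {1..r} \<Longrightarrow> \<phi> i = \<phi>' i"
proof -
  have J: "\<psi> ` {1..s} = {1..q} - \<Union>N" if "valid_diag s q {} {1..s} \<psi> N" for \<psi> s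
    using that is_match_Union[of "{1..q} - \<psi> ` {1..s}" N] by (auto simp: valid_up)
  have c: "s = card ({1..q} - \<Union>N)" if "valid_diag s q {} {1..s} \<psi> N" for \<psi> s
    using J[OF that] that card_image[of \<psi> "{1..s}"] by (simp add: valid_up)
  show rr: "r = r'" using c[OF v(1)] c[OF v'(1)] by simp
  let ?J = "{1..q} - \<Union>N"
  \<comment> \<open>\<open>\<psi>\<close> lists \<open>?J\<close> in increasing order, so
    \<open>rank_in ?J\<close> inverts it; as \<open>?J\<close> depends on \<open>N\<close> alone, so
    does \<open>\<psi>\<close>.\<close>
  have rk: "rank_in ?J (\<psi> i) = i" if s: "valid_diag s q {} {1..s} \<psi> N" "strict_mono_on {1..s} \<psi>" "i \<in> {1..s}" for \<psi> s i
  proof -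
    have "\<psi> ` {j \<in> {1..s}. j \<le> i} = {j \<in> ?J. j \<le> \<psi> i}"
    proof (rule subset_antisym; rule subsetI)
      fix x assume "x \<in> \<psi> ` {j \<in> {1..s}. j \<le> i}"
      then obtain j where j: "j \<in> {1..s}" "j \<le> i" "x = \<psi> j" by blast
      then have "x \<le> \<psi> i" using strict_mono_onD[OF s(2) j(1) s(3)] by (cases "j = i") auto
      moreover have "x \<in> ?J" using j J[OF s(1)] by blast
      ultimately show "x \<in> {j \<in> ?J. j \<le> \<psi> i}" by blast
    next
      fix x assume x: "x \<in> {j \<in> ?J. j \<le> \<psi> i}"
      then have "x \<in> \<psi> ` {1..s}" using J[OF s(1)] by blast
      then obtain j where j: "j \<in> {1..s}" "x = \<psi> j" by blast
      have "\<not> i < j" using strict_mono_onD[OF s(2) s(3) j(1)] x j by auto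
      then show "x \<in> \<psi> ` {j \<in> {1..s}. j \<le> i}" using j by auto
    qed
    moreover have "inj_on \<psi> {j \<in> {1..s}. j \<le> i}" by (rule inj_on_subset[OF strict_mono_on_imp_inj_on[OF s(2)]]) blast
    moreover have "{j \<in> {1..s}. j \<le> i} = {1..i}" using s(3) by auto
    ultimately show ?thesis unfolding rank_in_def using card_image by fastforce
  qed
  assume i: "i \<in> {1..r}"
  have "\<phi> i \<in> ?J" "\<phi>' i \<in> ?J" using J[OF v(1)] J[OF v'(1)] i rr by blast+
  moreover have "rank_in ?J (\<phi> i) = rank_in ?J (\<phi>' i)" using rk[OF v i] rk[OF v'] i rr by simp
  ultimately show "\<phi> i = \<phi>' i"
    using strict_mono_on_imp_inj_on[OF rank_in_strict_mono[of ?J]] by (meson finite_Diff finite_atLeastAtMost inj_onD)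
qed

lemma triple_comp:
  assumes a: "valid_diag r q {} {1..r} \<phi> N" and s: "\<sigma> permutes {1..r}" and c: "valid_diag p r M I \<omega> {}"
  shows "diag {} {1..r} \<phi> N \<bullet>\<^sub>B perm_diagram r \<sigma> \<bullet>\<^sub>B diag M I \<omega> {} = diag M I (\<phi> \<circ> (\<sigma> \<circ> \<omega>)) N"
    and "valid_diag p q M I (\<phi> \<circ> (\<sigma> \<circ> \<omega>)) N"
  using perm_diagram_comp_diag[OF s c] up_comp[OF a perm_diagram_comp_diag(2)[OF s c]] by simp_all

text \<open>The product displays \<open>M\<close>, \<open>I\<close>, \<open>N\<close> and
  \<open>\<phi> \<circ> (\<sigma> \<circ> rank_in I)\<close>. The first two give the downward
  factor, \<open>N\<close> gives the upward one, and cancelling the injective \<open>\<phi>\<close>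
  and the surjective \<open>rank_in I\<close> gives the level one.\<close>

lemma factorization_unique:
  assumes a: "a \<in> up_mono r q" "a' \<in> up_mono r' q" and b: "b \<in> level_diagrams r" "b' \<in> level_diagrams r'"
    and c: "c \<in> down_mono p r" "c' \<in> down_mono p r'"
    and eq: "a \<bullet>\<^sub>B b \<bullet>\<^sub>B c = a' \<bullet>\<^sub>B b' \<bullet>\<^sub>B c'"
  shows "r = r' \<and> a = a' \<and> b = b' \<and> c = c'"
proof -
  obtain \<phi> N where A: "valid_diag r q {} {1..r} \<phi> N" "a = diag {} {1..r} \<phi> N" "strict_mono_on {1..r} \<phi>"
    using up_mono_diag[OF a(1)] .
  obtain \<phi>' N' where A': "valid_diag r' q {} {1..r'} \<phi>' N'" "a' = diag {} {1..r'} \<phi>' N'" "strict_mono_on {1..r'} \<phi>'"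
    using up_mono_diag[OF a(2)] .
  obtain M I where C: "valid_diag p r M I (rank_in I) {}" "c = diag M I (rank_in I) {}" using down_mono_diag[OF c(1)] .
  obtain M' I' where C': "valid_diag p r' M' I' (rank_in I') {}" "c' = diag M' I' (rank_in I') {}" using down_mono_diag[OF c(2)] .
  obtain \<sigma> where S: "\<sigma> permutes {1..r}" "b = perm_diagram r \<sigma>" using b(1) level_iff_perm by blast
  obtain \<sigma>' where S': "\<sigma>' permutes {1..r'}" "b' = perm_diagram r' \<sigma>'" using b(2) level_iff_perm by blast
  have e: "diag M I (\<phi> \<circ> (\<sigma> \<circ> rank_in I)) N = diag M' I' (\<phi>' \<circ> (\<sigma>' \<circ> rank_in I')) N'"
    using eq triple_comp(1)[OF A(1) S(1) C(1)] triple_comp(1)[OF A'(1) S'(1) C'(1)]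
    unfolding A(2) A'(2) C(2) C'(2) S(2) S'(2) by simp
  note d = diag_inject[OF triple_comp(2)[OF A(1) S(1) C(1)] triple_comp(2)[OF A'(1) S'(1) C'(1)] e]
  have r: "r = r'" and \<phi>: "\<And>i. i \<in> {1..r} \<Longrightarrow> \<phi> i = \<phi>' i"
    using up_mono_unique[OF A(1,3)] A'(1,3) d(3) by simp_all
  have "a = a'" unfolding A(2) A'(2) r[symmetric] d(3)[symmetric] using \<phi> by (rule diag_cong)
  moreover have "c = c'" unfolding C(2) C'(2) d(1,2) ..
  moreover have "b = b'"
    unfolding S(2) S'(2) r[symmetric] perm_diagram_diag
  proof (rule diag_cong)
    fix i assume i: "i \<in> {1..r}"
    have "rank_in I ` I = {1..r}" using C(1) by (simp add: valid_down)
    then obtain k where k: "k \<in> I" "i = rank_in I k" using i by blast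
    have "\<phi> (\<sigma> i) = \<phi>' (\<sigma>' i)" using d(4)[OF k(1)] k d(2) by simp
    moreover have "\<sigma> i \<in> {1..r}" "\<sigma>' i \<in> {1..r}" using S(1) S'(1) i r by (simp_all only: permutes_in_image)
    ultimately show "\<sigma> i = \<sigma>' i" using \<phi> strict_mono_on_imp_inj_on[OF A(3)] by (metis inj_onD)
  qed
  ultimately show ?thesis using r by simp
qed

text \<open>Sort the top ends \<open>I\<close> and the bottom ends \<open>J\<close> of the through
  strands separately; the crossings that sorting removes are stored in a permutation of
  positions.\<close>

lemma factorization_exists:
  assumes f: "f \<in> brauer p q"
  obtains r a b c where "a \<in> up_mono r q" "b \<in> level_diagrams r" "c \<in> down_mono p r" "f = a \<bullet>\<^sub>B b \<bullet>\<^sub>B c"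
proof -
  obtain M I \<theta> N where v: "valid_diag p q M I \<theta> N" "f = diag M I \<theta> N" using brauer_diag[OF f] .
  have I: "I \<subseteq> {1..p}" "inj_on \<theta> I" "\<theta> ` I \<subseteq> {1..q}" "is_match ({1..p} - I) M" "is_match ({1..q} - \<theta> ` I) N"
    using v(1) by (simp_all add: valid_diag_def)
  define r where "r = card I"
  define J where "J = \<theta> ` I"
  have fin: "finite I" "finite J" using I(1) finite_subset unfolding J_def by (blast, blast)
  have cJ: "card J = r" unfolding J_def r_def by (rule card_image[OF I(2)])
  note mI = rank_in_strict_mono[OF fin(1)] and mJ = rank_in_strict_mono[OF fin(2)]
  have iI: "rank_in I ` I = {1..r}" and iJ: "rank_in J ` J = {1..r}"
    using rank_in_image[OF fin(1)] rank_in_image[OF fin(2)] cJ r_def by simp_all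
  \<comment> \<open>\<open>\<psi>\<close> enumerates \<open>J\<close> increasingly.
    \<open>\<sigma>\<close> sends the position of a top end to the position of its bottom end, and
    is the identity outside \<open>{1..r}\<close> as \<open>permutes\<close> demands.\<close>
  define \<psi> where "\<psi> = inv_into J (rank_in J)"
  define \<sigma> where "\<sigma> i = (if i \<in> {1..r} then rank_in J (\<theta> (inv_into I (rank_in I) i)) else i)" for i
  have \<psi>: "\<psi> (rank_in J j) = j" if "j \<in> J" for j
    unfolding \<psi>_def by (rule inv_into_f_f[OF strict_mono_on_imp_inj_on[OF mJ] that])
  have \<psi>J: "\<psi> i \<in> J" "rank_in J (\<psi> i) = i" if "i \<in> {1..r}" for i
    using that iJ unfolding \<psi>_def by (simp_all add: inv_into_into f_inv_into_f)
  have \<psi>m: "strict_mono_on {1..r} \<psi>"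
  proof (rule strict_mono_onI)
    fix i k assume ik: "i \<in> {1..r}" "k \<in> {1..r}" "i < k"
    show "\<psi> i < \<psi> k"
    proof (rule ccontr)
      assume "\<not> \<psi> i < \<psi> k"
      then have "rank_in J (\<psi> k) \<le> rank_in J (\<psi> i)"
        using strict_mono_onD[OF mJ \<psi>J(1)[OF ik(2)] \<psi>J(1)[OF ik(1)]] by (cases "\<psi> k = \<psi> i") auto
      then show False using \<psi>J(2)[OF ik(1)] \<psi>J(2)[OF ik(2)] ik(3) by simp
    qed
  qed
  have \<psi>im: "\<psi> ` {1..r} = J"
    using \<psi>J(1) \<psi> iJ by (metis (no_types, lifting) image_eqI image_subset_iff subsetI subset_antisym)
  have va: "valid_diag r q {} {1..r} \<psi> N"
    unfolding valid_up \<psi>im using strict_mono_on_imp_inj_on[OF \<psi>m] I unfolding J_def by simp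
  have vc: "valid_diag p r M I (rank_in I) {}"
    unfolding valid_down using iI I strict_mono_on_imp_inj_on[OF mI] by simp
  have \<sigma>r: "\<sigma> (rank_in I i) = rank_in J (\<theta> i)" if "i \<in> I" for i
  proof -
    have "rank_in I i \<in> {1..r}" using iI that by blast
    then show ?thesis unfolding \<sigma>_def using inv_into_f_f[OF strict_mono_on_imp_inj_on[OF mI] that] by simp
  qed
  have "\<sigma> ` {1..r} = rank_in J ` \<theta> ` I"
    unfolding iI[symmetric] image_image using \<sigma>r by (simp cong: image_cong)
  then have \<sigma>im: "\<sigma> ` {1..r} = {1..r}" unfolding J_def[symmetric] iJ .
  then have "bij_betw \<sigma> {1..r} {1..r}" by (simp add: bij_betw_def eq_card_imp_inj_on)
  then have s: "\<sigma> permutes {1..r}" by (rule bij_imp_permutes) (simp only: \<sigma>_def if_False)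
  have "f = diag {} {1..r} \<psi> N \<bullet>\<^sub>B perm_diagram r \<sigma> \<bullet>\<^sub>B diag M I (rank_in I) {}"
    unfolding triple_comp(1)[OF va s vc] v(2)
  proof (rule diag_cong)
    fix i assume i: "i \<in> I"
    then have "\<theta> i \<in> J" by (simp add: J_def)
    then show "\<theta> i = (\<psi> \<circ> (\<sigma> \<circ> rank_in I)) i" using \<sigma>r[OF i] \<psi> by simp
  qed
  moreover have "diag {} {1..r} \<psi> N \<in> up_mono r q"
    unfolding up_mono_def using diag_brauer[OF va] diag_upward[OF va] diag_monotone \<psi>m by blast
  moreover have "diag M I (rank_in I) {} \<in> down_mono p r"
    unfolding down_mono_def using diag_brauer[OF vc] diag_downward[OF vc] diag_monotone mI by blast
  ultimately show thesis using that perm_diagram_level[OF s] by blast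
qed

lemma factorization_eq:
  assumes "a \<in> up_mono r q" "b \<in> level_diagrams r" "c \<in> down_mono p r"
  shows "factorization p q (a \<bullet>\<^sub>B b \<bullet>\<^sub>B c) = (r, a, b, c)"
  unfolding factorization_def
proof (rule the_equality)
  show "case (r, a, b, c) of (r, a', b', c') \<Rightarrow> a' \<in> up_mono r q \<and> b' \<in> level_diagrams r \<and> c' \<in> down_mono p r \<and>
      a \<bullet>\<^sub>B b \<bullet>\<^sub>B c = a' \<bullet>\<^sub>B b' \<bullet>\<^sub>B c'"
    using assms by simp
next
  fix x assume x: "case x of (r, a', b', c') \<Rightarrow> a' \<in> up_mono r q \<and> b' \<in> level_diagrams r \<and> c' \<in> down_mono p r \<and>
      a \<bullet>\<^sub>B b \<bullet>\<^sub>B c = a' \<bullet>\<^sub>B b' \<bullet>\<^sub>B c'"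
  obtain r' a' b' c' where x': "x = (r', a', b', c')" by (cases x) auto
  show "x = (r, a, b, c)"
    using factorization_unique[OF assms(1) _ assms(2) _ assms(3)] x unfolding x' by auto
qed

section \<open>Factoring downward diagrams; parity and finiteness of the index sets\<close>

lemma factor_brauer:
  assumes "a \<in> up_mono r q" "b \<in> level_diagrams r" "c \<in> down_mono p r"
  shows "a \<bullet>\<^sub>B b \<bullet>\<^sub>B c \<in> brauer p q"
  using assms by (meson brauer_comp down_mono_brauer level_brauer up_mono_brauer)

lemma up_down_level:
  assumes "a \<in> brauer r s" "upward a" "downward a"
  shows "s = r \<and> a \<in> level_diagrams r"
proof -
  have "s \<le> r" using downward_rank(1)[OF assms(1,3)] .
  moreover have "r \<le> s" using downward_rank(1)[OF flip_brauer[OF assms(1)]] assms(2) by (simp add: flip_downward)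
  ultimately show ?thesis using assms by (auto simp: level_diagrams_def level_def)
qed

text \<open>A pair of bottom points in the upward factor would persist in \<open>x\<close>. So that
  factor is both upward and downward, hence level, and is absorbed into the middle.\<close>

lemma downward_factor:
  assumes x: "x \<in> brauer p s" "downward x"
  obtains b c where "b \<in> level_diagrams s" "c \<in> down_mono p s" "x = b \<bullet>\<^sub>B c"
proof -
  obtain r a b c where f: "a \<in> up_mono r s" "b \<in> level_diagrams r" "c \<in> down_mono p r" "x = a \<bullet>\<^sub>B b \<bullet>\<^sub>B c"
    using factorization_exists[OF x(1)] .
  have "downward a"
    by (rule downward_compD[OF up_mono_brauer[OF f(1)] brauer_comp[OF level_brauer[OF f(2)] down_mono_brauer[OF f(3)]]])
      (use f x in simp)
  then have "s = r" "a \<in> level_diagrams r" using up_down_level[of a r s] f(1) by (auto simp: up_mono_def)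
  then show thesis using that[of "a \<bullet>\<^sub>B b" c] f level_comp by (simp add: diagram_comp_assoc)
qed

lemma even_match: "finite S \<Longrightarrow> is_match S P \<Longrightarrow> even (card S)"
proof -
  assume S: "finite S" "is_match S P"
  have "pairwise disjnt P" using S by (simp add: is_match_def partition_on_def)
  moreover have "finite b" if "b \<in> P" for b using is_match_subset[OF S(2) that] S(1) finite_subset by blast
  ultimately have "card (\<Union>P) = sum card P" by (rule card_Union_disjoint)
  also have "\<dots> = 2 * card P" using S(2) by (simp add: is_match_def)
  finally show ?thesis using is_match_Union[OF S(2)] by simp
qed

lemma up_mono_preceq: "a \<in> up_mono r p \<Longrightarrow> r \<preceq> p"
proof -
  assume "a \<in> up_mono r p"
  then obtain \<phi> N where v: "valid_diag r p {} {1..r} \<phi> N" by (rule up_mono_diag)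
  then have "is_match ({1..p} - \<phi> ` {1..r}) N" "\<phi> ` {1..r} \<subseteq> {1..p}" "card (\<phi> ` {1..r}) = r"
    using card_image[of \<phi> "{1..r}"] by (simp_all add: valid_up)
  then show ?thesis
    using even_match[of "{1..p} - \<phi> ` {1..r}" N] card_mono[of "{1..p}" "\<phi> ` {1..r}"]
    by (simp add: preceq_def card_Diff_subset)
qed

lemma up_mono_source_unique: "a \<in> up_mono r p \<Longrightarrow> a \<in> up_mono s p \<Longrightarrow> r = s"
proof -
  assume "a \<in> up_mono r p" "a \<in> up_mono s p"
  then have "points r p = points s p" using brauer_Union up_mono_brauer by metis
  moreover have "Top i \<in> points t p \<longleftrightarrow> i \<in> {1..t}" for i t by (auto simp: points_def)
  ultimately have "{1..r} = {1..s}" by blast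
  then show "r = s" by (metis card_atLeastAtMost diff_Suc_1)
qed

lemma finite_up_mono: "finite (up_mono r p)"
  using finite_brauer[of r p] by (rule rev_finite_subset) (auto simp: up_mono_def)

section \<open>Finite sums and linear maps over a commutative ring\<close>

context abelian_monoid
begin

text \<open>Serves to cut a sum over all diagrams down to the contributing ones, which
  \<open>e\<close> parametrizes by their factors.\<close>

lemma finsum_support_reindex:
  assumes "finite X" "inj_on e K" "e ` K \<subseteq> X" "F \<in> X \<rightarrow> carrier G"
    and "\<And>x. x \<in> X \<Longrightarrow> x \<notin> e ` K \<Longrightarrow> F x = \<zero>"
  shows "finsum G F X = finsum G (\<lambda>k. F (e k)) K"
proof -
  have "finsum G F X = finsum G F (e ` K)"
    by (rule add.finprod_mono_neutral_cong_right) (use assms in auto)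
  also have "\<dots> = finsum G (\<lambda>k. F (e k)) K"
    by (rule finsum_reindex[OF _ assms(2)]) (use assms in auto)
  finally show ?thesis .
qed

lemma finsum_eq_single:
  assumes "finite X" "x \<in> X" "F x \<in> carrier G" "\<And>y. y \<in> X \<Longrightarrow> y \<noteq> x \<Longrightarrow> F y = \<zero>"
  shows "finsum G F X = F x"
proof -
  have "F \<in> X \<rightarrow> carrier G" using assms(3,4) by (metis Pi_I zero_closed)
  then have "finsum G F X = finsum G F {x}"
    by (intro add.finprod_mono_neutral_cong_right) (use assms in auto)
  then show ?thesis using assms(3) by simp
qed

lemma finsum_cartesian:
  assumes "finite A" "finite B" "\<And>a b. a \<in> A \<Longrightarrow> b \<in> B \<Longrightarrow> F a b \<in> carrier G"
  shows "(\<Oplus>z\<in>A \<times> B. F (fst z) (snd z)) = (\<Oplus>a\<in>A. \<Oplus>b\<in>B. F a b)"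
  using assms(1,3)
proof (induction A rule: finite_induct)
  case (insert a A)
  have "insert a A \<times> B = Pair a ` B \<union> A \<times> B" by auto
  moreover have "(\<Oplus>z\<in>Pair a ` B \<union> A \<times> B. F (fst z) (snd z)) =
      (\<Oplus>z\<in>Pair a ` B. F (fst z) (snd z)) \<oplus> (\<Oplus>z\<in>A \<times> B. F (fst z) (snd z))"
    by (rule finsum_Un_disjoint) (use insert assms(2) in auto)
  moreover have "(\<Oplus>z\<in>Pair a ` B. F (fst z) (snd z)) = (\<Oplus>b\<in>B. F a b)"
    by (subst finsum_reindex) (use insert in \<open>auto simp: inj_on_def\<close>)
  moreover have "(\<Oplus>z\<in>A \<times> B. F (fst z) (snd z)) = (\<Oplus>a\<in>A. \<Oplus>b\<in>B. F a b)"
    by (rule insert.IH) (use insert in auto)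
  moreover have "(\<Oplus>a\<in>insert a A. \<Oplus>b\<in>B. F a b) = (\<Oplus>b\<in>B. F a b) \<oplus> (\<Oplus>a\<in>A. \<Oplus>b\<in>B. F a b)"
    by (rule finsum_insert) (use insert in \<open>auto intro!: finsum_closed\<close>)
  ultimately show ?case by simp
qed simp

lemma finsum_exchange:
  assumes "finite A" "finite B" "\<And>a b. a \<in> A \<Longrightarrow> b \<in> B \<Longrightarrow> F a b \<in> carrier G"
  shows "(\<Oplus>a\<in>A. \<Oplus>b\<in>B. F a b) = (\<Oplus>b\<in>B. \<Oplus>a\<in>A. F a b)"
  using assms(1,3)
proof (induction A rule: finite_induct)
  case (insert a A)
  have "(\<Oplus>a\<in>insert a A. \<Oplus>b\<in>B. F a b) = (\<Oplus>b\<in>B. F a b) \<oplus> (\<Oplus>a\<in>A. \<Oplus>b\<in>B. F a b)"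
    by (rule finsum_insert) (use insert in \<open>auto intro!: finsum_closed\<close>)
  also have "(\<Oplus>a\<in>A. \<Oplus>b\<in>B. F a b) = (\<Oplus>b\<in>B. \<Oplus>a\<in>A. F a b)"
    by (rule insert.IH) (use insert in auto)
  also have "(\<Oplus>b\<in>B. F a b) \<oplus> (\<Oplus>b\<in>B. \<Oplus>a\<in>A. F a b) = (\<Oplus>b\<in>B. F a b \<oplus> (\<Oplus>a\<in>A. F a b))"
    by (rule finsum_addf[symmetric]) (use insert in \<open>auto intro!: finsum_closed\<close>)
  also have "\<dots> = (\<Oplus>b\<in>B. \<Oplus>a\<in>insert a A. F a b)"
    by (rule finsum_cong') (use insert in \<open>auto intro!: finsum_closed finsum_insert[symmetric]\<close>)
  finally show ?case .
qed simp

end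

text \<open>Over mere monoids, preservation of zero does not follow from additivity and has to be
  assumed; it settles the empty and the infinite index sets.\<close>

lemma finsum_additive:
  assumes M: "abelian_monoid M" and N: "abelian_monoid N"
    and cl: "\<And>x. x \<in> carrier M \<Longrightarrow> e x \<in> carrier N"
    and add: "\<And>x y. x \<in> carrier M \<Longrightarrow> y \<in> carrier M \<Longrightarrow> e (x \<oplus>\<^bsub>M\<^esub> y) = e x \<oplus>\<^bsub>N\<^esub> e y"
    and zero: "e \<zero>\<^bsub>M\<^esub> = \<zero>\<^bsub>N\<^esub>"
    and F: "F \<in> I \<rightarrow> carrier M"
  shows "e (finsum M F I) = finsum N (\<lambda>i. e (F i)) I"
proof -
  interpret M: abelian_monoid M by (rule M)
  interpret N: abelian_monoid N by (rule N)
  show ?thesis using F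
  proof (induction I rule: infinite_finite_induct)
    case (insert i I)
    have "e (finsum M F (insert i I)) = e (F i \<oplus>\<^bsub>M\<^esub> finsum M F I)"
      by (subst M.finsum_insert) (use insert in auto)
    also have "\<dots> = e (F i) \<oplus>\<^bsub>N\<^esub> finsum N (\<lambda>i. e (F i)) I"
      by (subst add) (use insert in auto)
    also have "\<dots> = finsum N (\<lambda>i. e (F i)) (insert i I)"
      by (subst N.finsum_insert) (use insert cl in auto)
    finally show ?case .
  qed (simp_all add: zero)
qed

text \<open>Nothing is asked outside the free modules. Preservation of zero is not listed, since
  homogeneity for the scalar zero implies it (\<open>lin_zero\<close>).\<close>

definition lin :: "('k, 'r) ring_scheme \<Rightarrow> 'x set \<Rightarrow> 'y set \<Rightarrow> (('x \<Rightarrow> 'k) \<Rightarrow> 'y \<Rightarrow> 'k) \<Rightarrow> bool" where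
  "lin R X Y T \<longleftrightarrow>
     (\<forall>v\<in>free_carrier R X. T v \<in> free_carrier R Y) \<and>
     (\<forall>v\<in>free_carrier R X. \<forall>w\<in>free_carrier R X. T (\<lambda>x. v x \<oplus>\<^bsub>R\<^esub> w x) = (\<lambda>y. T v y \<oplus>\<^bsub>R\<^esub> T w y)) \<and>
     (\<forall>a\<in>carrier R. \<forall>v\<in>free_carrier R X. T (scale R a v) = scale R a (T v))"

lemma linD:
  assumes "lin R X Y T"
  shows lin_closed: "v \<in> free_carrier R X \<Longrightarrow> T v \<in> free_carrier R Y"
    and lin_add: "v \<in> free_carrier R X \<Longrightarrow> w \<in> free_carrier R X \<Longrightarrow> T (\<lambda>x. v x \<oplus>\<^bsub>R\<^esub> w x) = (\<lambda>y. T v y \<oplus>\<^bsub>R\<^esub> T w y)"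
    and lin_scale: "a \<in> carrier R \<Longrightarrow> v \<in> free_carrier R X \<Longrightarrow> T (scale R a v) = scale R a (T v)"
  using assms unfolding lin_def by blast+

lemma lin_comp: "lin R X Y S \<Longrightarrow> lin R Y Z T \<Longrightarrow> lin R X Z (\<lambda>v. T (S v))"
  unfolding lin_def by simp

section \<open>Free modules and linear maps between them\<close>

lemma free_algebra_simps:
  "carrier (free_algebra R X m e) = free_carrier R X"
  "monoid.mult (free_algebra R X m e) = bilinear_ext R X X m"
  "one (free_algebra R X m e) = e"
  "zero (free_algebra R X m e) = (\<lambda>x. \<zero>\<^bsub>R\<^esub>)"
  "add (free_algebra R X m e) = (\<lambda>v w x. v x \<oplus>\<^bsub>R\<^esub> w x)"
  "module.smult (free_algebra R X m e) = scale R"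
  by (simp_all add: free_algebra_def)

context cring
begin

lemma free_carrierD: "v \<in> free_carrier R X \<Longrightarrow> v x \<in> carrier R"
  unfolding free_carrier_def by (cases "x \<in> X") auto

lemma free_carrier_off: "v \<in> free_carrier R X \<Longrightarrow> x \<notin> X \<Longrightarrow> v x = \<zero>"
  unfolding free_carrier_def by auto

lemma free_carrierI: "(\<And>x. x \<in> X \<Longrightarrow> v x \<in> carrier R) \<Longrightarrow> (\<And>x. x \<notin> X \<Longrightarrow> v x = \<zero>) \<Longrightarrow> v \<in> free_carrier R X"
  unfolding free_carrier_def by auto

lemma free_zero: "(\<lambda>x. \<zero>) \<in> free_carrier R X"
  by (rule free_carrierI) auto

lemma free_add: "v \<in> free_carrier R X \<Longrightarrow> w \<in> free_carrier R X \<Longrightarrow> (\<lambda>x. v x \<oplus> w x) \<in> free_carrier R X"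
  by (rule free_carrierI) (auto simp: free_carrierD free_carrier_off)

lemma free_scale: "a \<in> carrier R \<Longrightarrow> v \<in> free_carrier R X \<Longrightarrow> scale R a v \<in> free_carrier R X"
  by (rule free_carrierI) (auto simp: free_carrierD free_carrier_off scale_def)

lemma free_basis: "x \<in> X \<Longrightarrow> basis R x \<in> free_carrier R X"
  by (rule free_carrierI) (auto simp: basis_def)

lemma basis_carrier: "basis R x y \<in> carrier R"
  by (simp add: basis_def)

lemma scale_scale: "a \<in> carrier R \<Longrightarrow> b \<in> carrier R \<Longrightarrow> v \<in> free_carrier R X \<Longrightarrow> scale R a (scale R b v) = scale R (a \<otimes> b) v"
  by (rule ext) (simp add: scale_def m_assoc free_carrierD)

lemma scale_one: "v \<in> free_carrier R X \<Longrightarrow> scale R \<one> v = v"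
  by (rule ext) (simp add: scale_def free_carrierD)

lemma scale_zero: "a \<in> carrier R \<Longrightarrow> scale R a (\<lambda>x. \<zero>) = (\<lambda>x. \<zero>)"
  by (rule ext) (simp add: scale_def)

lemma free_algebra_group: "abelian_group (free_algebra R X m e)"
proof (rule abelian_groupI; unfold free_algebra_simps)
  show "\<And>x. x \<in> free_carrier R X \<Longrightarrow> \<exists>y\<in>free_carrier R X. (\<lambda>z. y z \<oplus> x z) = (\<lambda>z. \<zero>)"
  proof
    fix x assume x: "x \<in> free_carrier R X"
    show "(\<lambda>z. \<ominus> x z \<oplus> x z) = (\<lambda>z. \<zero>)" by (rule ext) (simp add: l_neg free_carrierD[OF x])
    show "(\<lambda>z. \<ominus> x z) \<in> free_carrier R X"
      by (rule free_carrierI) (simp_all add: free_carrierD[OF x] free_carrier_off[OF x])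
  qed
qed (auto simp: free_add free_zero a_assoc free_carrierD intro!: ext a_comm)

lemma free_algebra_monoid: "abelian_monoid (free_algebra R X m e)"
  by (rule abelian_group.axioms(1)[OF free_algebra_group])

lemma free_algebra_module: "module R (free_algebra R X m e)"
proof (rule moduleI[OF is_cring free_algebra_group]; unfold free_algebra_simps)
  show "scale R a v \<in> free_carrier R X" if "a \<in> carrier R" "v \<in> free_carrier R X" for a v
    by (rule free_scale[OF that])
qed (auto simp: scale_def l_distr r_distr m_assoc free_carrierD intro!: ext)

lemma finsum_free_closed:
  "F \<in> I \<rightarrow> free_carrier R X \<Longrightarrow> finsum (free_algebra R X m e) F I \<in> free_carrier R X"
  using abelian_monoid.finsum_closed[OF free_algebra_monoid, of F I X m e] by (simp add: free_algebra_simps)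

text \<open>Evaluation at \<open>z\<close> is additive. The product \<open>m\<close> and the unit
  \<open>e\<close> do not enter a sum, so they can be chosen at will; dummies are used wherever only
  the additive structure matters.\<close>

lemma finsum_free:
  "F \<in> I \<rightarrow> free_carrier R X \<Longrightarrow> finsum (free_algebra R X m e) F I z = (\<Oplus>i\<in>I. F i z)"
  by (rule finsum_additive[OF free_algebra_monoid, where e = "\<lambda>v. v z"])
    (auto simp: free_algebra_simps free_carrierD abelian_monoid_axioms)

lemma lin_zero: "lin R X Y T \<Longrightarrow> T (\<lambda>x. \<zero>) = (\<lambda>y. \<zero>)"
proof -
  assume T: "lin R X Y T"
  have eq: "scale R \<zero> v = (\<lambda>x. \<zero>)" if "v \<in> free_carrier R Z" for v Z
    by (rule ext) (simp add: scale_def free_carrierD[OF that])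
  have "T (scale R \<zero> (\<lambda>x. \<zero>)) = scale R \<zero> (T (\<lambda>x. \<zero>))"
    by (rule lin_scale[OF T zero_closed free_zero])
  also have "\<dots> = (\<lambda>y. \<zero>)" by (rule eq[OF lin_closed[OF T free_zero]])
  finally show ?thesis by (simp only: eq[OF free_zero])
qed

lemma lin_finsum:
  assumes T: "lin R X Y T" and F: "F \<in> I \<rightarrow> free_carrier R X"
  shows "T (finsum (free_algebra R X m e) F I) = finsum (free_algebra R Y m' e') (\<lambda>i. T (F i)) I"
  by (rule finsum_additive[OF free_algebra_monoid free_algebra_monoid])
    (use F in \<open>auto simp: free_algebra_simps lin_closed[OF T] lin_add[OF T] lin_zero[OF T]\<close>)

lemma free_expand:
  assumes X: "finite X" and v: "v \<in> free_carrier R X"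
  shows "v = finsum (free_algebra R X m e) (\<lambda>x. scale R (v x) (basis R x)) X"
proof
  fix z
  have cl: "(\<lambda>x. scale R (v x) (basis R x)) \<in> X \<rightarrow> free_carrier R X"
    by (auto intro!: free_scale free_basis free_carrierD[OF v])
  have "(\<Oplus>x\<in>X. scale R (v x) (basis R x) z) = v z"
  proof (cases "z \<in> X")
    case True
    have "(\<Oplus>x\<in>X. scale R (v x) (basis R x) z) = scale R (v z) (basis R z) z"
      by (rule finsum_eq_single[OF X True]) (auto simp: scale_def basis_def free_carrierD[OF v])
    then show ?thesis by (simp add: scale_def basis_def free_carrierD[OF v])
  next
    case False
    then have "(\<Oplus>x\<in>X. scale R (v x) (basis R x) z) = (\<Oplus>x\<in>X. \<zero>)"
      by (intro finsum_cong') (auto simp: scale_def basis_def free_carrierD[OF v])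
    then show ?thesis using free_carrier_off[OF v False] by simp
  qed
  then show "v z = finsum (free_algebra R X m e) (\<lambda>x. scale R (v x) (basis R x)) X z"
    by (simp add: finsum_free[OF cl])
qed

lemma lin_expand:
  assumes T: "lin R X Y T" and X: "finite X" and v: "v \<in> free_carrier R X"
  shows "T v z = (\<Oplus>x\<in>X. v x \<otimes> T (basis R x) z)"
proof -
  \<comment> \<open>A carrier for sums only; product and unit are placeholders.\<close>
  let ?M = "\<lambda>Z. free_algebra R Z (\<lambda>x y. undefined) undefined"
  have cl: "(\<lambda>x. scale R (v x) (basis R x)) \<in> X \<rightarrow> free_carrier R X"
    by (auto intro!: free_scale free_basis free_carrierD[OF v])
  have "T v = T (finsum (?M X) (\<lambda>x. scale R (v x) (basis R x)) X)" using free_expand[OF X v] by simp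
  also have "\<dots> = finsum (?M Y) (\<lambda>x. T (scale R (v x) (basis R x))) X" by (rule lin_finsum[OF T cl])
  finally have "T v z = (\<Oplus>x\<in>X. T (scale R (v x) (basis R x)) z)"
    using cl by (simp add: finsum_free lin_closed[OF T] Pi_iff)
  also have "\<dots> = (\<Oplus>x\<in>X. v x \<otimes> T (basis R x) z)"
  proof (rule finsum_cong'[OF refl])
    fix x assume x: "x \<in> X"
    show "T (scale R (v x) (basis R x)) z = v x \<otimes> T (basis R x) z"
      unfolding lin_scale[OF T free_carrierD[OF v] free_basis[OF x]] by (simp add: scale_def)
  qed (auto simp: free_carrierD[OF v] free_carrierD[OF lin_closed[OF T free_basis]])
  finally show ?thesis .
qed

lemma lin_ext:
  assumes "lin R X Y S" "lin R X Y T" "finite X" "\<And>x. x \<in> X \<Longrightarrow> S (basis R x) = T (basis R x)" "v \<in> free_carrier R X"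
  shows "S v = T v"
proof
  fix z
  have "(\<Oplus>x\<in>X. v x \<otimes> S (basis R x) z) = (\<Oplus>x\<in>X. v x \<otimes> T (basis R x) z)"
    by (rule finsum_cong')
      (use assms in \<open>auto simp: free_carrierD[OF assms(5)] free_carrierD[OF lin_closed[OF assms(2) free_basis]]\<close>)
  then show "S v z = T v z" using lin_expand[OF assms(1,3,5)] lin_expand[OF assms(2,3,5)] by simp
qed

section \<open>Bilinear extensions and algebras with a finite basis\<close>

lemma bilinear_closed:
  assumes m: "\<And>x y. x \<in> X \<Longrightarrow> y \<in> Y \<Longrightarrow> m x y \<in> free_carrier R Z"
    and v: "v \<in> free_carrier R X" and w: "w \<in> free_carrier R Y"
  shows "bilinear_ext R X Y m v w \<in> free_carrier R Z"
proof (rule free_carrierI)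
  show "bilinear_ext R X Y m v w z \<in> carrier R" for z
    unfolding bilinear_ext_def
    by (intro finsum_closed Pi_I m_closed free_carrierD[OF v] free_carrierD[OF w] free_carrierD[OF m])
  show "bilinear_ext R X Y m v w z = \<zero>" if "z \<notin> Z" for z
  proof -
    have "(\<Oplus>y\<in>Y. v x \<otimes> w y \<otimes> m x y z) = \<zero>" if x: "x \<in> X" for x
    proof -
      have "(\<Oplus>y\<in>Y. v x \<otimes> w y \<otimes> m x y z) = (\<Oplus>y\<in>Y. \<zero>)"
        by (rule finsum_cong') (auto simp: free_carrier_off[OF m[OF x] \<open>z \<notin> Z\<close>] free_carrierD[OF v] free_carrierD[OF w])
      then show ?thesis by simp
    qed
    then have "(\<Oplus>x\<in>X. \<Oplus>y\<in>Y. v x \<otimes> w y \<otimes> m x y z) = (\<Oplus>x\<in>X. \<zero>)"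
      by (intro finsum_cong') auto
    then show ?thesis unfolding bilinear_ext_def by simp
  qed
qed

text \<open>Exchanging the two sums reduces linearity in the right argument to linearity in the left
  one.\<close>

lemma bilinear_swap:
  assumes XY: "finite X" "finite Y" and m: "\<And>x y. x \<in> X \<Longrightarrow> y \<in> Y \<Longrightarrow> m x y \<in> free_carrier R Z"
    and v: "v \<in> free_carrier R X" and w: "w \<in> free_carrier R Y"
  shows "bilinear_ext R X Y m v w = bilinear_ext R Y X (\<lambda>y x. m x y) w v"
proof
  fix z
  have "(\<Oplus>x\<in>X. \<Oplus>y\<in>Y. v x \<otimes> w y \<otimes> m x y z) = (\<Oplus>y\<in>Y. \<Oplus>x\<in>X. v x \<otimes> w y \<otimes> m x y z)"
    by (intro finsum_exchange XY m_closed free_carrierD[OF v] free_carrierD[OF w] free_carrierD[OF m])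
  also have "\<dots> = (\<Oplus>y\<in>Y. \<Oplus>x\<in>X. w y \<otimes> v x \<otimes> m x y z)"
    by (simp add: m_comm[OF free_carrierD[OF v] free_carrierD[OF w]])
  finally show "bilinear_ext R X Y m v w z = bilinear_ext R Y X (\<lambda>y x. m x y) w v z"
    unfolding bilinear_ext_def .
qed

lemma lin_bilinear_left:
  assumes m: "\<And>x y. x \<in> X \<Longrightarrow> y \<in> Y \<Longrightarrow> m x y \<in> free_carrier R Z" and w: "w \<in> free_carrier R Y"
  shows "lin R X Z (\<lambda>v. bilinear_ext R X Y m v w)"
  unfolding lin_def
proof (intro conjI ballI)
  note cl = free_carrierD[OF w] free_carrierD[OF m]
  show "bilinear_ext R X Y m v w \<in> free_carrier R Z" if "v \<in> free_carrier R X" for v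
    by (rule bilinear_closed[OF m that w])
  show "bilinear_ext R X Y m (\<lambda>x. v x \<oplus> v' x) w = (\<lambda>z. bilinear_ext R X Y m v w z \<oplus> bilinear_ext R X Y m v' w z)"
    if v: "v \<in> free_carrier R X" and v': "v' \<in> free_carrier R X" for v v'
  proof
    fix z
    have "(\<Oplus>x\<in>X. \<Oplus>y\<in>Y. (v x \<oplus> v' x) \<otimes> w y \<otimes> m x y z) =
        (\<Oplus>x\<in>X. (\<Oplus>y\<in>Y. v x \<otimes> w y \<otimes> m x y z) \<oplus> (\<Oplus>y\<in>Y. v' x \<otimes> w y \<otimes> m x y z))"
    proof (rule finsum_cong'[OF refl])
      fix x assume x: "x \<in> X"
      have "(\<Oplus>y\<in>Y. (v x \<oplus> v' x) \<otimes> w y \<otimes> m x y z) = (\<Oplus>y\<in>Y. v x \<otimes> w y \<otimes> m x y z \<oplus> v' x \<otimes> w y \<otimes> m x y z)"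
        by (rule finsum_cong') (auto simp: l_distr free_carrierD[OF v] free_carrierD[OF v'] cl x)
      also have "\<dots> = (\<Oplus>y\<in>Y. v x \<otimes> w y \<otimes> m x y z) \<oplus> (\<Oplus>y\<in>Y. v' x \<otimes> w y \<otimes> m x y z)"
        by (rule finsum_addf) (auto simp: free_carrierD[OF v] free_carrierD[OF v'] cl x)
      finally show "(\<Oplus>y\<in>Y. (v x \<oplus> v' x) \<otimes> w y \<otimes> m x y z) =
        (\<Oplus>y\<in>Y. v x \<otimes> w y \<otimes> m x y z) \<oplus> (\<Oplus>y\<in>Y. v' x \<otimes> w y \<otimes> m x y z)" .
    qed (auto intro!: finsum_closed simp: free_carrierD[OF v] free_carrierD[OF v'] cl)
    also have "\<dots> = (\<Oplus>x\<in>X. \<Oplus>y\<in>Y. v x \<otimes> w y \<otimes> m x y z) \<oplus> (\<Oplus>x\<in>X. \<Oplus>y\<in>Y. v' x \<otimes> w y \<otimes> m x y z)"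
      by (rule finsum_addf) (auto intro!: finsum_closed simp: free_carrierD[OF v] free_carrierD[OF v'] cl)
    finally show "bilinear_ext R X Y m (\<lambda>x. v x \<oplus> v' x) w z = bilinear_ext R X Y m v w z \<oplus> bilinear_ext R X Y m v' w z"
      unfolding bilinear_ext_def .
  qed
  show "bilinear_ext R X Y m (scale R a v) w = scale R a (bilinear_ext R X Y m v w)"
    if a: "a \<in> carrier R" and v: "v \<in> free_carrier R X" for a v
  proof
    fix z
    have "(\<Oplus>x\<in>X. \<Oplus>y\<in>Y. a \<otimes> v x \<otimes> w y \<otimes> m x y z) = (\<Oplus>x\<in>X. a \<otimes> (\<Oplus>y\<in>Y. v x \<otimes> w y \<otimes> m x y z))"
    proof (rule finsum_cong'[OF refl])
      fix x assume x: "x \<in> X"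
      have "(\<Oplus>y\<in>Y. a \<otimes> v x \<otimes> w y \<otimes> m x y z) = (\<Oplus>y\<in>Y. a \<otimes> (v x \<otimes> w y \<otimes> m x y z))"
        by (rule finsum_cong') (auto simp: m_assoc free_carrierD[OF v] cl x a)
      also have "\<dots> = a \<otimes> (\<Oplus>y\<in>Y. v x \<otimes> w y \<otimes> m x y z)"
        by (cases "finite Y") (auto intro!: finsum_rdistr[symmetric] simp: free_carrierD[OF v] cl x a)
      finally show "(\<Oplus>y\<in>Y. a \<otimes> v x \<otimes> w y \<otimes> m x y z) = a \<otimes> (\<Oplus>y\<in>Y. v x \<otimes> w y \<otimes> m x y z)" .
    qed (auto intro!: finsum_closed simp: free_carrierD[OF v] cl a)
    also have "\<dots> = a \<otimes> (\<Oplus>x\<in>X. \<Oplus>y\<in>Y. v x \<otimes> w y \<otimes> m x y z)"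
      by (cases "finite X") (auto intro!: finsum_rdistr[symmetric] finsum_closed simp: free_carrierD[OF v] cl a)
    finally show "bilinear_ext R X Y m (scale R a v) w z = scale R a (bilinear_ext R X Y m v w) z"
      unfolding bilinear_ext_def scale_def .
  qed
qed

lemma lin_bilinear_right:
  assumes XY: "finite X" "finite Y" and m: "\<And>x y. x \<in> X \<Longrightarrow> y \<in> Y \<Longrightarrow> m x y \<in> free_carrier R Z" and v: "v \<in> free_carrier R X"
  shows "lin R Y Z (\<lambda>w. bilinear_ext R X Y m v w)"
proof -
  have "lin R Y Z (\<lambda>w. bilinear_ext R Y X (\<lambda>y x. m x y) w v)"
    by (rule lin_bilinear_left[OF m v])
  moreover have "bilinear_ext R X Y m v w = bilinear_ext R Y X (\<lambda>y x. m x y) w v" if "w \<in> free_carrier R Y" for w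
    by (rule bilinear_swap[OF XY m v that])
  ultimately show ?thesis unfolding lin_def by (simp add: free_add free_scale)
qed

lemma bilinear_basis:
  assumes XY: "finite X" "finite Y" and m': "\<And>x y. x \<in> X \<Longrightarrow> y \<in> Y \<Longrightarrow> m x y \<in> free_carrier R Z"
    and x: "x \<in> X" and y: "y \<in> Y"
  shows "bilinear_ext R X Y m (basis R x) (basis R y) = m x y"
proof
  fix z
  have inner: "(\<Oplus>y'\<in>Y. basis R x x' \<otimes> basis R y y' \<otimes> m x' y' z) = basis R x x' \<otimes> m x' y z" if "x' \<in> X" for x'
  proof -
    have "(\<Oplus>y'\<in>Y. basis R x x' \<otimes> basis R y y' \<otimes> m x' y' z) = basis R x x' \<otimes> basis R y y \<otimes> m x' y z"
      by (rule finsum_eq_single[OF XY(2) y]) (auto simp: basis_def free_carrierD[OF m'] that y)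
    then show ?thesis by (simp add: basis_def free_carrierD[OF m'] that y)
  qed
  have "(\<Oplus>x'\<in>X. \<Oplus>y'\<in>Y. basis R x x' \<otimes> basis R y y' \<otimes> m x' y' z) = (\<Oplus>x'\<in>X. basis R x x' \<otimes> m x' y z)"
    by (rule finsum_cong') (auto simp: inner basis_carrier free_carrierD[OF m'] y)
  also have "\<dots> = basis R x x \<otimes> m x y z"
    by (rule finsum_eq_single[OF XY(1) x]) (auto simp: basis_def free_carrierD[OF m'] x y)
  also have "\<dots> = m x y z" by (simp add: basis_def free_carrierD[OF m'] x y)
  finally show "bilinear_ext R X Y m (basis R x) (basis R y) z = m x y z" unfolding bilinear_ext_def .
qed

text \<open>By multilinearity the variables can be replaced by basis elements one after another,
  each time through \<open>lin_ext\<close>; so the laws are required on basis elements only.\<close>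

lemma assoc_algebra_free:
  fixes m :: "'x \<Rightarrow> 'x \<Rightarrow> 'x \<Rightarrow> 'a"
  assumes X: "finite X" and m: "\<And>x y. x \<in> X \<Longrightarrow> y \<in> X \<Longrightarrow> m x y \<in> free_carrier R X"
    and e: "e \<in> free_carrier R X"
    and one: "\<And>x. x \<in> X \<Longrightarrow> bilinear_ext R X X m e (basis R x) = basis R x"
      "\<And>x. x \<in> X \<Longrightarrow> bilinear_ext R X X m (basis R x) e = basis R x"
    and assoc: "\<And>x y z. x \<in> X \<Longrightarrow> y \<in> X \<Longrightarrow> z \<in> X \<Longrightarrow>
      bilinear_ext R X X m (m x y) (basis R z) = bilinear_ext R X X m (basis R x) (m y z)"
  shows "assoc_algebra R (free_algebra R X m e)"
proof -
  let ?B = "bilinear_ext R X X m"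
  have L: "lin R X X (\<lambda>v. ?B v w)" if "w \<in> free_carrier R X" for w
    by (rule lin_bilinear_left[OF m that])
  have Rt: "lin R X X (?B v)" if "v \<in> free_carrier R X" for v
    by (rule lin_bilinear_right[OF X X m that])
  have id: "lin R X X (\<lambda>v. v)" unfolding lin_def by simp
  have cl: "?B v w \<in> free_carrier R X" if "v \<in> free_carrier R X" "w \<in> free_carrier R X" for v w
    by (rule bilinear_closed[OF m that])
  have l1: "?B e v = v" if "v \<in> free_carrier R X" for v
    by (rule lin_ext[OF Rt[OF e] id X one(1) that])
  have r1: "?B v e = v" if "v \<in> free_carrier R X" for v
    by (rule lin_ext[OF L[OF e] id X one(2) that])
  have a: "?B (?B u v) w = ?B u (?B v w)"
    if u: "u \<in> free_carrier R X" and v: "v \<in> free_carrier R X" and w: "w \<in> free_carrier R X" for u v w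
  proof (rule lin_ext[OF lin_comp[OF L[OF v] L[OF w]] L[OF cl[OF v w]] X _ u])
    fix x assume x: "x \<in> X"
    note bx = free_basis[OF x]
    show "?B (?B (basis R x) v) w = ?B (basis R x) (?B v w)"
    proof (rule lin_ext[OF lin_comp[OF Rt[OF bx] L[OF w]] lin_comp[OF L[OF w] Rt[OF bx]] X _ v])
      fix y assume y: "y \<in> X"
      note b_y = free_basis[OF y]
      show "?B (?B (basis R x) (basis R y)) w = ?B (basis R x) (?B (basis R y) w)"
      proof (rule lin_ext[OF Rt[OF cl[OF bx b_y]] lin_comp[OF Rt[OF b_y] Rt[OF bx]] X _ w])
        fix z assume z: "z \<in> X"
        show "?B (?B (basis R x) (basis R y)) (basis R z) = ?B (basis R x) (?B (basis R y) (basis R z))"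
          using assoc[OF x y z] bilinear_basis[where m = m, OF X X m x y] bilinear_basis[where m = m, OF X X m y z] by simp
      qed
    qed
  qed
  have "Group.monoid (free_algebra R X m e)"
    by (rule monoidI; unfold free_algebra_simps) (simp_all add: cl e a l1 r1)
  then have "ring (free_algebra R X m e)"
    by (rule ringI[OF free_algebra_group]; unfold free_algebra_simps)
      (simp_all add: lin_add[OF L] lin_add[OF Rt])
  then show ?thesis
    unfolding assoc_algebra_def free_algebra_simps
    by (simp add: free_algebra_module lin_scale[OF L] lin_scale[OF Rt])
qed

end

text \<open>\<open>B\<close> need not be known to be an algebra beforehand.\<close>

lemma assoc_algebra_transport:
  assumes A: "assoc_algebra R A" and bij: "bij_betw h (carrier A) (carrier B)"
    and mult: "\<And>x y. x \<in> carrier A \<Longrightarrow> y \<in> carrier A \<Longrightarrow> h (x \<otimes>\<^bsub>A\<^esub> y) = h x \<otimes>\<^bsub>B\<^esub> h y"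
    and add: "\<And>x y. x \<in> carrier A \<Longrightarrow> y \<in> carrier A \<Longrightarrow> h (x \<oplus>\<^bsub>A\<^esub> y) = h x \<oplus>\<^bsub>B\<^esub> h y"
    and one: "h \<one>\<^bsub>A\<^esub> = \<one>\<^bsub>B\<^esub>" and zero: "h \<zero>\<^bsub>A\<^esub> = \<zero>\<^bsub>B\<^esub>"
    and smult: "\<And>a x. a \<in> carrier R \<Longrightarrow> x \<in> carrier A \<Longrightarrow> h (a \<odot>\<^bsub>A\<^esub> x) = a \<odot>\<^bsub>B\<^esub> h x"
  shows "h \<in> algebra_iso R A B"
proof -
  interpret A: ring A using A by (simp add: assoc_algebra_def)
  interpret M: module R A using A by (simp add: assoc_algebra_def)
  have B: "carrier B = h ` carrier A" using bij by (simp add: bij_betw_def)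
  have mA: "(a \<odot>\<^bsub>A\<^esub> x) \<otimes>\<^bsub>A\<^esub> y = a \<odot>\<^bsub>A\<^esub> (x \<otimes>\<^bsub>A\<^esub> y)" "x \<otimes>\<^bsub>A\<^esub> (a \<odot>\<^bsub>A\<^esub> y) = a \<odot>\<^bsub>A\<^esub> (x \<otimes>\<^bsub>A\<^esub> y)"
    if "a \<in> carrier R" "x \<in> carrier A" "y \<in> carrier A" for a x y
    using A that by (simp_all add: assoc_algebra_def)
  have gB: "abelian_group B"
  proof (rule abelian_groupI; unfold B; (elim imageE)?)
    fix x x' assume x: "x = h x'" "x' \<in> carrier A"
    have "h (\<ominus>\<^bsub>A\<^esub> x') \<oplus>\<^bsub>B\<^esub> x = \<zero>\<^bsub>B\<^esub>" using x by (simp flip: add zero add: A.l_neg)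
    then show "\<exists>y\<in>h ` carrier A. y \<oplus>\<^bsub>B\<^esub> x = \<zero>\<^bsub>B\<^esub>" using x by auto
  next
    show "\<zero>\<^bsub>B\<^esub> \<in> h ` carrier A" by (metis A.zero_closed image_eqI zero)
  qed (auto simp: A.a_assoc A.a_comm A.a_lcomm simp flip: add zero)
  have "Group.monoid B"
  proof (rule monoidI; unfold B; (elim imageE)?)
    show "\<one>\<^bsub>B\<^esub> \<in> h ` carrier A" by (metis A.one_closed image_eqI one)
  qed (auto simp: A.m_assoc simp flip: mult one)
  then have "ring B"
    by (rule ringI[OF gB]; unfold B; elim imageE) (auto simp: A.l_distr A.r_distr simp flip: mult add)
  moreover have "module R B"
    by (rule moduleI[OF M.R.is_cring gB]; unfold B; (elim imageE)?)
      (auto simp: M.smult_l_distr M.smult_r_distr M.smult_assoc1 simp flip: smult add)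
  ultimately have *: "assoc_algebra R B"
    unfolding assoc_algebra_def B by (auto simp: mA simp flip: smult mult)
  have "h \<in> Ring.ring_hom A B" by (rule ring_hom_memI) (auto simp: B mult add one)
  then show ?thesis
    using A * bij smult by (simp add: algebra_iso_def ring_iso_def)
qed

lemma algebra_iso_comp:
  assumes "f \<in> algebra_iso R A B" "g \<in> algebra_iso R B C"
  shows "g \<circ> f \<in> algebra_iso R A C"
proof -
  have f: "f \<in> ring_iso A B" and g: "g \<in> ring_iso B C" using assms by (simp_all add: algebra_iso_def)
  have "f \<in> carrier A \<rightarrow> carrier B" using f by (auto simp: ring_iso_def dest: bij_betwE)
  then have "\<forall>a\<in>carrier R. \<forall>x\<in>carrier A. (g \<circ> f) (a \<odot>\<^bsub>A\<^esub> x) = a \<odot>\<^bsub>C\<^esub> (g \<circ> f) x"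
    using assms by (auto simp: algebra_iso_def Pi_iff)
  then show ?thesis using ring_iso_set_trans[OF f g] assms by (simp add: algebra_iso_def)
qed

section \<open>Evaluation of integer polynomials and block triangular maps\<close>

lemma Zx_ring_simps:
  "carrier Zx_ring = UNIV" "monoid.mult Zx_ring = (*)" "one Zx_ring = 1" "zero Zx_ring = 0" "add Zx_ring = (+)"
  by (simp_all add: Zx_ring_def)

lemma cring_Zx: "cring Zx_ring"
proof (rule cringI)
  show "abelian_group Zx_ring"
    by (rule abelian_groupI; unfold Zx_ring_simps) (auto intro: exI[of _ "- _"] add.left_inverse)
  show "comm_monoid Zx_ring"
    by (rule comm_monoidI; unfold Zx_ring_simps) auto
qed (auto simp: Zx_ring_simps distrib_right)

context cring
begin

text \<open>Cancellation may lower the degree of a sum of polynomials, so sums are compared up to a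
  common bound.\<close>

lemma eval_int_poly_bound:
  assumes d: "d \<in> carrier R" and n: "degree f \<le> n"
  shows "eval_int_poly R d f = (\<Oplus>i\<in>{..n}. [coeff f i] \<cdot> (d [^] i))"
  unfolding eval_int_poly_def
proof (rule add.finprod_mono_neutral_cong_left)
  show "[coeff f i] \<cdot> (d [^] i) = \<zero>" if "i \<in> {..n} - {..degree f}" for i
  proof -
    have "coeff f i = 0" using that by (simp add: coeff_eq_0)
    then show ?thesis by (simp add: add_pow_int_ge)
  qed
qed (use d n in auto)

lemma eval_int_poly_closed: "d \<in> carrier R \<Longrightarrow> eval_int_poly R d f \<in> carrier R"
  unfolding eval_int_poly_def by (auto intro!: finsum_closed)

lemma eval_int_poly_add:
  assumes d: "d \<in> carrier R"
  shows "eval_int_poly R d (f + g) = eval_int_poly R d f \<oplus> eval_int_poly R d g"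
proof -
  define n where "n = max (degree f) (degree g)"
  have n: "degree f \<le> n" "degree g \<le> n" "degree (f + g) \<le> n" by (simp_all add: n_def degree_add_le_max)
  have "(\<Oplus>i\<in>{..n}. [coeff (f + g) i] \<cdot> (d [^] i)) = (\<Oplus>i\<in>{..n}. [coeff f i] \<cdot> (d [^] i) \<oplus> [coeff g i] \<cdot> (d [^] i))"
    by (rule finsum_cong') (use d in \<open>auto simp: add.int_pow_mult\<close>)
  also have "\<dots> = (\<Oplus>i\<in>{..n}. [coeff f i] \<cdot> (d [^] i)) \<oplus> (\<Oplus>i\<in>{..n}. [coeff g i] \<cdot> (d [^] i))"
    by (rule finsum_addf) (use d in auto)
  finally show ?thesis using eval_int_poly_bound[OF d] n by simp
qed

lemma eval_int_poly_0: "eval_int_poly R d 0 = \<zero>"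
  unfolding eval_int_poly_def by (simp add: add_pow_int_ge)

text \<open>Horner's rule, which carries the inductions for scalars and products.\<close>

lemma eval_int_poly_pCons:
  assumes d: "d \<in> carrier R"
  shows "eval_int_poly R d (pCons a f) = [a] \<cdot> \<one> \<oplus> d \<otimes> eval_int_poly R d f"
proof -
  let ?n = "degree f"
  have "eval_int_poly R d (pCons a f) = (\<Oplus>i\<in>{..Suc ?n}. [coeff (pCons a f) i] \<cdot> (d [^] i))"
    by (rule eval_int_poly_bound[OF d]) (rule degree_pCons_le)
  also have "\<dots> = (\<Oplus>i\<in>{..?n}. [coeff f i] \<cdot> (d [^] Suc i)) \<oplus> [a] \<cdot> \<one>"
    by (subst finsum_Suc2) (use d in auto)
  also have "(\<Oplus>i\<in>{..?n}. [coeff f i] \<cdot> (d [^] Suc i)) = (\<Oplus>i\<in>{..?n}. d \<otimes> ([coeff f i] \<cdot> (d [^] i)))"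
    by (rule finsum_cong') (use d in \<open>auto simp: add_pow_rdistr_int m_comm\<close>)
  also have "\<dots> = d \<otimes> eval_int_poly R d f"
    unfolding eval_int_poly_def by (rule finsum_rdistr[symmetric]) (use d in auto)
  finally show ?thesis using d by (simp add: a_comm eval_int_poly_closed)
qed

lemma eval_int_poly_smult:
  assumes d: "d \<in> carrier R"
  shows "eval_int_poly R d (Polynomial.smult a f) = ([a] \<cdot> \<one>) \<otimes> eval_int_poly R d f"
proof (induction f)
  case 0 show ?case by (simp add: eval_int_poly_0)
next
  case (pCons b f)
  have "[(a * b)] \<cdot> \<one> = ([a] \<cdot> \<one>) \<otimes> ([b] \<cdot> \<one>)"
    by (simp add: add_pow_ldistr_int add.int_pow_pow mult.commute)
  then show ?case
    using d pCons.IH by (simp add: eval_int_poly_pCons eval_int_poly_closed r_distr m_lcomm)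
qed

lemma eval_int_poly_mult:
  assumes d: "d \<in> carrier R"
  shows "eval_int_poly R d (f * g) = eval_int_poly R d f \<otimes> eval_int_poly R d g"
proof (induction f)
  case 0 show ?case using d by (simp add: eval_int_poly_0 eval_int_poly_closed)
next
  case (pCons b f)
  have "eval_int_poly R d (pCons b f * g) = ([b] \<cdot> \<one>) \<otimes> eval_int_poly R d g \<oplus> ([(0::int)] \<cdot> \<one> \<oplus> d \<otimes> (eval_int_poly R d f \<otimes> eval_int_poly R d g))"
    by (simp add: mult_pCons_left eval_int_poly_add[OF d] eval_int_poly_smult[OF d] eval_int_poly_pCons[OF d] pCons.IH)
  also have "[(0::int)] \<cdot> \<one> = \<zero>" by (simp add: add_pow_int_ge)
  finally show ?case
    using d by (simp add: eval_int_poly_pCons eval_int_poly_closed l_distr m_assoc)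
qed

lemma eval_int_poly_1:
  assumes "d \<in> carrier R" shows "eval_int_poly R d 1 = \<one>"
proof -
  have "[(1::int)] \<cdot> \<one> = \<one>" by (simp add: add_pow_int_ge)
  then show ?thesis using eval_int_poly_pCons[OF assms, of 1 0] assms by (simp add: eval_int_poly_0 one_pCons)
qed

lemma eval_int_poly_X_power:
  assumes d: "d \<in> carrier R" shows "eval_int_poly R d ([:0, 1:] ^ l) = d [^] l"
proof (induction l)
  case (Suc l)
  have "[(0::int)] \<cdot> \<one> = \<zero>" "[(1::int)] \<cdot> \<one> = \<one>" by (simp_all add: add_pow_int_ge)
  then have "eval_int_poly R d [:0, 1:] = d" using d by (simp add: eval_int_poly_pCons eval_int_poly_0)
  moreover have "eval_int_poly R d ([:0, 1:] ^ Suc l) = eval_int_poly R d [:0, 1:] \<otimes> eval_int_poly R d ([:0, 1:] ^ l)"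
    by (simp only: power_Suc eval_int_poly_mult[OF d])
  ultimately show ?case using Suc d by (simp add: m_comm del: power_Suc)
qed (simp add: eval_int_poly_1 d)

lemma eval_int_poly_sum:
  assumes d: "d \<in> carrier R"
  shows "eval_int_poly R d (\<Sum>i\<in>I. f i) = (\<Oplus>i\<in>I. eval_int_poly R d (f i))"
proof (induction I rule: infinite_finite_induct)
  case (insert i I)
  then show ?case using d by (simp add: eval_int_poly_add eval_int_poly_closed)
qed (simp_all add: eval_int_poly_0)

text \<open>The matrices have entries in the type \<open>int poly\<close>, whereas \<open>R\<close>
  is a ring on a carrier set. A matrix identity therefore passes to \<open>R\<close> entry by entry,
  as an identity of evaluated sums.\<close>

lemma eval_matrix_mult:
  assumes d: "d \<in> carrier R" and A: "A \<in> carrier_mat n n" and B: "B \<in> carrier_mat n n" and AB: "A * B = c \<cdot>\<^sub>m 1\<^sub>m n"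
    and ij: "i < n" "j < n"
  shows "(\<Oplus>k\<in>{..<n}. eval_int_poly R d (A $$ (i, k)) \<otimes> eval_int_poly R d (B $$ (k, j))) =
    (if i = j then eval_int_poly R d c else \<zero>)"
proof -
  have "(A * B) $$ (i, j) = (\<Sum>k\<in>{..<n}. A $$ (i, k) * B $$ (k, j))"
    using A B ij by (simp add: scalar_prod_def atLeast0LessThan)
  moreover have "(A * B) $$ (i, j) = (if i = j then c else 0)" unfolding AB using ij by simp
  ultimately have "eval_int_poly R d (if i = j then c else 0) = eval_int_poly R d (\<Sum>k\<in>{..<n}. A $$ (i, k) * B $$ (k, j))"
    by simp
  also have "\<dots> = (\<Oplus>k\<in>{..<n}. eval_int_poly R d (A $$ (i, k)) \<otimes> eval_int_poly R d (B $$ (k, j)))"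
    by (simp add: eval_int_poly_sum[OF d] eval_int_poly_mult[OF d])
  finally show ?thesis by (cases "i = j") (simp_all add: eval_int_poly_0)
qed

text \<open>To be applied with \<open>E\<close> the diagrams of one rank. There \<open>K\<close> is
  block diagonal, and \<open>idx\<close> turns each block into a matrix over
  \<open>int poly\<close>. The adjugate identity holds over \<open>int poly\<close> whatever
  \<open>R\<close> is; after evaluation the determinant becomes a unit, so \<open>J\<close> can
  divide by it.\<close>

lemma block_inverse:
  fixes block :: "'x \<Rightarrow> 'c" and A :: "'c \<Rightarrow> int poly mat"
  assumes d: "d \<in> carrier R" and E: "finite E"
    and idx: "\<And>z. z \<in> E \<Longrightarrow> bij_betw idx {x \<in> E. block x = block z} {..<n (block z)}"
    and A: "\<And>z. z \<in> E \<Longrightarrow> A (block z) \<in> carrier_mat (n (block z)) (n (block z))"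
    and unit: "\<And>z. z \<in> E \<Longrightarrow> eval_int_poly R d (det (A (block z))) \<in> Units R"
    and K: "\<And>y x. y \<in> E \<Longrightarrow> x \<in> E \<Longrightarrow>
      K y x = (if block y = block x then eval_int_poly R d (A (block x) $$ (idx y, idx x)) else \<zero>)"
  defines "J \<equiv> \<lambda>z y. if block z = block y
    then inv (eval_int_poly R d (det (A (block z)))) \<otimes> eval_int_poly R d (adj_mat (A (block z)) $$ (idx z, idx y)) else \<zero>"
  assumes z: "z \<in> E" and x: "x \<in> E"
  shows "(\<Oplus>y\<in>E. J z y \<otimes> K y x) = (if z = x then \<one> else \<zero>)"
    and "(\<Oplus>y\<in>E. K z y \<otimes> J y x) = (if z = x then \<one> else \<zero>)"
    and "J z x \<in> carrier R"
proof -
  let ?ev = "eval_int_poly R d" and ?b = "block z"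
  let ?B = "{y \<in> E. block y = ?b}" and ?n = "n (block z)"
  let ?u = "inv (?ev (det (A ?b)))"
  have u: "?u \<in> carrier R" "?u \<otimes> ?ev (det (A ?b)) = \<one>" if "z \<in> E" for z
    using unit[OF z] by simp_all
  note ev = eval_int_poly_closed[OF d]
  show "J z x \<in> carrier R" unfolding J_def using unit[OF z] unit[OF x] ev by simp
  have lt: "idx y < ?n" if "y \<in> ?B" for y using bij_betwE[OF idx[OF z]] that by blast
  have inj: "idx y = idx y' \<longleftrightarrow> y = y'" if "y \<in> ?B" "y' \<in> ?B" for y y'
    using bij_betw_imp_inj_on[OF idx[OF z]] that by (auto dest: inj_onD)
  \<comment> \<open>Only the block of \<open>z\<close> contributes, and \<open>idx\<close> renumbers
    it by the row and column indices of the matrix.\<close>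
  have reindex: "(\<Oplus>y\<in>E. F y) = (\<Oplus>k\<in>{..<?n}. G k)"
    if F: "\<And>y. y \<in> ?B \<Longrightarrow> F y = G (idx y)" "\<And>y. y \<in> E \<Longrightarrow> y \<notin> ?B \<Longrightarrow> F y = \<zero>" and G: "\<And>k. G k \<in> carrier R" for F G
  proof -
    have "F \<in> E \<rightarrow> carrier R"
    proof
      fix y assume "y \<in> E" then show "F y \<in> carrier R"
        using F(1)[of y] F(2)[of y] G by (cases "y \<in> ?B") simp_all
    qed
    then have "(\<Oplus>y\<in>E. F y) = (\<Oplus>y\<in>?B. F y)"
      by (intro add.finprod_mono_neutral_cong_right) (use E F in auto)
    also have "\<dots> = (\<Oplus>y\<in>?B. G (idx y))" by (rule finsum_cong') (use F G in auto)
    also have "\<dots> = (\<Oplus>k\<in>idx ` ?B. G k)"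
      by (rule finsum_reindex[symmetric]) (use G bij_betw_imp_inj_on[OF idx[OF z]] in auto)
    also have "idx ` ?B = {..<?n}" by (rule bij_betw_imp_surj_on[OF idx[OF z]])
    finally show ?thesis .
  qed
  have out: "(\<Oplus>y\<in>E. F y) = \<zero>" if "\<And>y. y \<in> E \<Longrightarrow> F y = \<zero>" for F
  proof -
    have "(\<Oplus>y\<in>E. F y) = (\<Oplus>y\<in>E. \<zero>)" by (rule finsum_cong') (use that in auto)
    then show ?thesis by simp
  qed
  note adj = adj_mat[OF A[OF z]]
  show "(\<Oplus>y\<in>E. J z y \<otimes> K y x) = (if z = x then \<one> else \<zero>)"
  proof (cases "block x = ?b")
    case False
    have "(\<Oplus>y\<in>E. J z y \<otimes> K y x) = \<zero>"
      by (rule out) (use False K x u[OF z] ev in \<open>auto simp: J_def\<close>)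
    then show ?thesis using False by auto
  next
    case True
    have "(\<Oplus>y\<in>E. J z y \<otimes> K y x) =
        (\<Oplus>k\<in>{..<?n}. ?u \<otimes> (?ev (adj_mat (A ?b) $$ (idx z, k)) \<otimes> ?ev (A ?b $$ (k, idx x))))"
      by (rule reindex) (use True K x u(1)[OF z] ev in \<open>auto simp: J_def m_assoc\<close>)
    also have "\<dots> = ?u \<otimes> (\<Oplus>k\<in>{..<?n}. ?ev (adj_mat (A ?b) $$ (idx z, k)) \<otimes> ?ev (A ?b $$ (k, idx x)))"
      by (rule finsum_rdistr[symmetric]) (use u(1)[OF z] ev in auto)
    also have "\<dots> = ?u \<otimes> (if idx z = idx x then ?ev (det (A ?b)) else \<zero>)"
      by (subst eval_matrix_mult[OF d adj(1) A[OF z] adj(3)]) (use lt z x True in auto)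
    also have "\<dots> = (if z = x then \<one> else \<zero>)"
    proof -
      have "idx z = idx x \<longleftrightarrow> z = x" by (rule inj) (use z x True in auto)
      then show ?thesis using u[OF z] by (cases "z = x") (simp_all only: if_True if_False r_null simp_thms)
    qed
    finally show ?thesis .
  qed
  show "(\<Oplus>y\<in>E. K z y \<otimes> J y x) = (if z = x then \<one> else \<zero>)"
  proof (cases "block x = ?b")
    case False
    have "(\<Oplus>y\<in>E. K z y \<otimes> J y x) = \<zero>"
      by (rule out) (use False K z unit[OF x] ev in \<open>auto simp: J_def\<close>)
    then show ?thesis using False by auto
  next
    case True
    have "(\<Oplus>y\<in>E. K z y \<otimes> J y x) =
        (\<Oplus>k\<in>{..<?n}. ?u \<otimes> (?ev (A ?b $$ (idx z, k)) \<otimes> ?ev (adj_mat (A ?b) $$ (k, idx x))))"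
      by (rule reindex) (use True K z u(1)[OF z] ev in \<open>auto simp: J_def m_lcomm\<close>)
    also have "\<dots> = ?u \<otimes> (\<Oplus>k\<in>{..<?n}. ?ev (A ?b $$ (idx z, k)) \<otimes> ?ev (adj_mat (A ?b) $$ (k, idx x)))"
      by (rule finsum_rdistr[symmetric]) (use u(1)[OF z] ev in auto)
    also have "\<dots> = ?u \<otimes> (if idx z = idx x then ?ev (det (A ?b)) else \<zero>)"
      by (subst eval_matrix_mult[OF d A[OF z] adj(1) adj(2)]) (use lt z x True in auto)
    also have "\<dots> = (if z = x then \<one> else \<zero>)"
    proof -
      have "idx z = idx x \<longleftrightarrow> z = x" by (rule inj) (use z x True in auto)
      then show ?thesis using u[OF z] by (cases "z = x") (simp_all only: if_True if_False r_null simp_thms)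
    qed
    finally show ?thesis .
  qed
qed

text \<open>Exchanging the sums, that is, associativity of matrices acting on a vector. With the
  roles of the two inverse matrices interchanged it serves both injectivity and surjectivity
  below.\<close>

lemma matrix_cancel:
  assumes E: "finite E" "x \<in> E" and P: "\<And>z. z \<in> E \<Longrightarrow> P z \<in> carrier R"
    and Q: "\<And>y z. y \<in> E \<Longrightarrow> z \<in> E \<Longrightarrow> Q z y \<in> carrier R"
    and PQ: "\<And>y. y \<in> E \<Longrightarrow> (\<Oplus>z\<in>E. P z \<otimes> Q z y) = (if x = y then \<one> else \<zero>)"
    and v: "\<And>y. y \<in> E \<Longrightarrow> v y \<in> carrier R"
  shows "(\<Oplus>z\<in>E. P z \<otimes> (\<Oplus>y\<in>E. v y \<otimes> Q z y)) = v x"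
proof -
  have "(\<Oplus>z\<in>E. P z \<otimes> (\<Oplus>y\<in>E. v y \<otimes> Q z y)) = (\<Oplus>z\<in>E. \<Oplus>y\<in>E. v y \<otimes> (P z \<otimes> Q z y))"
  proof (rule finsum_cong'[OF refl])
    fix z assume z: "z \<in> E"
    have "P z \<otimes> (\<Oplus>y\<in>E. v y \<otimes> Q z y) = (\<Oplus>y\<in>E. P z \<otimes> (v y \<otimes> Q z y))"
      by (rule finsum_rdistr) (use z E P Q v in auto)
    also have "\<dots> = (\<Oplus>y\<in>E. v y \<otimes> (P z \<otimes> Q z y))"
      by (rule finsum_cong') (use z P Q v in \<open>auto simp: m_lcomm\<close>)
    finally show "P z \<otimes> (\<Oplus>y\<in>E. v y \<otimes> Q z y) = (\<Oplus>y\<in>E. v y \<otimes> (P z \<otimes> Q z y))" .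
  qed (use P Q v in \<open>auto intro!: finsum_closed\<close>)
  also have "\<dots> = (\<Oplus>y\<in>E. \<Oplus>z\<in>E. v y \<otimes> (P z \<otimes> Q z y))"
    by (rule finsum_exchange) (use E P Q v in auto)
  also have "\<dots> = (\<Oplus>y\<in>E. v y \<otimes> (\<Oplus>z\<in>E. P z \<otimes> Q z y))"
    by (rule finsum_cong') (use E P Q v in \<open>auto intro!: finsum_rdistr[symmetric] m_closed finsum_closed\<close>)
  also have "\<dots> = v x \<otimes> (\<Oplus>z\<in>E. P z \<otimes> Q z x)"
    by (rule finsum_eq_single) (use E v PQ in auto)
  also have "\<dots> = v x" using PQ v E by simp
  finally show ?thesis .
qed

text \<open>\<open>T\<close> never raises \<open>rk\<close>. A kernel element is thus killed from
  the highest rank downward, using the left inverse \<open>J\<close> of each diagonal block; a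
  preimage is found by solving at the highest rank with the right inverse \<open>J\<close> and
  passing the remainder to lower ranks.\<close>

lemma triangular_bij:
  fixes rk :: "'x \<Rightarrow> nat"
  assumes X: "finite X" and T: "lin R X X T"
    and K: "\<And>z x. z \<in> X \<Longrightarrow> x \<in> X \<Longrightarrow> K z x \<in> carrier R"
    and TK: "\<And>v z. v \<in> free_carrier R X \<Longrightarrow> z \<in> X \<Longrightarrow> T v z = (\<Oplus>x\<in>X. v x \<otimes> K z x)"
    and tri: "\<And>z x. z \<in> X \<Longrightarrow> x \<in> X \<Longrightarrow> rk x < rk z \<Longrightarrow> K z x = \<zero>"
    and J: "\<And>z x. z \<in> X \<Longrightarrow> x \<in> X \<Longrightarrow> rk z = rk x \<Longrightarrow> J z x \<in> carrier R"
    and JK: "\<And>z x. z \<in> X \<Longrightarrow> x \<in> X \<Longrightarrow> rk z = rk x \<Longrightarrow>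
      (\<Oplus>y\<in>{y \<in> X. rk y = rk z}. J z y \<otimes> K y x) = (if z = x then \<one> else \<zero>)"
    and KJ: "\<And>z x. z \<in> X \<Longrightarrow> x \<in> X \<Longrightarrow> rk z = rk x \<Longrightarrow>
      (\<Oplus>y\<in>{y \<in> X. rk y = rk z}. K z y \<otimes> J y x) = (if z = x then \<one> else \<zero>)"
  shows "bij_betw T (free_carrier R X) (free_carrier R X)"
proof -
  define E where "E n = {x \<in> X. rk x = n}" for n
  have finE: "finite (E n)" and EX: "E n \<subseteq> X" for n using X by (auto simp: E_def)
  have restrict: "T v z = (\<Oplus>x\<in>E n. v x \<otimes> K z x)"
    if v: "v \<in> free_carrier R X" and z: "z \<in> X" and zero: "\<And>x. x \<in> X \<Longrightarrow> rk x \<noteq> n \<Longrightarrow> v x = \<zero> \<or> K z x = \<zero>" for v z n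
    unfolding TK[OF v z]
  proof (rule add.finprod_mono_neutral_cong_right[OF X EX])
    fix x assume "x \<in> X - E n"
    then have "x \<in> X" "rk x \<noteq> n" by (auto simp: E_def)
    then show "v x \<otimes> K z x = \<zero>" using zero[of x] K[OF z] free_carrierD[OF v] by fastforce
  qed (use K[OF z] in \<open>auto simp: free_carrierD[OF v]\<close>)
  have ker: "v = (\<lambda>x. \<zero>)" if v: "v \<in> free_carrier R X" and Tv: "T v = (\<lambda>x. \<zero>)" for v
  proof -
    define N where "N = Max (insert 0 (rk ` X))"
    have N: "rk x \<le> N" if "x \<in> X" for x unfolding N_def using that X by auto
    \<comment> \<open>The condition selects the \<open>k\<close> highest ranks below and including
      the bound \<open>N\<close>; for \<open>k = 0\<close> it selects none.\<close>
    have van: "\<forall>x\<in>X. N < rk x + k \<longrightarrow> v x = \<zero>" for k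
    proof (induction k)
      case 0 then show ?case using N by fastforce
    next
      case (Suc k)
      show ?case
      proof (intro ballI impI)
        fix x assume x: "x \<in> X" "N < rk x + Suc k"
        show "v x = \<zero>"
        proof (cases "N < rk x + k")
          case True then show ?thesis using Suc x by blast
        next
          case False
          have xE: "x \<in> E (rk x)" using x by (simp add: E_def)
          have "(\<Oplus>y\<in>E (rk x). v y \<otimes> K z y) = \<zero>" if z: "z \<in> E (rk x)" for z
          proof -
            have zX: "z \<in> X" "rk z = rk x" using z by (auto simp: E_def)
            have "T v z = (\<Oplus>y\<in>E (rk x). v y \<otimes> K z y)"
            proof (rule restrict[OF v zX(1)])
              fix y assume y: "y \<in> X" "rk y \<noteq> rk x"
              show "v y = \<zero> \<or> K z y = \<zero>"
              proof (cases "rk y < rk x")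
                case True then show ?thesis using tri[OF zX(1) y(1)] zX by simp
              next
                case False
                then have "N < rk y + k" using y x by linarith
                then show ?thesis using Suc y by blast
              qed
            qed
            then show ?thesis using Tv by simp
          qed
          then have A: "(\<Oplus>z\<in>E (rk x). J x z \<otimes> (\<Oplus>y\<in>E (rk x). v y \<otimes> K z y)) = (\<Oplus>z\<in>E (rk x). \<zero>)"
            by (intro finsum_cong') (use J xE in \<open>auto simp: E_def\<close>)
          have B: "(\<Oplus>z\<in>E (rk x). J x z \<otimes> (\<Oplus>y\<in>E (rk x). v y \<otimes> K z y)) = v x"
          proof (rule matrix_cancel[OF finE xE])
            fix y z assume y: "y \<in> E (rk x)" and z: "z \<in> E (rk x)"
            show "K z y \<in> carrier R" using y z EX K by blast
          next
            fix y assume y: "y \<in> E (rk x)"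
            then have y': "y \<in> X" "rk x = rk y" by (simp_all add: E_def)
            show "J x y \<in> carrier R" by (rule J[OF x(1) y'])
            show "(\<Oplus>z\<in>E (rk x). J x z \<otimes> K z y) = (if x = y then \<one> else \<zero>)"
              using JK[OF x(1) y'] by (simp only: E_def)
            show "v y \<in> carrier R" by (rule free_carrierD[OF v])
          qed
          show ?thesis by (rule trans[OF trans[OF B[symmetric] A] finsum_zero])
        qed
      qed
    qed
    show ?thesis
    proof
      fix x show "v x = \<zero>"
        using van[of "Suc N"] free_carrier_off[OF v, of x] by (cases "x \<in> X") auto
    qed
  qed
  \<comment> \<open>Induction on a strict bound \<open>n\<close> for the ranks at which
    \<open>w\<close> may be nonzero.\<close>
  have surj: "\<forall>w\<in>free_carrier R X. (\<forall>x\<in>X. n \<le> rk x \<longrightarrow> w x = \<zero>) \<longrightarrow> (\<exists>v\<in>free_carrier R X. T v = w)" for n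
  proof (induction n)
    case 0
    show ?case
    proof (intro ballI impI)
      fix w assume w: "w \<in> free_carrier R X" "\<forall>x\<in>X. 0 \<le> rk x \<longrightarrow> w x = \<zero>"
      have "w = (\<lambda>x. \<zero>)"
      proof
        fix x show "w x = \<zero>" using w(2) free_carrier_off[OF w(1), of x] by (cases "x \<in> X") auto
      qed
      then show "\<exists>v\<in>free_carrier R X. T v = w" using lin_zero[OF T] free_zero by metis
    qed
  next
    case (Suc n)
    show ?case
    proof (intro ballI impI)
      fix w assume w: "w \<in> free_carrier R X" "\<forall>x\<in>X. Suc n \<le> rk x \<longrightarrow> w x = \<zero>"
      \<comment> \<open>Solves the equation at rank \<open>n\<close>, the highest where
        \<open>w\<close> may be nonzero. The unwanted contributions of this \<open>v\<close> lie in
        lower ranks only.\<close>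
      define v where "v x = (if x \<in> E n then (\<Oplus>y\<in>E n. w y \<otimes> J x y) else \<zero>)" for x
      have Jc: "J x y \<in> carrier R" if "x \<in> E n" "y \<in> E n" for x y using that J by (simp add: E_def)
      have v: "v \<in> free_carrier R X"
        by (rule free_carrierI) (use EX Jc in \<open>auto simp: v_def free_carrierD[OF w(1)] intro!: finsum_closed\<close>)
      have Tz: "T v z = (\<Oplus>x\<in>E n. v x \<otimes> K z x)" if "z \<in> X" for z
        by (rule restrict[OF v that]) (simp add: v_def E_def)
      have T1: "T v z = w z" if z: "z \<in> E n" for z
      proof -
        have zX: "z \<in> X" using z EX by blast
        have Kc: "K z x \<in> carrier R" if "x \<in> E n" for x using K[OF zX] EX that by blast
        have "T v z = (\<Oplus>x\<in>E n. K z x \<otimes> (\<Oplus>y\<in>E n. w y \<otimes> J x y))"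
          unfolding Tz[OF zX]
          by (rule finsum_cong')
            (use Jc Kc in \<open>auto simp: v_def m_comm free_carrierD[OF w(1)] intro!: finsum_closed m_closed\<close>)
        also have "\<dots> = w z"
        proof (rule matrix_cancel[OF finE z])
          fix x y assume x: "x \<in> E n" and y: "y \<in> E n"
          show "J x y \<in> carrier R" by (rule Jc[OF x y])
        next
          fix y assume y: "y \<in> E n"
          then have y': "y \<in> X" "rk z = rk y" "rk z = n" using z by (simp_all add: E_def)
          show "K z y \<in> carrier R" by (rule K[OF zX y'(1)])
          show "(\<Oplus>x\<in>E n. K z x \<otimes> J x y) = (if z = y then \<one> else \<zero>)"
            using KJ[OF zX y'(1,2)] y'(3) by (simp only: E_def)
          show "w y \<in> carrier R" by (rule free_carrierD[OF w(1)])
        qed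
        finally show ?thesis .
      qed
      have T0: "T v z = \<zero>" if z: "z \<in> X" "n < rk z" for z
      proof -
        have "(\<Oplus>x\<in>E n. v x \<otimes> K z x) = (\<Oplus>x\<in>E n. \<zero>)"
          by (rule finsum_cong') (use z tri in \<open>auto simp: E_def free_carrierD[OF v]\<close>)
        then show ?thesis using Tz z by simp
      qed
      \<comment> \<open>The remainder vanishes at rank \<open>n\<close> by \<open>T1\<close> and
        above it by \<open>T0\<close>, so the induction hypothesis applies.\<close>
      define w' where "w' x = w x \<ominus> T v x" for x
      note cl = free_carrierD[OF w(1)] free_carrierD[OF lin_closed[OF T v]]
      have w': "w' \<in> free_carrier R X"
        by (rule free_carrierI)
          (simp_all add: w'_def cl free_carrier_off[OF w(1)] free_carrier_off[OF lin_closed[OF T v]] a_minus_def)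
      have "w' x = \<zero>" if x: "x \<in> X" "n \<le> rk x" for x
      proof (cases "rk x = n")
        case True
        then have "T v x = w x" using T1 x by (simp add: E_def)
        then show ?thesis by (simp add: w'_def cl a_minus_def r_neg)
      next
        case False
        then have "T v x = \<zero>" "w x = \<zero>" using T0 x w(2) by auto
        then show ?thesis by (simp add: w'_def a_minus_def)
      qed
      then obtain v' where v': "v' \<in> free_carrier R X" "T v' = w'" using Suc w' by blast
      have "T (\<lambda>x. v x \<oplus> v' x) = (\<lambda>x. T v x \<oplus> w' x)" using lin_add[OF T v v'(1)] v'(2) by simp
      also have "\<dots> = w"
      proof
        fix x
        have "T v x \<oplus> (w x \<ominus> T v x) = w x"
          using cl[of x] by (simp add: a_minus_def a_lcomm[of "T v x" "w x"] r_neg)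
        then show "T v x \<oplus> w' x = w x" by (simp add: w'_def)
      qed
      finally show "\<exists>v\<in>free_carrier R X. T v = w" using free_add[OF v v'(1)] by blast
    qed
  qed
  show ?thesis
    unfolding bij_betw_def
  proof
    show "inj_on T (free_carrier R X)"
    proof (rule inj_onI)
      fix v w assume v: "v \<in> free_carrier R X" and w: "w \<in> free_carrier R X" and eq: "T v = T w"
      let ?u = "\<lambda>x. v x \<oplus> scale R (\<ominus> \<one>) w x"
      have m: "scale R (\<ominus> \<one>) u z = \<ominus> u z" if "u \<in> free_carrier R X" for u z
        by (simp add: scale_def free_carrierD[OF that] l_minus)
      have u: "?u \<in> free_carrier R X" by (rule free_add[OF v free_scale[OF _ w]]) simp
      have "T ?u = (\<lambda>x. T v x \<oplus> scale R (\<ominus> \<one>) (T w) x)"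
        using lin_add[OF T v free_scale[OF _ w, of "\<ominus> \<one>"]] lin_scale[OF T _ w, of "\<ominus> \<one>"] by simp
      also have "\<dots> = (\<lambda>x. \<zero>)"
        using eq by (simp add: m[OF lin_closed[OF T w]] r_neg free_carrierD[OF lin_closed[OF T w]])
      finally have "?u = (\<lambda>x. \<zero>)" by (rule ker[OF u])
      then have z: "v x \<oplus> \<ominus> w x = \<zero>" for x using m[OF w] by metis
      show "v = w"
      proof
        fix x
        have "v x = (v x \<oplus> \<ominus> w x) \<oplus> w x"
          by (simp add: a_assoc l_neg free_carrierD[OF v] free_carrierD[OF w])
        then show "v x = w x" by (simp add: z free_carrierD[OF w])
      qed
    qed
    show "T ` free_carrier R X = free_carrier R X"
    proof (rule subset_antisym; rule subsetI)
      fix w assume "w \<in> T ` free_carrier R X" then show "w \<in> free_carrier R X" using lin_closed[OF T] by blast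
    next
      fix w assume w: "w \<in> free_carrier R X"
      have "rk x \<le> Max (insert 0 (rk ` X))" if "x \<in> X" for x using that X by auto
      then have "\<forall>x\<in>X. Suc (Max (insert 0 (rk ` X))) \<le> rk x \<longrightarrow> w x = \<zero>" by fastforce
      then show "w \<in> T ` free_carrier R X" using surj w by blast
    qed
  qed
qed

end

section \<open>The two algebra structures on diagrams\<close>

lemma finite_preceq: "finite {r. r \<preceq> p}"
  by (rule finite_subset[of _ "{..p}"]) (auto simp: preceq_def)

text \<open>The union is disjoint, as a diagram determines its source; double sums over the source
  and the diagram thus become single sums.\<close>

definition all_up :: "nat \<Rightarrow> diagram set" where
  "all_up p = (\<Union>r\<in>{r. r \<preceq> p}. up_mono r p)"

lemma finite_all_up: "finite (all_up p)"
  unfolding all_up_def using finite_preceq finite_up_mono by blast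

lemma all_up_mem: "h \<in> up_mono r p \<Longrightarrow> h \<in> all_up p"
  unfolding all_up_def using up_mono_preceq by blast

lemma all_upE: "h \<in> all_up p \<Longrightarrow> (\<And>r. r \<preceq> p \<Longrightarrow> h \<in> up_mono r p \<Longrightarrow> thesis) \<Longrightarrow> thesis"
  unfolding all_up_def by blast

lemma (in abelian_monoid) finsum_all_up:
  assumes "\<And>h. h \<in> all_up p \<Longrightarrow> F h \<in> carrier G"
  shows "(\<Oplus>r\<in>{r. r \<preceq> p}. \<Oplus>h\<in>up_mono r p. F h) = (\<Oplus>h\<in>all_up p. F h)"
  unfolding all_up_def
proof (rule add.finprod_UN_disjoint[symmetric])
  show "pairwise (\<lambda>i j. disjnt (up_mono i p) (up_mono j p)) {r. r \<preceq> p}"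
    unfolding pairwise_def disjnt_iff using up_mono_source_unique by blast
qed (use assms finite_preceq finite_up_mono in \<open>auto simp: all_up_def\<close>)

text \<open>Inserting the identity puts a summand of the unit into the factorized form on which the
  matrix product is computed.\<close>

lemma up_mono_flip_self:
  assumes "f \<in> up_mono r p"
  shows "f \<bullet>\<^sub>B flip f = f \<bullet>\<^sub>B id_diagram r \<bullet>\<^sub>B flip f"
  using id_comp[OF flip_brauer[OF up_mono_brauer[OF assms]]] by simp

section \<open>Structure constants of the two products\<close>

definition diagram_mult :: "('k, 'r) ring_scheme \<Rightarrow> 'k \<Rightarrow> diagram \<Rightarrow> diagram \<Rightarrow> diagram \<Rightarrow> 'k" where
  "diagram_mult R \<delta> f g = scale R (\<delta> [^]\<^bsub>R\<^esub> loops f g) (basis R (f \<bullet>\<^sub>B g))"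

definition matrix_mult :: "('k, 'r) ring_scheme \<Rightarrow> nat \<Rightarrow> diagram \<Rightarrow> diagram \<Rightarrow> diagram \<Rightarrow> 'k" where
  "matrix_mult R p f g = (case factorization p p f of (r, fu, f0, fd) \<Rightarrow>
     case factorization p p g of (s, gu, g0, gd) \<Rightarrow>
       if flip fd = gu then basis R (fu \<bullet>\<^sub>B (f0 \<bullet>\<^sub>B g0) \<bullet>\<^sub>B gd) else (\<lambda>_. \<zero>\<^bsub>R\<^esub>))"

definition matrix_one :: "('k, 'r) ring_scheme \<Rightarrow> nat \<Rightarrow> diagram \<Rightarrow> 'k" where
  "matrix_one R p = (\<lambda>d. \<Oplus>\<^bsub>R\<^esub>r\<in>{r. r \<preceq> p}. \<Oplus>\<^bsub>R\<^esub>f\<in>up_mono r p. basis R (f \<bullet>\<^sub>B flip f) d)"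

lemma brauer_algebra_eq:
  "brauer_algebra R \<delta> p = free_algebra R (brauer p p) (diagram_mult R \<delta>) (basis R (id_diagram p))"
  unfolding brauer_algebra_def diagram_mult_def ..

lemma brauer_mult_eq: "brauer_mult R \<delta> p q r = bilinear_ext R (brauer q r) (brauer p q) (diagram_mult R \<delta>)"
  unfolding brauer_mult_def diagram_mult_def ..

lemma matrix_brauer_algebra_eq:
  "matrix_brauer_algebra R p = free_algebra R (brauer p p) (matrix_mult R p) (matrix_one R p)"
  unfolding matrix_brauer_algebra_def matrix_mult_def matrix_one_def ..

lemma matrix_mult_eq:
  assumes "a \<in> up_mono r p" "b \<in> level_diagrams r" "c \<in> down_mono p r"
    and "a' \<in> up_mono s p" "b' \<in> level_diagrams s" "c' \<in> down_mono p s"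
  shows "matrix_mult R p (a \<bullet>\<^sub>B b \<bullet>\<^sub>B c) (a' \<bullet>\<^sub>B b' \<bullet>\<^sub>B c') =
    (if flip c = a' then basis R (a \<bullet>\<^sub>B (b \<bullet>\<^sub>B b') \<bullet>\<^sub>B c') else (\<lambda>_. \<zero>\<^bsub>R\<^esub>))"
  unfolding matrix_mult_def factorization_eq[OF assms(1-3)] factorization_eq[OF assms(4-6)] by simp

lemma flip_match_rank:
  assumes "c \<in> down_mono p r" "a' \<in> up_mono s p" "flip c = a'" shows "s = r"
  using up_mono_source_unique[OF flip_down_mono[OF assms(1)]] assms by blast

context cring
begin

section \<open>The Brauer algebra\<close>

lemma diagram_mult_closed:
  assumes "\<delta> \<in> carrier R" "f \<in> brauer q r" "g \<in> brauer p q"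
  shows "diagram_mult R \<delta> f g \<in> free_carrier R (brauer p r)"
  unfolding diagram_mult_def using assms by (intro free_scale free_basis brauer_comp) auto

lemma brauer_mult_basis:
  assumes "\<delta> \<in> carrier R" "f \<in> brauer q r" "g \<in> brauer p q"
  shows "brauer_mult R \<delta> p q r (basis R f) (basis R g) = diagram_mult R \<delta> f g"
  unfolding brauer_mult_eq
  by (rule bilinear_basis[where m = "diagram_mult R \<delta>", OF finite_brauer finite_brauer diagram_mult_closed])
    (use assms in auto)

lemma lin_brauer_mult_left:
  assumes "\<delta> \<in> carrier R" "w \<in> free_carrier R (brauer p q)"
  shows "lin R (brauer q r) (brauer p r) (\<lambda>v. brauer_mult R \<delta> p q r v w)"
  unfolding brauer_mult_eq by (rule lin_bilinear_left) (use assms diagram_mult_closed in auto)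

lemma lin_brauer_mult_right:
  assumes "\<delta> \<in> carrier R" "v \<in> free_carrier R (brauer q r)"
  shows "lin R (brauer p q) (brauer p r) (\<lambda>w. brauer_mult R \<delta> p q r v w)"
  unfolding brauer_mult_eq by (rule lin_bilinear_right[OF finite_brauer finite_brauer]) (use assms diagram_mult_closed in auto)

lemma brauer_algebra_assoc:
  assumes d: "\<delta> \<in> carrier R"
  shows "assoc_algebra R (brauer_algebra R \<delta> p)"
  unfolding brauer_algebra_eq
proof (rule assoc_algebra_free[OF finite_brauer])
  let ?X = "brauer p p" and ?B = "brauer_mult R \<delta> p p p"
  note id = level_brauer[OF id_level[of p]]
  have idl: "upward (id_diagram p)" "downward (id_diagram p)"
    using id_level[of p] by (auto simp: level_diagrams_def level_def)
  show "diagram_mult R \<delta> f g \<in> free_carrier R ?X" if "f \<in> ?X" "g \<in> ?X" for f g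
    by (rule diagram_mult_closed[OF d that])
  show "basis R (id_diagram p) \<in> free_carrier R ?X" by (rule free_basis[OF id])
  have one: "scale R (\<delta> [^] (0::nat)) (basis R f) = basis R f" if "f \<in> ?X" for f
    using scale_one[OF free_basis[OF that]] by simp
  show "bilinear_ext R ?X ?X (diagram_mult R \<delta>) (basis R (id_diagram p)) (basis R f) = basis R f" if f: "f \<in> ?X" for f
    using brauer_mult_basis[OF d id f] one[OF f] unfolding brauer_mult_eq diagram_mult_def loops_upward[OF id idl(1) f] id_comp[OF f]
    by simp
  show "bilinear_ext R ?X ?X (diagram_mult R \<delta>) (basis R f) (basis R (id_diagram p)) = basis R f" if f: "f \<in> ?X" for f
    using brauer_mult_basis[OF d f id] one[OF f] unfolding brauer_mult_eq diagram_mult_def loops_downward[OF id idl(2) f] comp_id[OF f]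
    by simp
  fix f g h assume f: "f \<in> ?X" and g: "g \<in> ?X" and h: "h \<in> ?X"
  note fg = brauer_comp[OF f g] and gh = brauer_comp[OF g h]
  have fin: "finite (\<Union>f)" "finite (\<Union>g)" "finite (\<Union>h)"
    using brauer_Union[OF f] brauer_Union[OF g] brauer_Union[OF h] finite_points by simp_all
  note basisX = free_basis[OF brauer_comp[OF f gh]]
  have "?B (diagram_mult R \<delta> f g) (basis R h) = scale R (\<delta> [^] loops f g) (diagram_mult R \<delta> (f \<bullet>\<^sub>B g) h)"
    unfolding diagram_mult_def[of R \<delta> f g] using d
    by (simp add: lin_scale[OF lin_brauer_mult_left[OF d free_basis[OF h]] _ free_basis[OF fg]] brauer_mult_basis[OF d fg h])
  \<comment> \<open>Each bracketing collects two loop counts; \<open>loops_assoc\<close> equates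
    their sums.\<close>
  also have "\<dots> = scale R (\<delta> [^] (loops f g + loops (f \<bullet>\<^sub>B g) h)) (basis R (f \<bullet>\<^sub>B g \<bullet>\<^sub>B h))"
    unfolding diagram_mult_def diagram_comp_assoc using d by (simp add: scale_scale[OF _ _ basisX] nat_pow_mult)
  also have "\<dots> = scale R (\<delta> [^] loops g h) (diagram_mult R \<delta> f (g \<bullet>\<^sub>B h))"
    unfolding loops_assoc[OF fin] diagram_mult_def using d by (simp add: scale_scale[OF _ _ basisX] nat_pow_mult)
  also have "\<dots> = ?B (basis R f) (diagram_mult R \<delta> g h)"
    unfolding diagram_mult_def[of R \<delta> g h] using d
    by (simp add: lin_scale[OF lin_brauer_mult_right[OF d free_basis[OF f]] _ free_basis[OF gh]] brauer_mult_basis[OF d f gh])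
  finally show "bilinear_ext R ?X ?X (diagram_mult R \<delta>) (diagram_mult R \<delta> f g) (basis R h) =
      bilinear_ext R ?X ?X (diagram_mult R \<delta>) (basis R f) (diagram_mult R \<delta> g h)"
    unfolding brauer_mult_eq .
qed

section \<open>The matrix Brauer algebra\<close>

lemma matrix_mult_closed:
  assumes "f \<in> brauer p p" "g \<in> brauer p p"
  shows "matrix_mult R p f g \<in> free_carrier R (brauer p p)"
proof -
  obtain r a b c where f: "a \<in> up_mono r p" "b \<in> level_diagrams r" "c \<in> down_mono p r" "f = a \<bullet>\<^sub>B b \<bullet>\<^sub>B c"
    using factorization_exists[OF assms(1)] .
  obtain s a' b' c' where g: "a' \<in> up_mono s p" "b' \<in> level_diagrams s" "c' \<in> down_mono p s" "g = a' \<bullet>\<^sub>B b' \<bullet>\<^sub>B c'"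
    using factorization_exists[OF assms(2)] .
  show ?thesis
  proof (cases "flip c = a'")
    case True
    then have "s = r" using flip_match_rank f g by blast
    then have "a \<bullet>\<^sub>B (b \<bullet>\<^sub>B b') \<bullet>\<^sub>B c' \<in> brauer p p" using f g level_comp factor_brauer by metis
    then show ?thesis unfolding f(4) g(4) matrix_mult_eq[OF f(1-3) g(1-3)] using True free_basis by simp
  next
    case False
    then show ?thesis unfolding f(4) g(4) matrix_mult_eq[OF f(1-3) g(1-3)] using free_zero by simp
  qed
qed

abbreviation matrix_ext where
  "matrix_ext p \<equiv> bilinear_ext R (brauer p p) (brauer p p) (matrix_mult R p)"

lemma matrix_ext_basis:
  "f \<in> brauer p p \<Longrightarrow> g \<in> brauer p p \<Longrightarrow> matrix_ext p (basis R f) (basis R g) = matrix_mult R p f g"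
  by (rule bilinear_basis[where m = "matrix_mult R p", OF finite_brauer finite_brauer matrix_mult_closed])

lemma lin_matrix_ext_left:
  "w \<in> free_carrier R (brauer p p) \<Longrightarrow> lin R (brauer p p) (brauer p p) (\<lambda>v. matrix_ext p v w)"
  by (rule lin_bilinear_left[OF matrix_mult_closed])

lemma lin_matrix_ext_right:
  "v \<in> free_carrier R (brauer p p) \<Longrightarrow> lin R (brauer p p) (brauer p p) (\<lambda>w. matrix_ext p v w)"
  by (rule lin_bilinear_right[OF finite_brauer finite_brauer matrix_mult_closed])

lemma up_flip_brauer: "f \<in> all_up p \<Longrightarrow> f \<bullet>\<^sub>B flip f \<in> brauer p p"
  by (elim all_upE) (intro brauer_comp[OF up_mono_brauer flip_brauer[OF up_mono_brauer]])

lemma matrix_one_eq: "matrix_one R p = finsum (free_algebra R (brauer p p) m e) (\<lambda>f. basis R (f \<bullet>\<^sub>B flip f)) (all_up p)"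
proof
  fix d
  have cl: "(\<lambda>f. basis R (f \<bullet>\<^sub>B flip f)) \<in> all_up p \<rightarrow> free_carrier R (brauer p p)"
    by (intro Pi_I free_basis up_flip_brauer)
  have "matrix_one R p d = (\<Oplus>f\<in>all_up p. basis R (f \<bullet>\<^sub>B flip f) d)"
    unfolding matrix_one_def by (rule finsum_all_up) (rule basis_carrier)
  then show "matrix_one R p d = finsum (free_algebra R (brauer p p) m e) (\<lambda>f. basis R (f \<bullet>\<^sub>B flip f)) (all_up p) d"
    by (simp add: finsum_free[OF cl])
qed

lemma matrix_one_closed: "matrix_one R p \<in> free_carrier R (brauer p p)"
  unfolding matrix_one_eq[where m = "\<lambda>x y. undefined" and e = undefined]
  by (rule finsum_free_closed) (intro Pi_I free_basis up_flip_brauer)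

lemma free_finsum_single:
  assumes "finite I" "i \<in> I" "F i \<in> free_carrier R X" "\<And>j. j \<in> I \<Longrightarrow> j \<noteq> i \<Longrightarrow> F j = (\<lambda>_. \<zero>)"
  shows "finsum (free_algebra R X m e) F I = F i"
  by (rule abelian_monoid.finsum_eq_single[OF free_algebra_monoid])
    (use assms in \<open>auto simp: free_algebra_simps\<close>)

lemma matrix_brauer_algebra_assoc: "assoc_algebra R (matrix_brauer_algebra R p)"
  unfolding matrix_brauer_algebra_eq
proof (rule assoc_algebra_free[OF finite_brauer matrix_mult_closed matrix_one_closed])
  let ?X = "brauer p p"
  let ?M = "free_algebra R ?X (\<lambda>x y. undefined) undefined"
  have cl: "(\<lambda>f. basis R (f \<bullet>\<^sub>B flip f)) \<in> all_up p \<rightarrow> free_carrier R ?X"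
    by (intro Pi_I free_basis up_flip_brauer)
  fix x assume x: "x \<in> ?X"
  obtain r a b c where X: "a \<in> up_mono r p" "b \<in> level_diagrams r" "c \<in> down_mono p r" "x = a \<bullet>\<^sub>B b \<bullet>\<^sub>B c"
    using factorization_exists[OF x] .
  obtain \<sigma> where \<sigma>: "\<sigma> permutes {1..r}" "b = perm_diagram r \<sigma>" using X(2) level_iff_perm by blast
  have bid: "id_diagram r \<bullet>\<^sub>B b = b" "b \<bullet>\<^sub>B id_diagram r = b"
    using id_comp comp_id level_brauer[OF X(2)] by simp_all
  \<comment> \<open>The summands of the unit act as orthogonal projections onto rows: the one for
    the upward factor of \<open>x\<close> fixes \<open>x\<close>, the others annihilate it. On the
    right the columns play this role.\<close>
  have m1: "matrix_mult R p (f \<bullet>\<^sub>B flip f) x = (if f = a then basis R x else (\<lambda>_. \<zero>))" if "f \<in> all_up p" for f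
  proof -
    obtain s where s: "f \<in> up_mono s p" using \<open>f \<in> all_up p\<close> all_upE by blast
    show ?thesis
    proof (cases "f = a")
      case True
      then have "s = r" using up_mono_source_unique s X(1) by blast
      then show ?thesis
        unfolding up_mono_flip_self[OF s] X(4) matrix_mult_eq[OF s id_level flip_up_mono[OF s] X(1-3)]
        using True bid by (simp add: flip_flip)
    next
      case False
      then show ?thesis
        unfolding up_mono_flip_self[OF s] X(4) matrix_mult_eq[OF s id_level flip_up_mono[OF s] X(1-3)]
        by (simp add: flip_flip)
    qed
  qed
  have "matrix_ext p (matrix_one R p) (basis R x) = finsum ?M (\<lambda>f. matrix_ext p (basis R (f \<bullet>\<^sub>B flip f)) (basis R x)) (all_up p)"
    unfolding matrix_one_eq[where m = "\<lambda>x y. undefined" and e = undefined]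
    by (rule lin_finsum[OF lin_matrix_ext_left[OF free_basis[OF x]] cl])
  also have "\<dots> = matrix_ext p (basis R (a \<bullet>\<^sub>B flip a)) (basis R x)"
    by (rule free_finsum_single[OF finite_all_up all_up_mem[OF X(1)]])
      (simp_all add: matrix_ext_basis up_flip_brauer x m1 all_up_mem[OF X(1)] free_basis)
  also have "\<dots> = basis R x"
    by (simp add: matrix_ext_basis up_flip_brauer x m1 all_up_mem[OF X(1)])
  finally show "matrix_ext p (matrix_one R p) (basis R x) = basis R x" .
  have ca: "flip c \<in> up_mono r p" by (rule flip_down_mono[OF X(3)])
  have m2: "matrix_mult R p x (f \<bullet>\<^sub>B flip f) = (if f = flip c then basis R x else (\<lambda>_. \<zero>))" if "f \<in> all_up p" for f
  proof -
    obtain s where s: "f \<in> up_mono s p" using \<open>f \<in> all_up p\<close> all_upE by blast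
    show ?thesis
    proof (cases "f = flip c")
      case True
      then have "s = r" using up_mono_source_unique s ca by blast
      then show ?thesis
        unfolding up_mono_flip_self[OF s] X(4) matrix_mult_eq[OF X(1-3) s id_level flip_up_mono[OF s]]
        using True bid by (simp add: flip_flip)
    next
      case False
      then show ?thesis
        unfolding up_mono_flip_self[OF s] X(4) matrix_mult_eq[OF X(1-3) s id_level flip_up_mono[OF s]]
        by auto
    qed
  qed
  have "matrix_ext p (basis R x) (matrix_one R p) = finsum ?M (\<lambda>f. matrix_ext p (basis R x) (basis R (f \<bullet>\<^sub>B flip f))) (all_up p)"
    unfolding matrix_one_eq[where m = "\<lambda>x y. undefined" and e = undefined]
    by (rule lin_finsum[OF lin_matrix_ext_right[OF free_basis[OF x]] cl])
  also have "\<dots> = matrix_ext p (basis R x) (basis R (flip c \<bullet>\<^sub>B flip (flip c)))"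
    by (rule free_finsum_single[OF finite_all_up all_up_mem[OF ca]])
      (simp_all add: matrix_ext_basis up_flip_brauer x m2 all_up_mem[OF ca] free_basis)
  also have "\<dots> = basis R x"
    by (simp add: matrix_ext_basis up_flip_brauer x m2 all_up_mem[OF ca])
  finally show "matrix_ext p (basis R x) (matrix_one R p) = basis R x" .
  fix y z assume y: "y \<in> ?X" and z: "z \<in> ?X"
  obtain s a' b' c' where Y: "a' \<in> up_mono s p" "b' \<in> level_diagrams s" "c' \<in> down_mono p s" "y = a' \<bullet>\<^sub>B b' \<bullet>\<^sub>B c'"
    using factorization_exists[OF y] .
  obtain t a'' b'' c'' where Z: "a'' \<in> up_mono t p" "b'' \<in> level_diagrams t" "c'' \<in> down_mono p t" "z = a'' \<bullet>\<^sub>B b'' \<bullet>\<^sub>B c''"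
    using factorization_exists[OF z] .
  note L0 = lin_zero[OF lin_matrix_ext_left[OF free_basis[OF z]]] and R0 = lin_zero[OF lin_matrix_ext_right[OF free_basis[OF x]]]
  note xy = matrix_mult_eq[OF X(1-3) Y(1-3), of R, folded X(4) Y(4)]
    and yz = matrix_mult_eq[OF Y(1-3) Z(1-3), of R, folded Y(4) Z(4)]
  show "matrix_ext p (matrix_mult R p x y) (basis R z) = matrix_ext p (basis R x) (matrix_mult R p y z)"
  \<comment> \<open>Either bracketing is nonzero only if both interfaces match, and then only the
    level factors are multiplied. If just one interface matches, one bracketing vanishes at its
    inner product and the other at its outer one.\<close>
  proof (cases "flip c = a'")
    case True
    then have sr: "s = r" using flip_match_rank X Y by blast
    have bb: "b \<bullet>\<^sub>B b' \<in> level_diagrams r" using level_comp X(2) Y(2) sr by blast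
    let ?xy = "a \<bullet>\<^sub>B (b \<bullet>\<^sub>B b') \<bullet>\<^sub>B c'"
    have c'r: "c' \<in> down_mono p r" using Y(3) sr by simp
    have xyX: "?xy \<in> ?X" by (rule factor_brauer[OF X(1) bb c'r])
    have lhs: "matrix_ext p (matrix_mult R p x y) (basis R z) =
        (if flip c' = a'' then basis R (a \<bullet>\<^sub>B ((b \<bullet>\<^sub>B b') \<bullet>\<^sub>B b'') \<bullet>\<^sub>B c'') else (\<lambda>_. \<zero>))"
      unfolding xy using True
      by (simp add: matrix_ext_basis[OF xyX z] matrix_mult_eq[OF X(1) bb c'r Z(1-3), folded Z(4)])
    show ?thesis
    proof (cases "flip c' = a''")
      case T2: True
      then have ts: "t = s" using flip_match_rank Y Z by blast
      have bb': "b' \<bullet>\<^sub>B b'' \<in> level_diagrams s" using level_comp Y(2) Z(2) ts by blast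
      have c''s: "c'' \<in> down_mono p s" using Z(3) ts by simp
      have yzX: "a' \<bullet>\<^sub>B (b' \<bullet>\<^sub>B b'') \<bullet>\<^sub>B c'' \<in> ?X" by (rule factor_brauer[OF Y(1) bb' c''s])
      have "matrix_ext p (basis R x) (basis R (a' \<bullet>\<^sub>B (b' \<bullet>\<^sub>B b'') \<bullet>\<^sub>B c'')) = basis R (a \<bullet>\<^sub>B (b \<bullet>\<^sub>B b' \<bullet>\<^sub>B b'') \<bullet>\<^sub>B c'')"
        using True by (simp add: matrix_ext_basis[OF x yzX] matrix_mult_eq[OF X(1-3) Y(1) bb' c''s, folded X(4)])
      then show ?thesis
        unfolding lhs yz using True T2 by (simp add: diagram_comp_assoc[of b b' b''])
    next
      case False
      then show ?thesis unfolding lhs yz by (simp add: R0)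
    qed
  next
    case False
    have lhs: "matrix_ext p (matrix_mult R p x y) (basis R z) = (\<lambda>_. \<zero>)"
      unfolding xy using False by (simp add: L0)
    show ?thesis
    proof (cases "flip c' = a''")
      case T2: True
      then have ts: "t = s" using flip_match_rank Y Z by blast
      have bb': "b' \<bullet>\<^sub>B b'' \<in> level_diagrams s" using level_comp Y(2) Z(2) ts by blast
      have c''s: "c'' \<in> down_mono p s" using Z(3) ts by simp
      have yzX: "a' \<bullet>\<^sub>B (b' \<bullet>\<^sub>B b'') \<bullet>\<^sub>B c'' \<in> ?X" by (rule factor_brauer[OF Y(1) bb' c''s])
      show ?thesis
        unfolding lhs yz using False T2
        by (simp add: matrix_ext_basis[OF x yzX] matrix_mult_eq[OF X(1-3) Y(1) bb' c''s, folded X(4)])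
    next
      case F2: False
      then show ?thesis unfolding lhs yz by (simp add: R0)
    qed
  qed
qed

end

section \<open>The map L\<close>

text \<open>The contribution of \<open>h\<close> to the image of a basis diagram \<open>g\<close>.
  Composing with the upward \<open>h\<close> on the left closes no loop, so only the loops of
  \<open>flip h\<close> with \<open>g\<close> appear.\<close>

definition L_term :: "('k, 'r) ring_scheme \<Rightarrow> 'k \<Rightarrow> diagram \<Rightarrow> diagram \<Rightarrow> diagram \<Rightarrow> 'k" where
  "L_term R \<delta> g h = (if downward (flip h \<bullet>\<^sub>B g)
     then scale R (\<delta> [^]\<^bsub>R\<^esub> loops (flip h) g) (basis R (h \<bullet>\<^sub>B flip h \<bullet>\<^sub>B g)) else (\<lambda>_. \<zero>\<^bsub>R\<^esub>))"

context cring
begin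

section \<open>Linearity of L and its values on diagrams\<close>

lemma lin_sum:
  assumes "finite I" and T: "\<And>i. i \<in> I \<Longrightarrow> lin R X Y (T i)"
  shows "lin R X Y (\<lambda>v. finsum (free_algebra R Y m e) (\<lambda>i. T i v) I)"
  unfolding lin_def
proof (intro conjI ballI)
  have cl: "(\<lambda>i. T i v) \<in> I \<rightarrow> free_carrier R Y" if "v \<in> free_carrier R X" for v
    using lin_closed[OF T that] by blast
  note c = free_carrierD[OF lin_closed[OF T]]
  show "finsum (free_algebra R Y m e) (\<lambda>i. T i v) I \<in> free_carrier R Y" if "v \<in> free_carrier R X" for v
    by (rule finsum_free_closed[OF cl[OF that]])
  show "finsum (free_algebra R Y m e) (\<lambda>i. T i (\<lambda>x. v x \<oplus> w x)) I =
      (\<lambda>y. finsum (free_algebra R Y m e) (\<lambda>i. T i v) I y \<oplus> finsum (free_algebra R Y m e) (\<lambda>i. T i w) I y)"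
    if v: "v \<in> free_carrier R X" and w: "w \<in> free_carrier R X" for v w
  proof
    fix y
    have "(\<Oplus>i\<in>I. T i (\<lambda>x. v x \<oplus> w x) y) = (\<Oplus>i\<in>I. T i v y \<oplus> T i w y)"
      by (rule finsum_cong') (auto simp: lin_add[OF T v w] c v w)
    also have "\<dots> = (\<Oplus>i\<in>I. T i v y) \<oplus> (\<Oplus>i\<in>I. T i w y)"
      by (rule finsum_addf) (auto simp: c v w)
    finally show "finsum (free_algebra R Y m e) (\<lambda>i. T i (\<lambda>x. v x \<oplus> w x)) I y =
      finsum (free_algebra R Y m e) (\<lambda>i. T i v) I y \<oplus> finsum (free_algebra R Y m e) (\<lambda>i. T i w) I y"
      by (simp add: finsum_free[OF cl[OF free_add[OF v w]]] finsum_free[OF cl[OF v]] finsum_free[OF cl[OF w]])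
  qed
  show "finsum (free_algebra R Y m e) (\<lambda>i. T i (scale R a v)) I = scale R a (finsum (free_algebra R Y m e) (\<lambda>i. T i v) I)"
    if a: "a \<in> carrier R" and v: "v \<in> free_carrier R X" for a v
  proof
    fix y
    have "(\<Oplus>i\<in>I. T i (scale R a v) y) = (\<Oplus>i\<in>I. a \<otimes> T i v y)"
      by (rule finsum_cong') (auto simp: lin_scale[OF T a v] c a v, simp add: scale_def)
    also have "\<dots> = a \<otimes> (\<Oplus>i\<in>I. T i v y)"
      by (rule finsum_rdistr[symmetric]) (auto simp: assms(1) a c v)
    finally show "finsum (free_algebra R Y m e) (\<lambda>i. T i (scale R a v)) I y = scale R a (finsum (free_algebra R Y m e) (\<lambda>i. T i v) I) y"
      by (simp only: finsum_free[OF cl[OF free_scale[OF a v]]]) (simp add: finsum_free[OF cl[OF v]] scale_def)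
  qed
qed

lemma lin_scale_map: "a \<in> carrier R \<Longrightarrow> lin R X X (scale R a)"
  unfolding lin_def
proof (intro conjI ballI)
  assume a: "a \<in> carrier R"
  show "scale R a v \<in> free_carrier R X" if "v \<in> free_carrier R X" for v by (rule free_scale[OF a that])
  show "scale R a (\<lambda>x. v x \<oplus> w x) = (\<lambda>y. scale R a v y \<oplus> scale R a w y)"
    if "v \<in> free_carrier R X" "w \<in> free_carrier R X" for v w
    by (rule ext) (simp add: scale_def r_distr a free_carrierD[OF that(1)] free_carrierD[OF that(2)])
  show "scale R a (scale R b v) = scale R b (scale R a v)" if "b \<in> carrier R" "v \<in> free_carrier R X" for b v
    by (simp add: scale_scale[OF a that] scale_scale[OF that(1) a that(2)] m_comm[OF a that(1)])
qed

lemma lin_proj_down: "lin R X X (proj_down R)"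
  unfolding lin_def
proof (intro conjI ballI)
  show "proj_down R v \<in> free_carrier R X" if "v \<in> free_carrier R X" for v
    by (rule free_carrierI) (simp_all add: proj_down_def free_carrierD[OF that] free_carrier_off[OF that])
  show "proj_down R (\<lambda>x. v x \<oplus> w x) = (\<lambda>y. proj_down R v y \<oplus> proj_down R w y)" for v w
    by (rule ext) (simp add: proj_down_def)
  show "proj_down R (scale R a v) = scale R a (proj_down R v)" if "a \<in> carrier R" for a v
    by (rule ext) (simp add: proj_down_def scale_def that)
qed

lemma proj_down_scale_basis:
  assumes "a \<in> carrier R"
  shows "proj_down R (scale R a (basis R d)) = (if downward d then scale R a (basis R d) else (\<lambda>_. \<zero>))"
  by (rule ext) (auto simp: proj_down_def scale_def basis_def assms)

lemma L_summand_lin: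
  assumes d: "\<delta> \<in> carrier R" and h: "h \<in> up_mono s p"
  shows "lin R (brauer p p) (brauer p p)
    (\<lambda>g. brauer_mult R \<delta> p s p (basis R h) (proj_down R (brauer_mult R \<delta> p p s (basis R (flip h)) g)))"
  by (rule lin_comp[OF lin_comp[OF lin_brauer_mult_right[OF d free_basis[OF flip_brauer]] lin_proj_down] lin_brauer_mult_right[OF d free_basis]])
    (use h in \<open>auto simp: up_mono_brauer\<close>)

lemma L_summand_basis:
  assumes d: "\<delta> \<in> carrier R" and h: "h \<in> up_mono s p" and g: "g \<in> brauer p p"
  shows "brauer_mult R \<delta> p s p (basis R h) (proj_down R (brauer_mult R \<delta> p p s (basis R (flip h)) (basis R g))) = L_term R \<delta> g h"
proof -
  note hb = up_mono_brauer[OF h]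
  note fb = flip_brauer[OF hb]
  note fg = brauer_comp[OF fb g]
  have pw: "\<delta> [^] loops (flip h) g \<in> carrier R" using d by simp
  have e: "brauer_mult R \<delta> p p s (basis R (flip h)) (basis R g) = scale R (\<delta> [^] loops (flip h) g) (basis R (flip h \<bullet>\<^sub>B g))"
    unfolding brauer_mult_basis[OF d fb g] diagram_mult_def ..
  have uh: "upward h" using h by (simp add: up_mono_def)
  note lr = lin_brauer_mult_right[OF d free_basis[OF hb], of p]
  show ?thesis
  proof (cases "downward (flip h \<bullet>\<^sub>B g)")
    case True
    then show ?thesis
      unfolding e proj_down_scale_basis[OF pw] L_term_def
      by (simp add: lin_scale[OF lr pw free_basis[OF fg]] brauer_mult_basis[OF d hb fg] diagram_mult_def
          loops_upward[OF hb uh fg] scale_one[OF free_basis[OF brauer_comp[OF hb fg]]])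
  next
    case False
    then show ?thesis
      unfolding e proj_down_scale_basis[OF pw] L_term_def by (simp add: lin_zero[OF lr])
  qed
qed

lemma L_term_closed:
  assumes d: "\<delta> \<in> carrier R" and h: "h \<in> all_up p" and g: "g \<in> brauer p p"
  shows "L_term R \<delta> g h \<in> free_carrier R (brauer p p)"
proof -
  obtain s where s: "h \<in> up_mono s p" using h all_upE by blast
  note hb = up_mono_brauer[OF s]
  show ?thesis
    unfolding L_term_def
    using d free_zero[of "brauer p p"] free_scale[OF _ free_basis[OF brauer_comp[OF hb brauer_comp[OF flip_brauer[OF hb] g]]]] by simp
qed

lemma L_map_lin:
  assumes d: "\<delta> \<in> carrier R"
  shows "lin R (brauer p p) (brauer p p) (L_map R \<delta> p)"
proof -
  have "lin R (brauer p p) (brauer p p) (\<lambda>g. L_map R \<delta> p g)"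
    unfolding L_map_def matrix_brauer_algebra_eq
    by (intro lin_sum finite_preceq finite_up_mono) (rule L_summand_lin[OF d])
  then show ?thesis by simp
qed

lemma L_map_basis:
  assumes d: "\<delta> \<in> carrier R" and g: "g \<in> brauer p p"
  shows "L_map R \<delta> p (basis R g) = finsum (free_algebra R (brauer p p) m e) (L_term R \<delta> g) (all_up p)"
proof
  fix z
  let ?M = "matrix_brauer_algebra R p"
  let ?t = "\<lambda>s h. brauer_mult R \<delta> p s p (basis R h) (proj_down R (brauer_mult R \<delta> p p s (basis R (flip h)) (basis R g)))"
  have cl: "L_term R \<delta> g \<in> all_up p \<rightarrow> free_carrier R (brauer p p)" using L_term_closed[OF d _ g] by blast
  have cl1: "(\<lambda>h. ?t s h) \<in> up_mono s p \<rightarrow> free_carrier R (brauer p p)" for s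
    using lin_closed[OF L_summand_lin[OF d] free_basis[OF g]] by blast
  have in1: "finsum ?M (\<lambda>h. ?t s h) (up_mono s p) z = (\<Oplus>h\<in>up_mono s p. L_term R \<delta> g h z)" for s
    unfolding matrix_brauer_algebra_eq finsum_free[OF cl1]
    by (rule finsum_cong') (auto simp: L_summand_basis[OF d _ g] free_carrierD[OF L_term_closed[OF d all_up_mem g]])
  have cl2: "(\<lambda>s. finsum ?M (\<lambda>h. ?t s h) (up_mono s p)) \<in> {s. s \<preceq> p} \<rightarrow> free_carrier R (brauer p p)"
    unfolding matrix_brauer_algebra_eq by (intro Pi_I finsum_free_closed cl1)
  have "L_map R \<delta> p (basis R g) z = (\<Oplus>s\<in>{s. s \<preceq> p}. finsum ?M (\<lambda>h. ?t s h) (up_mono s p) z)"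
    unfolding L_map_def using finsum_free[OF cl2, of "matrix_mult R p" "matrix_one R p" z]
    unfolding matrix_brauer_algebra_eq .
  also have "\<dots> = (\<Oplus>s\<in>{s. s \<preceq> p}. \<Oplus>h\<in>up_mono s p. L_term R \<delta> g h z)" unfolding in1 ..
  also have "\<dots> = (\<Oplus>h\<in>all_up p. L_term R \<delta> g h z)"
    by (rule finsum_all_up) (rule free_carrierD[OF L_term_closed[OF d _ g]])
  finally show "L_map R \<delta> p (basis R g) z = finsum (free_algebra R (brauer p p) m e) (L_term R \<delta> g) (all_up p) z"
    by (simp add: finsum_free[OF cl])
qed

lemma L_map_one:
  assumes d: "\<delta> \<in> carrier R"
  shows "L_map R \<delta> p (basis R (id_diagram p)) = matrix_one R p"
proof -
  note id = level_brauer[OF id_level[of p]]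
  have idl: "downward (id_diagram p)" using id_level[of p] by (auto simp: level_diagrams_def level_def)
  let ?M = "free_algebra R (brauer p p) (\<lambda>x y. undefined) undefined"
  have t: "L_term R \<delta> (id_diagram p) h = basis R (h \<bullet>\<^sub>B flip h)" if h: "h \<in> all_up p" for h
  proof -
    obtain s where s: "h \<in> up_mono s p" using h all_upE by blast
    have "downward (flip h)" using flip_up_mono[OF s] by (simp add: down_mono_def)
    then show ?thesis
      unfolding L_term_def comp_id[OF flip_brauer[OF up_mono_brauer[OF s]]] loops_downward[OF id idl flip_brauer[OF up_mono_brauer[OF s]]]
      using scale_one[OF free_basis[OF up_flip_brauer[OF h]]] by simp
  qed
  have "finsum ?M (L_term R \<delta> (id_diagram p)) (all_up p) = finsum ?M (\<lambda>f. basis R (f \<bullet>\<^sub>B flip f)) (all_up p)"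
    by (rule abelian_monoid.finsum_cong'[OF free_algebra_monoid])
      (auto simp: t free_algebra_simps intro!: free_basis up_flip_brauer)
  then show ?thesis
    unfolding L_map_basis[OF d id, where m = "\<lambda>x y. undefined" and e = undefined]
      matrix_one_eq[where m = "\<lambda>x y. undefined" and e = undefined] .
qed

text \<open>Multiplicativity already holds for each \<open>h\<close> separately, before summation: a
  single term of \<open>L f\<close> times all of \<open>L g\<close> is the corresponding term of the
  product.\<close>

lemma L_term_mult:
  assumes d: "\<delta> \<in> carrier R" and f: "f \<in> brauer p p" and g: "g \<in> brauer p p" and h: "h \<in> up_mono s p"
  shows "matrix_ext p (L_term R \<delta> f h) (L_map R \<delta> p (basis R g)) = scale R (\<delta> [^] loops f g) (L_term R \<delta> (f \<bullet>\<^sub>B g) h)"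
proof (cases "downward (flip h \<bullet>\<^sub>B f)")
  case False
  have "\<not> downward (flip h \<bullet>\<^sub>B f \<bullet>\<^sub>B g)"
    using downward_compD[OF brauer_comp[OF flip_brauer[OF up_mono_brauer[OF h]] f] g] False by (auto simp: diagram_comp_assoc)
  moreover have "matrix_ext p (\<lambda>_. \<zero>) (L_map R \<delta> p (basis R g)) = (\<lambda>_. \<zero>)"
    by (rule lin_zero[OF lin_matrix_ext_left[OF lin_closed[OF L_map_lin[OF d] free_basis[OF g]]]])
  ultimately show ?thesis using False d unfolding L_term_def by (simp add: scale_zero)
next
  case True
  let ?X = "brauer p p"
  let ?M = "free_algebra R ?X (\<lambda>x y. undefined) undefined"
  note hb = up_mono_brauer[OF h]
  note fb = flip_brauer[OF hb]
  note hf = brauer_comp[OF fb f]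
  obtain d0 dm where D: "d0 \<in> level_diagrams s" "dm \<in> down_mono p s" "flip h \<bullet>\<^sub>B f = d0 \<bullet>\<^sub>B dm"
    using downward_factor[OF hf True] .
  note dmb = down_mono_brauer[OF D(2)]
  note k0 = flip_down_mono[OF D(2)]
  note hfX = brauer_comp[OF hb hf]
  have cf: "\<delta> [^] n \<in> carrier R" for n :: nat using d by simp
  have Lf: "L_term R \<delta> f h = scale R (\<delta> [^] loops (flip h) f) (basis R (h \<bullet>\<^sub>B d0 \<bullet>\<^sub>B dm))"
    unfolding L_term_def using True by (simp add: D(3))
  have hdX: "h \<bullet>\<^sub>B d0 \<bullet>\<^sub>B dm \<in> ?X" by (rule factor_brauer[OF h D(1,2)])
  have LfX: "L_term R \<delta> f h \<in> free_carrier R ?X" by (rule L_term_closed[OF d all_up_mem[OF h] f])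
  have key: "matrix_ext p (L_term R \<delta> f h) (L_term R \<delta> g k) =
      (if k = flip dm then scale R (\<delta> [^] loops f g) (L_term R \<delta> (f \<bullet>\<^sub>B g) h) else (\<lambda>_. \<zero>))" if k: "k \<in> all_up p" for k
  proof -
    obtain t where t: "k \<in> up_mono t p" using k all_upE by blast
    note kb = up_mono_brauer[OF t]
    note kg = brauer_comp[OF flip_brauer[OF kb] g]
    have dmg: "flip h \<bullet>\<^sub>B f \<bullet>\<^sub>B g = d0 \<bullet>\<^sub>B dm \<bullet>\<^sub>B g"
      using D(3) by (simp flip: diagram_comp_assoc)
    show ?thesis
    proof (cases "downward (flip k \<bullet>\<^sub>B g)")
      case False
      have "L_term R \<delta> g k = (\<lambda>_. \<zero>)" using False by (simp add: L_term_def)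
      then have lhs: "matrix_ext p (L_term R \<delta> f h) (L_term R \<delta> g k) = (\<lambda>_. \<zero>)"
        using lin_zero[OF lin_matrix_ext_right[OF LfX]] by simp
      \<comment> \<open>If this \<open>k\<close> is the one that matters, the right side vanishes
        too, because the level \<open>d0\<close> only permutes bottom points and leaves
        \<open>dm \<bullet>\<^sub>B g\<close> not downward.\<close>
      have "scale R (\<delta> [^] loops f g) (L_term R \<delta> (f \<bullet>\<^sub>B g) h) = (\<lambda>_. \<zero>)" if "k = flip dm"
      proof -
        have "\<not> downward (flip h \<bullet>\<^sub>B f \<bullet>\<^sub>B g)"
          unfolding dmg using downward_level_comp[OF D(1) brauer_comp[OF dmb g]] False that by (simp add: flip_flip)
        then show ?thesis by (simp add: L_term_def scale_zero cf)
      qed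
      then show ?thesis using lhs by simp
    next
      case Tk: True
      obtain e0 em where E: "e0 \<in> level_diagrams t" "em \<in> down_mono p t" "flip k \<bullet>\<^sub>B g = e0 \<bullet>\<^sub>B em"
        using downward_factor[OF kg Tk] .
      have keX: "k \<bullet>\<^sub>B e0 \<bullet>\<^sub>B em \<in> ?X" by (rule factor_brauer[OF t E(1,2)])
      have Lg: "L_term R \<delta> g k = scale R (\<delta> [^] loops (flip k) g) (basis R (k \<bullet>\<^sub>B e0 \<bullet>\<^sub>B em))"
        unfolding L_term_def using Tk by (simp add: E(3))
      have lhs: "matrix_ext p (L_term R \<delta> f h) (L_term R \<delta> g k) =
          scale R (\<delta> [^] loops (flip h) f) (scale R (\<delta> [^] loops (flip k) g)
            (if flip dm = k then basis R (h \<bullet>\<^sub>B (d0 \<bullet>\<^sub>B e0) \<bullet>\<^sub>B em) else (\<lambda>_. \<zero>)))"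
        unfolding Lf Lg
        by (simp only: lin_scale[OF lin_matrix_ext_left[OF free_scale[OF cf free_basis[OF keX]]] cf free_basis[OF hdX]]
            lin_scale[OF lin_matrix_ext_right[OF free_basis[OF hdX]] cf free_basis[OF keX]]
            matrix_ext_basis[OF hdX keX] matrix_mult_eq[OF h D(1,2) t E(1,2)])
      show ?thesis
      proof (cases "k = flip dm")
        case False
        then show ?thesis unfolding lhs by (auto simp: scale_zero cf)
      next
        case kd: True
        then have fk: "flip k = dm" by (simp add: flip_flip)
        have fin: "finite (\<Union>f)" "finite (\<Union>g)" "finite (\<Union>(flip h))" "finite (\<Union>d0)" "finite (\<Union>dm)"
          using brauer_Union[OF f] brauer_Union[OF g] brauer_Union[OF fb] brauer_Union[OF level_brauer[OF D(1)]] brauer_Union[OF dmb]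
            finite_points by simp_all
        have lev: "upward d0" "downward dm" using D(1,2) by (auto simp: level_diagrams_def level_def down_mono_def)
        \<comment> \<open>\<open>d0\<close> is upward and closes no loop with anything above it, so
          it drops out of the count. The second use of \<open>loops_assoc\<close>, on
          \<open>flip h\<close>, \<open>f\<close>, \<open>g\<close>, then matches the exponents of
          \<open>\<delta>\<close>.\<close>
        have "loops d0 dm + loops (d0 \<bullet>\<^sub>B dm) g = loops dm g + loops d0 (dm \<bullet>\<^sub>B g)"
          by (rule loops_assoc) (use fin in auto)
        then have l1: "loops (d0 \<bullet>\<^sub>B dm) g = loops dm g"
          using loops_upward[OF level_brauer[OF D(1)] lev(1) dmb] loops_upward[OF level_brauer[OF D(1)] lev(1) brauer_comp[OF dmb g]] by simp
        have "loops (flip h) f + loops (flip h \<bullet>\<^sub>B f) g = loops f g + loops (flip h) (f \<bullet>\<^sub>B g)"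
          by (rule loops_assoc) (use fin in auto)
        then have l2: "loops (flip h) f + loops dm g = loops f g + loops (flip h) (f \<bullet>\<^sub>B g)"
          using l1 by (simp add: D(3))
        have dw: "downward (flip h \<bullet>\<^sub>B f \<bullet>\<^sub>B g)"
          unfolding dmg using downward_level_comp[OF D(1) brauer_comp[OF dmb g]] Tk fk by simp
        have eq: "h \<bullet>\<^sub>B (d0 \<bullet>\<^sub>B e0) \<bullet>\<^sub>B em = h \<bullet>\<^sub>B flip h \<bullet>\<^sub>B f \<bullet>\<^sub>B g"
          unfolding dmg using E(3) fk by (simp add: diagram_comp_assoc)
        have X: "h \<bullet>\<^sub>B flip h \<bullet>\<^sub>B f \<bullet>\<^sub>B g \<in> ?X"
          using brauer_comp[OF hb brauer_comp[OF fb brauer_comp[OF f g]]] .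
        have "matrix_ext p (L_term R \<delta> f h) (L_term R \<delta> g k) =
            scale R (\<delta> [^] (loops (flip h) f + loops dm g)) (basis R (h \<bullet>\<^sub>B flip h \<bullet>\<^sub>B f \<bullet>\<^sub>B g))"
          unfolding lhs fk eq using kd d
          by (simp add: scale_scale[OF _ _ free_basis[OF X]] nat_pow_mult)
        also have "\<dots> = scale R (\<delta> [^] loops f g) (L_term R \<delta> (f \<bullet>\<^sub>B g) h)"
          unfolding l2 L_term_def using dw d
          by (simp add: scale_scale[OF _ _ free_basis[OF X]] nat_pow_mult)
        finally show ?thesis using kd by simp
      qed
    qed
  qed
  have cl: "L_term R \<delta> g \<in> all_up p \<rightarrow> free_carrier R ?X" using L_term_closed[OF d _ g] by blast
  have "matrix_ext p (L_term R \<delta> f h) (L_map R \<delta> p (basis R g)) =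
      finsum ?M (\<lambda>k. matrix_ext p (L_term R \<delta> f h) (L_term R \<delta> g k)) (all_up p)"
    unfolding L_map_basis[OF d g, where m = "\<lambda>x y. undefined" and e = undefined]
    by (rule lin_finsum[OF lin_matrix_ext_right[OF LfX] cl])
  also have "\<dots> = matrix_ext p (L_term R \<delta> f h) (L_term R \<delta> g (flip dm))"
    by (rule free_finsum_single[OF finite_all_up all_up_mem[OF k0]])
      (simp_all add: key all_up_mem[OF k0] free_scale[OF cf] L_term_closed[OF d all_up_mem[OF h] brauer_comp[OF f g]])
  also have "\<dots> = scale R (\<delta> [^] loops f g) (L_term R \<delta> (f \<bullet>\<^sub>B g) h)" by (simp add: key all_up_mem[OF k0])
  finally show ?thesis .
qed

lemma L_map_mult:
  assumes d: "\<delta> \<in> carrier R" and u: "u \<in> free_carrier R (brauer p p)" and v: "v \<in> free_carrier R (brauer p p)"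
  shows "L_map R \<delta> p (brauer_mult R \<delta> p p p u v) = matrix_ext p (L_map R \<delta> p u) (L_map R \<delta> p v)"
proof -
  let ?X = "brauer p p" and ?L = "L_map R \<delta> p"
  let ?M = "free_algebra R ?X (\<lambda>x y. undefined) undefined"
  note L = L_map_lin[OF d, of p]
  note Lc = lin_closed[OF L]
  show ?thesis
  proof (rule lin_ext[OF lin_comp[OF lin_brauer_mult_left[OF d v] L] lin_comp[OF L lin_matrix_ext_left[OF Lc[OF v]]] finite_brauer _ u])
    fix f assume f: "f \<in> ?X"
    show "?L (brauer_mult R \<delta> p p p (basis R f) v) = matrix_ext p (?L (basis R f)) (?L v)"
    proof (rule lin_ext[OF lin_comp[OF lin_brauer_mult_right[OF d free_basis[OF f]] L]
          lin_comp[OF L lin_matrix_ext_right[OF Lc[OF free_basis[OF f]]]] finite_brauer _ v])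
      fix g assume g: "g \<in> ?X"
      note fg = brauer_comp[OF f g]
      have cf: "\<delta> [^] loops f g \<in> carrier R" using d by simp
      have cl: "L_term R \<delta> x \<in> all_up p \<rightarrow> free_carrier R ?X" if "x \<in> ?X" for x using L_term_closed[OF d _ that] by blast
      have "?L (brauer_mult R \<delta> p p p (basis R f) (basis R g)) = scale R (\<delta> [^] loops f g) (?L (basis R (f \<bullet>\<^sub>B g)))"
        unfolding brauer_mult_basis[OF d f g] diagram_mult_def by (rule lin_scale[OF L cf free_basis[OF fg]])
      also have "\<dots> = finsum ?M (\<lambda>h. scale R (\<delta> [^] loops f g) (L_term R \<delta> (f \<bullet>\<^sub>B g) h)) (all_up p)"
        unfolding L_map_basis[OF d fg, where m = "\<lambda>x y. undefined" and e = undefined]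
        by (rule lin_finsum[OF lin_scale_map[OF cf] cl[OF fg]])
      also have "\<dots> = finsum ?M (\<lambda>h. matrix_ext p (L_term R \<delta> f h) (?L (basis R g))) (all_up p)"
      proof (rule abelian_monoid.finsum_cong'[OF free_algebra_monoid refl])
        show "(\<lambda>h. matrix_ext p (L_term R \<delta> f h) (?L (basis R g))) \<in> all_up p \<rightarrow> carrier ?M"
          unfolding free_algebra_simps
          using lin_closed[OF lin_matrix_ext_left[OF Lc[OF free_basis[OF g]]] L_term_closed[OF d _ f]] by blast
        show "scale R (\<delta> [^] loops f g) (L_term R \<delta> (f \<bullet>\<^sub>B g) h) = matrix_ext p (L_term R \<delta> f h) (?L (basis R g))"
          if "h \<in> all_up p" for h
          using that L_term_mult[OF d f g] by (metis all_upE)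
      qed
      also have "\<dots> = matrix_ext p (?L (basis R f)) (?L (basis R g))"
        unfolding L_map_basis[OF d f, where m = "\<lambda>x y. undefined" and e = undefined]
        by (rule lin_finsum[OF lin_matrix_ext_left[OF Lc[OF free_basis[OF g]]] cl[OF f], symmetric])
      finally show "?L (brauer_mult R \<delta> p p p (basis R f) (basis R g)) = matrix_ext p (?L (basis R f)) (?L (basis R g))" .
    qed
  qed
qed

end

section \<open>Bijectivity of L\<close>

lemma gram_index:
  shows distinct_gram_index: "distinct (gram_index s q)"
    and set_gram_index: "set (gram_index s q) = up_mono s q \<times> carrier (sym_group s)"
proof -
  have "finite {\<sigma>. \<sigma> permutes {1..s}}" by (rule finite_permutations) simp
  then have "finite (carrier (sym_group s))" by (simp only: sym_group_def partial_object.simps)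
  then have "\<exists>xs. distinct xs \<and> set xs = up_mono s q \<times> carrier (sym_group s)"
    using finite_distinct_list[of "up_mono s q \<times> carrier (sym_group s)"] finite_up_mono by auto
  from someI_ex[OF this] show "distinct (gram_index s q)" "set (gram_index s q) = up_mono s q \<times> carrier (sym_group s)"
    unfolding gram_index_def by blast+
qed

text \<open>The matrix inside \<open>gram_poly\<close>, named so that its adjugate can be used as
  well as its determinant.\<close>

definition gram_mat :: "nat \<Rightarrow> nat \<Rightarrow> int poly mat" where
  "gram_mat s q = mat (length (gram_index s q)) (length (gram_index s q))
     (\<lambda>(i, j). gram_entry_regular s (gram_index s q ! i) (gram_index s q ! j))"

lemma det_gram_mat: "det (gram_mat s q) = gram_poly s q"
  by (simp add: gram_mat_def gram_poly_def Let_def)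

lemma sym_carrier: "\<sigma> \<in> carrier (sym_group r) \<longleftrightarrow> \<sigma> permutes {1..r}"
  by (rule sym_group_carrier)

lemma finite_sym: "finite (carrier (sym_group r))"
proof -
  have "finite {\<sigma>. \<sigma> permutes {1..r}}" by (rule finite_permutations) simp
  then show ?thesis by (simp only: sym_group_def partial_object.simps)
qed

lemma (in cring) group_mult_closed:
  assumes "\<sigma> \<in> carrier (sym_group r)" "\<tau> \<in> carrier (sym_group r)"
  shows "basis R (\<sigma> \<otimes>\<^bsub>sym_group r\<^esub> \<tau>) \<in> free_carrier R (carrier (sym_group r))"
  by (rule free_basis) (rule monoid.m_closed[OF group.is_monoid[OF sym_group_is_group] assms])

lemma (in cring) group_algebra_mult_eq:
  "monoid.mult (group_algebra R G) = bilinear_ext R (carrier G) (carrier G) (\<lambda>x y. basis R (x \<otimes>\<^bsub>G\<^esub> y))"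
  by (simp add: group_algebra_def free_algebra_simps)

text \<open>A level \<open>flip f \<bullet>\<^sub>B g\<close> acts on the regular representation by
  composing permutations, so its matrix has one power of the variable in each column. In this
  diagrammatic form the entries can be compared with the coefficients of L.\<close>

lemma gram_entry_regular_eq:
  assumes f: "f \<in> up_mono r p" and g: "g \<in> up_mono r p" and \<sigma>: "\<sigma> permutes {1..r}" and \<tau>: "\<tau> permutes {1..r}"
  shows "gram_entry_regular r (f, \<sigma>) (g, \<tau>) =
    (if level (flip f \<bullet>\<^sub>B g) \<and> (flip f \<bullet>\<^sub>B g) \<bullet>\<^sub>B perm_diagram r \<tau> = perm_diagram r \<sigma>
     then [:0, 1:] ^ loops (flip f) g else 0)"
proof -
  interpret Z: cring Zx_ring by (rule cring_Zx)
  let ?S = "carrier (sym_group r)"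
  let ?B = "bilinear_ext Zx_ring ?S ?S (\<lambda>x y. basis Zx_ring (x \<otimes>\<^bsub>sym_group r\<^esub> y))"
  have t: "\<tau> \<in> ?S" using \<tau> by (simp only: sym_carrier)
  have lin: "lin Zx_ring ?S ?S (\<lambda>v. ?B v (basis Zx_ring \<tau>))"
    by (rule Z.lin_bilinear_left[OF Z.group_mult_closed Z.free_basis[OF t]])
  have e: "gram_entry_regular r (f, \<sigma>) (g, \<tau>) = ?B (gram_entry r f g) (basis Zx_ring \<tau>) \<sigma>"
    by (simp add: gram_entry_regular_def Z.group_algebra_mult_eq)
  show ?thesis
  proof (cases "level (flip f \<bullet>\<^sub>B g)")
    case False
    have z: "?B (\<lambda>_. 0) (basis Zx_ring \<tau>) = (\<lambda>_. 0)" using Z.lin_zero[OF lin] by (simp add: Zx_ring_simps)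
    show ?thesis unfolding e gram_entry_def using False z by simp
  next
    case True
    have "flip f \<bullet>\<^sub>B g \<in> level_diagrams r"
      using brauer_comp[OF flip_brauer[OF up_mono_brauer[OF f]] up_mono_brauer[OF g]] True by (simp add: level_diagrams_def)
    then obtain \<rho> where \<rho>: "\<rho> permutes {1..r}" "flip f \<bullet>\<^sub>B g = perm_diagram r \<rho>" using level_iff_perm by blast
    have rS: "\<rho> \<in> ?S" using \<rho>(1) by (simp only: sym_carrier)
    let ?c = "[:0, 1:] ^ loops (flip f) g :: int poly"
    have ge: "gram_entry r f g = scale Zx_ring ?c (basis Zx_ring \<rho>)"
      unfolding gram_entry_def using True \<rho> by (simp add: diagram_perm_perm_diagram)
    have "?B (gram_entry r f g) (basis Zx_ring \<tau>) = scale Zx_ring ?c (?B (basis Zx_ring \<rho>) (basis Zx_ring \<tau>))"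
      unfolding ge by (rule lin_scale[OF lin _ Z.free_basis[OF rS]]) (simp add: Zx_ring_simps)
    also have "?B (basis Zx_ring \<rho>) (basis Zx_ring \<tau>) = basis Zx_ring (\<rho> \<otimes>\<^bsub>sym_group r\<^esub> \<tau>)"
      by (rule Z.bilinear_basis[where m = "\<lambda>x y. basis Zx_ring (x \<otimes>\<^bsub>sym_group r\<^esub> y)", OF finite_sym finite_sym Z.group_mult_closed rS t])
    finally have B: "?B (gram_entry r f g) (basis Zx_ring \<tau>) = scale Zx_ring ?c (basis Zx_ring (\<rho> \<otimes>\<^bsub>sym_group r\<^esub> \<tau>))" .
    have "gram_entry_regular r (f, \<sigma>) (g, \<tau>) = ?c * (if \<sigma> = \<rho> \<circ> \<tau> then 1 else 0)"
      unfolding e B by (simp add: scale_def basis_def Zx_ring_simps sym_group_mult)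
    moreover have "(flip f \<bullet>\<^sub>B g) \<bullet>\<^sub>B perm_diagram r \<tau> = perm_diagram r \<sigma> \<longleftrightarrow> \<sigma> = \<rho> \<circ> \<tau>"
      unfolding \<rho>(2) perm_diagram_comp[OF \<rho>(1) \<tau>]
      using perm_diagram_inject[OF permutes_compose[OF \<tau> \<rho>(1)] \<sigma>] by auto
    ultimately show ?thesis using True by simp
  qed
qed

text \<open>Only the upward factor \<open>a'\<close> interacts with \<open>flip a\<close>: the rest
  is downward, and \<open>a'\<close> is upward, so no loop closes between these two or between the
  rest and \<open>flip a \<bullet>\<^sub>B a'\<close>. What remains of \<open>loops_assoc\<close> is
  the claim.\<close>

lemma flip_comp_factor:
  assumes a: "a \<in> up_mono s p" and x: "a' \<in> up_mono r p" "b' \<in> level_diagrams r" "c' \<in> down_mono p r"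
  shows "loops (flip a) (a' \<bullet>\<^sub>B b' \<bullet>\<^sub>B c') = loops (flip a) a'"
    and "downward (flip a \<bullet>\<^sub>B a' \<bullet>\<^sub>B b' \<bullet>\<^sub>B c') \<Longrightarrow> downward (flip a \<bullet>\<^sub>B a')"
proof -
  note ab = flip_brauer[OF up_mono_brauer[OF a]]
  note a'b = up_mono_brauer[OF x(1)] and b'b = level_brauer[OF x(2)] and c'b = down_mono_brauer[OF x(3)]
  note bc = brauer_comp[OF b'b c'b]
  have fin: "finite (\<Union>(flip a))" "finite (\<Union>a')" "finite (\<Union>(b' \<bullet>\<^sub>B c'))"
    using brauer_Union[OF ab] brauer_Union[OF a'b] brauer_Union[OF bc] finite_points by simp_all
  have up: "upward a'" using x(1) by (simp add: up_mono_def)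
  have dw: "downward (b' \<bullet>\<^sub>B c')"
    using downward_level_comp[OF x(2) c'b] x(3) by (simp add: down_mono_def)
  show "loops (flip a) (a' \<bullet>\<^sub>B b' \<bullet>\<^sub>B c') = loops (flip a) a'"
    using loops_assoc[OF fin] loops_upward[OF a'b up bc] loops_downward[OF bc dw brauer_comp[OF ab a'b]] by simp
  show "downward (flip a \<bullet>\<^sub>B a' \<bullet>\<^sub>B b' \<bullet>\<^sub>B c') \<Longrightarrow> downward (flip a \<bullet>\<^sub>B a')"
    using downward_compD[OF brauer_comp[OF ab a'b] bc] by (simp add: diagram_comp_assoc)
qed

text \<open>\<open>flip a \<bullet>\<^sub>B a'\<close> has to be downward, and it has equally many
  top and bottom points, hence is level. Composing with \<open>a\<close> then yields two
  factorizations of one diagram. The condition \<open>c' = c\<close> makes the diagonal part block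
  diagonal.\<close>

lemma flip_comp_eq_iff:
  assumes a: "a \<in> up_mono r p" "b \<in> level_diagrams r" "c \<in> down_mono p r"
    and x: "a' \<in> up_mono r p" "b' \<in> level_diagrams r" "c' \<in> down_mono p r"
  shows "flip a \<bullet>\<^sub>B a' \<bullet>\<^sub>B b' \<bullet>\<^sub>B c' = b \<bullet>\<^sub>B c \<longleftrightarrow>
    level (flip a \<bullet>\<^sub>B a') \<and> (flip a \<bullet>\<^sub>B a') \<bullet>\<^sub>B b' = b \<and> c' = c"
proof
  assume eq: "flip a \<bullet>\<^sub>B a' \<bullet>\<^sub>B b' \<bullet>\<^sub>B c' = b \<bullet>\<^sub>B c"
  have "downward (b \<bullet>\<^sub>B c)"
    using downward_level_comp[OF a(2) down_mono_brauer[OF a(3)]] a(3) by (simp add: down_mono_def)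
  then have "downward (flip a \<bullet>\<^sub>B a')" using flip_comp_factor(2)[OF a(1) x] eq by simp
  moreover note B = brauer_comp[OF flip_brauer[OF up_mono_brauer[OF a(1)]] up_mono_brauer[OF x(1)]]
  ultimately have l: "level (flip a \<bullet>\<^sub>B a')" using downward_rank(2) by blast
  then have "(flip a \<bullet>\<^sub>B a') \<bullet>\<^sub>B b' \<in> level_diagrams r" using level_comp[OF _ x(2)] B by (simp add: level_diagrams_def)
  moreover have "a \<bullet>\<^sub>B ((flip a \<bullet>\<^sub>B a') \<bullet>\<^sub>B b') \<bullet>\<^sub>B c' = a \<bullet>\<^sub>B b \<bullet>\<^sub>B c" using eq by (simp add: diagram_comp_assoc)
  ultimately show "level (flip a \<bullet>\<^sub>B a') \<and> (flip a \<bullet>\<^sub>B a') \<bullet>\<^sub>B b' = b \<and> c' = c"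
    using factorization_unique[OF a(1) a(1) _ a(2) x(3) a(3)] l by blast
next
  assume "level (flip a \<bullet>\<^sub>B a') \<and> (flip a \<bullet>\<^sub>B a') \<bullet>\<^sub>B b' = b \<and> c' = c"
  then show "flip a \<bullet>\<^sub>B a' \<bullet>\<^sub>B b' \<bullet>\<^sub>B c' = b \<bullet>\<^sub>B c" by (auto simp: diagram_comp_assoc)
qed

section \<open>Coefficients of L and its bijectivity\<close>

context cring
begin

text \<open>A nonzero term of \<open>h\<close> is a multiple of one basis diagram whose upward
  factor is \<open>h\<close>, so uniqueness of the factorization leaves only
  \<open>h = a\<close>.\<close>

lemma L_map_coeff:
  assumes d: "\<delta> \<in> carrier R" and x: "x \<in> brauer p p"
    and a: "a \<in> up_mono s p" "b \<in> level_diagrams s" "c \<in> down_mono p s"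
  shows "L_map R \<delta> p (basis R x) (a \<bullet>\<^sub>B b \<bullet>\<^sub>B c) = (if flip a \<bullet>\<^sub>B x = b \<bullet>\<^sub>B c then \<delta> [^] loops (flip a) x else \<zero>)"
proof -
  let ?z = "a \<bullet>\<^sub>B b \<bullet>\<^sub>B c"
  have cl: "L_term R \<delta> x \<in> all_up p \<rightarrow> free_carrier R (brauer p p)" using L_term_closed[OF d _ x] by blast
  have bc: "downward (b \<bullet>\<^sub>B c)"
    using downward_level_comp[OF a(2) down_mono_brauer[OF a(3)]] a(3) by (simp add: down_mono_def)
  have val: "L_term R \<delta> x h ?z = (if h = a \<and> flip a \<bullet>\<^sub>B x = b \<bullet>\<^sub>B c then \<delta> [^] loops (flip a) x else \<zero>)" if h: "h \<in> all_up p" for h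
  proof -
    obtain t where t: "h \<in> up_mono t p" using h all_upE by blast
    show ?thesis
    proof (cases "downward (flip h \<bullet>\<^sub>B x)")
      case False
      then show ?thesis unfolding L_term_def using bc by auto
    next
      case True
      obtain d0 dm where D: "d0 \<in> level_diagrams t" "dm \<in> down_mono p t" "flip h \<bullet>\<^sub>B x = d0 \<bullet>\<^sub>B dm"
        using downward_factor[OF brauer_comp[OF flip_brauer[OF up_mono_brauer[OF t]] x] True] .
      have "?z = h \<bullet>\<^sub>B flip h \<bullet>\<^sub>B x \<longleftrightarrow> h = a \<and> flip a \<bullet>\<^sub>B x = b \<bullet>\<^sub>B c"
        using factorization_unique[OF a(1) t a(2) D(1) a(3) D(2)] D(3) by auto
      then show ?thesis unfolding L_term_def using True d by (auto simp: scale_def basis_def)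
    qed
  qed
  have "L_map R \<delta> p (basis R x) ?z = (\<Oplus>h\<in>all_up p. L_term R \<delta> x h ?z)"
    unfolding L_map_basis[OF d x, where m = "\<lambda>x y. undefined" and e = undefined] by (rule finsum_free[OF cl])
  also have "\<dots> = L_term R \<delta> x a ?z"
    by (rule finsum_eq_single[OF finite_all_up all_up_mem[OF a(1)]])
      (use d in \<open>auto simp: val all_up_mem[OF a(1)]\<close>)
  also have "\<dots> = (if flip a \<bullet>\<^sub>B x = b \<bullet>\<^sub>B c then \<delta> [^] loops (flip a) x else \<zero>)"
    by (simp add: val all_up_mem[OF a(1)])
  finally show ?thesis .
qed

lemma L_map_bij:
  assumes d: "\<delta> \<in> carrier R" and ns: "non_singular R \<delta> p"
  shows "bij_betw (L_map R \<delta> p) (free_carrier R (brauer p p)) (free_carrier R (brauer p p))"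
proof -
  let ?X = "brauer p p" and ?L = "L_map R \<delta> p" and ?ev = "eval_int_poly R \<delta>"
  define K where "K z x = ?L (basis R x) z" for z x
  define rk where "rk x = fst (factorization p p x)" for x
  \<comment> \<open>Within one rank a block is given by the monotone downward factor. The other two
    factors form the key, which has exactly the shape of a row index of the Gram matrix;
    \<open>idx\<close> is its position in the chosen enumeration.\<close>
  define block where "block x = (case factorization p p x of (r, a, b, c) \<Rightarrow> (r, c))" for x
  define key where "key x = (case factorization p p x of (r, a, b, c) \<Rightarrow> (a, diagram_perm r b))" for x
  define num where "num rc = length (gram_index (fst rc) p)" for rc :: "nat \<times> diagram"
  define idx where "idx x = inv_into {..<num (block x)} ((!) (gram_index (rk x) p)) (key x)" for x
  define A where "A rc = gram_mat (fst rc) p" for rc :: "nat \<times> diagram"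
  have fac: "rk (a \<bullet>\<^sub>B b \<bullet>\<^sub>B c) = r" "block (a \<bullet>\<^sub>B b \<bullet>\<^sub>B c) = (r, c)" "key (a \<bullet>\<^sub>B b \<bullet>\<^sub>B c) = (a, diagram_perm r b)"
    if "a \<in> up_mono r p" "b \<in> level_diagrams r" "c \<in> down_mono p r" for r a b c
    using factorization_eq[OF that] by (simp_all add: rk_def block_def key_def)
  have enum: "bij_betw ((!) (gram_index r p)) {..<length (gram_index r p)} (up_mono r p \<times> carrier (sym_group r))" for r
    by (rule bij_betw_nth[OF distinct_gram_index refl set_gram_index[symmetric]])
  have keymem: "key x \<in> up_mono (rk x) p \<times> carrier (sym_group (rk x))" and fstb: "fst (block x) = rk x" if "x \<in> ?X" for x
  proof -
    obtain r a b c where X: "a \<in> up_mono r p" "b \<in> level_diagrams r" "c \<in> down_mono p r" "x = a \<bullet>\<^sub>B b \<bullet>\<^sub>B c"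
      using factorization_exists[OF \<open>x \<in> ?X\<close>] .
    obtain \<sigma> where "\<sigma> permutes {1..r}" "b = perm_diagram r \<sigma>" using X(2) level_iff_perm by blast
    then have "diagram_perm r b \<in> carrier (sym_group r)" by (simp only: diagram_perm_perm_diagram sym_carrier)
    then show "key x \<in> up_mono (rk x) p \<times> carrier (sym_group (rk x))" "fst (block x) = rk x"
      using fac[OF X(1-3)] X by simp_all
  qed
  have idx: "idx x < num (block x)" "gram_index (rk x) p ! idx x = key x" if "x \<in> ?X" for x
    using bij_betwE[OF bij_betw_inv_into[OF enum]] bij_betw_inv_into_right[OF enum] keymem[OF that] fstb[OF that]
    unfolding idx_def num_def by auto
  have rkp: "rk x \<preceq> p" if "x \<in> ?X" for x
    using keymem[OF that] up_mono_preceq by auto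
  have entry: "K y x = (if block y = block x then ?ev (A (block x) $$ (idx y, idx x)) else \<zero>)"
    if y: "y \<in> ?X" and x: "x \<in> ?X" and rk: "rk y = rk x" for y x
  proof -
    obtain r a b c where Y: "a \<in> up_mono r p" "b \<in> level_diagrams r" "c \<in> down_mono p r" "y = a \<bullet>\<^sub>B b \<bullet>\<^sub>B c"
      using factorization_exists[OF y] .
    obtain r' a' b' c' where X': "a' \<in> up_mono r' p" "b' \<in> level_diagrams r'" "c' \<in> down_mono p r'" "x = a' \<bullet>\<^sub>B b' \<bullet>\<^sub>B c'"
      using factorization_exists[OF x] .
    have r: "r' = r" using rk fac(1)[OF Y(1-3)] fac(1)[OF X'(1-3)] Y(4) X'(4) by simp
    note X = X'[unfolded r]
    obtain \<sigma> where \<sigma>: "\<sigma> permutes {1..r}" "b = perm_diagram r \<sigma>" using Y(2) level_iff_perm by blast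
    obtain \<tau> where \<tau>: "\<tau> permutes {1..r}" "b' = perm_diagram r \<tau>" using X(2) level_iff_perm by blast
    \<comment> \<open>The condition splits: \<open>c' = c\<close> says that the blocks agree, the
      rest is the condition for a nonzero Gram entry.\<close>
    have K: "K y x = (if level (flip a \<bullet>\<^sub>B a') \<and> (flip a \<bullet>\<^sub>B a') \<bullet>\<^sub>B b' = b \<and> c' = c then \<delta> [^] loops (flip a) a' else \<zero>)"
      unfolding K_def Y(4) L_map_coeff[OF d x Y(1-3)]
      unfolding X(4) flip_comp_eq_iff[OF Y(1-3) X(1-3)] flip_comp_factor(1)[OF Y(1) X(1-3)] ..
    have blocks: "block y = (r, c)" "block x = (r, c')" using fac(2)[OF Y(1-3)] fac(2)[OF X(1-3)] Y(4) X(4) by simp_all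
    have rks: "rk y = r" "rk x = r" using fac(1)[OF Y(1-3)] fac(1)[OF X(1-3)] Y(4) X(4) by simp_all
    have keys: "key y = (a, \<sigma>)" "key x = (a', \<tau>)"
      using fac(3)[OF Y(1-3)] fac(3)[OF X(1-3)] Y(4) X(4) \<sigma> \<tau> by (simp_all add: diagram_perm_perm_diagram)
    have "A (block x) $$ (idx y, idx x) = gram_entry_regular r (a, \<sigma>) (a', \<tau>)"
      using idx[OF y] idx[OF x] unfolding blocks rks keys num_def A_def gram_mat_def by simp
    also have "?ev \<dots> = (if level (flip a \<bullet>\<^sub>B a') \<and> (flip a \<bullet>\<^sub>B a') \<bullet>\<^sub>B b' = b then \<delta> [^] loops (flip a) a' else \<zero>)"
      unfolding gram_entry_regular_eq[OF Y(1) X(1) \<sigma>(1) \<tau>(1)] \<sigma>(2)[symmetric] \<tau>(2)[symmetric]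
      by (simp add: eval_int_poly_X_power[OF d] eval_int_poly_0)
    finally show ?thesis unfolding K blocks by auto
  qed
  \<comment> \<open>With the downward factor fixed, the upward factor and the permutation can be
    prescribed freely; so every block runs through the whole index list of the Gram matrix.\<close>
  have bij: "bij_betw idx {x \<in> E. block x = block z} {..<num (block z)}" if E: "E = {x \<in> ?X. rk x = n}" and z: "z \<in> E" for E n z
  proof -
    have zX: "z \<in> ?X" "rk z = n" using z E by auto
    obtain r a b c where Z: "a \<in> up_mono r p" "b \<in> level_diagrams r" "c \<in> down_mono p r" "z = a \<bullet>\<^sub>B b \<bullet>\<^sub>B c"
      using factorization_exists[OF zX(1)] .
    have rn: "r = n" and bz: "block z = (r, c)" using fac[OF Z(1-3)] Z(4) zX by simp_all
    let ?B = "{x \<in> E. block x = block z}"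
    have "bij_betw key ?B (up_mono r p \<times> carrier (sym_group r))"
    proof (rule bij_betw_imageI)
      show "inj_on key ?B"
      proof (rule inj_onI)
        fix x y assume xy: "x \<in> ?B" "y \<in> ?B" "key x = key y"
        have "x \<in> ?X" "y \<in> ?X" using xy E by auto
        obtain r1 a1 b1 c1 where X: "a1 \<in> up_mono r1 p" "b1 \<in> level_diagrams r1" "c1 \<in> down_mono p r1" "x = a1 \<bullet>\<^sub>B b1 \<bullet>\<^sub>B c1"
          using factorization_exists[OF \<open>x \<in> ?X\<close>] .
        obtain r2 a2 b2 c2 where Y: "a2 \<in> up_mono r2 p" "b2 \<in> level_diagrams r2" "c2 \<in> down_mono p r2" "y = a2 \<bullet>\<^sub>B b2 \<bullet>\<^sub>B c2"
          using factorization_exists[OF \<open>y \<in> ?X\<close>] .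
        have eqs: "r1 = r" "c1 = c" "r2 = r" "c2 = c" "a1 = a2" "diagram_perm r1 b1 = diagram_perm r2 b2"
          using fac[OF X(1-3)] fac[OF Y(1-3)] X(4) Y(4) xy bz by simp_all
        obtain \<sigma> where "\<sigma> permutes {1..r}" "b1 = perm_diagram r \<sigma>" using X(2) eqs level_iff_perm by blast
        moreover obtain \<tau> where "\<tau> permutes {1..r}" "b2 = perm_diagram r \<tau>" using Y(2) eqs level_iff_perm by blast
        ultimately have "b1 = b2" using eqs by (simp add: diagram_perm_perm_diagram)
        then show "x = y" using X(4) Y(4) eqs by simp
      qed
      show "key ` ?B = up_mono r p \<times> carrier (sym_group r)"
      proof (rule subset_antisym; rule subsetI)
        fix k assume "k \<in> key ` ?B"
        then obtain x where "x \<in> ?B" "k = key x" by blast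
        then show "k \<in> up_mono r p \<times> carrier (sym_group r)" using keymem[of x] E rn by auto
      next
        fix k assume k: "k \<in> up_mono r p \<times> carrier (sym_group r)"
        obtain a' \<sigma> where "k = (a', \<sigma>)" by (cases k)
        then have a': "k = (a', \<sigma>)" "a' \<in> up_mono r p" "\<sigma> permutes {1..r}"
          using k by (simp_all only: sym_carrier mem_Times_iff fst_conv snd_conv)
        let ?x = "a' \<bullet>\<^sub>B perm_diagram r \<sigma> \<bullet>\<^sub>B c"
        note pl = perm_diagram_level[OF a'(3)]
        have "?x \<in> ?B" using factor_brauer[OF a'(2) pl Z(3)] fac[OF a'(2) pl Z(3)] E rn bz by simp
        moreover have "key ?x = k" using fac(3)[OF a'(2) pl Z(3)] a' by (simp add: diagram_perm_perm_diagram)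
        ultimately show "k \<in> key ` ?B" by blast
      qed
    qed
    moreover have "bij_betw (inv_into {..<length (gram_index r p)} ((!) (gram_index r p))) (up_mono r p \<times> carrier (sym_group r)) {..<length (gram_index r p)}"
      by (rule bij_betw_inv_into[OF enum])
    ultimately have "bij_betw (inv_into {..<length (gram_index r p)} ((!) (gram_index r p)) \<circ> key) ?B {..<length (gram_index r p)}"
      by (rule bij_betw_trans)
    moreover have "num (block z) = length (gram_index r p)" by (simp add: num_def bz)
    moreover have "idx x = (inv_into {..<length (gram_index r p)} ((!) (gram_index r p)) \<circ> key) x" if "x \<in> ?B" for x
      using that E rn bz by (simp add: idx_def num_def)
    ultimately show ?thesis
      using bij_betw_cong[of ?B idx "inv_into {..<length (gram_index r p)} ((!) (gram_index r p)) \<circ> key"] by simp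
  qed
  define J where "J z y = (if block z = block y
    then inv (?ev (det (A (block z)))) \<otimes> ?ev (adj_mat (A (block z)) $$ (idx z, idx y)) else \<zero>)" for z y
  have inverse: "(\<Oplus>y\<in>{y \<in> ?X. rk y = rk z}. J z y \<otimes> K y x) = (if z = x then \<one> else \<zero>)"
      "(\<Oplus>y\<in>{y \<in> ?X. rk y = rk z}. K z y \<otimes> J y x) = (if z = x then \<one> else \<zero>)"
      "J z x \<in> carrier R"
    if z: "z \<in> ?X" and x: "x \<in> ?X" and rk: "rk z = rk x" for z x
  proof -
    let ?E = "{y \<in> ?X. rk y = rk z}"
    have fin: "finite ?E" using finite_brauer by simp
    have zx: "z \<in> ?E" "x \<in> ?E" using z x rk by simp_all
    have cm: "A (block y) \<in> carrier_mat (num (block y)) (num (block y))" for y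
      by (simp add: A_def num_def gram_mat_def)
    \<comment> \<open>Non-singularity is applied with \<open>q = p\<close> and \<open>s\<close> the
      rank of \<open>y\<close>.\<close>
    have unit: "?ev (det (A (block y))) \<in> Units R" if "y \<in> ?E" for y
    proof -
      have "p \<preceq> p" by (simp add: preceq_def)
      then show ?thesis using ns rkp[of y] fstb[of y] that unfolding non_singular_def A_def det_gram_mat by auto
    qed
    have K: "K y' y = (if block y' = block y then ?ev (A (block y) $$ (idx y', idx y)) else \<zero>)" if "y' \<in> ?E" "y \<in> ?E" for y' y
      using entry[of y' y] that by simp
    note inv = block_inverse[of \<delta> ?E idx block num A K, OF d fin bij[OF refl] cm unit K zx, folded J_def]
    show "(\<Oplus>y\<in>?E. J z y \<otimes> K y x) = (if z = x then \<one> else \<zero>)"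
      "(\<Oplus>y\<in>?E. K z y \<otimes> J y x) = (if z = x then \<one> else \<zero>)" "J z x \<in> carrier R"
      by (rule inv; assumption)+
  qed
  show ?thesis
  proof (rule triangular_bij[OF finite_brauer L_map_lin[OF d], where K = K and rk = rk and J = J])
    show "K z x \<in> carrier R" if "x \<in> ?X" for z x
      unfolding K_def by (rule free_carrierD[OF lin_closed[OF L_map_lin[OF d] free_basis[OF that]]])
    show "?L v z = (\<Oplus>x\<in>?X. v x \<otimes> K z x)" if "v \<in> free_carrier R ?X" for v z
      unfolding K_def by (rule lin_expand[OF L_map_lin[OF d] finite_brauer that])
    show "K z x = \<zero>" if z: "z \<in> ?X" and x: "x \<in> ?X" and rk: "rk x < rk z" for z x
    proof -
      obtain s a b c where Z: "a \<in> up_mono s p" "b \<in> level_diagrams s" "c \<in> down_mono p s" "z = a \<bullet>\<^sub>B b \<bullet>\<^sub>B c"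
        using factorization_exists[OF z] .
      obtain r a' b' c' where X: "a' \<in> up_mono r p" "b' \<in> level_diagrams r" "c' \<in> down_mono p r" "x = a' \<bullet>\<^sub>B b' \<bullet>\<^sub>B c'"
        using factorization_exists[OF x] .
      have "r < s" using rk fac(1)[OF Z(1-3)] fac(1)[OF X(1-3)] Z(4) X(4) by simp
      have "flip a \<bullet>\<^sub>B x \<noteq> b \<bullet>\<^sub>B c"
      proof
        assume eq: "flip a \<bullet>\<^sub>B x = b \<bullet>\<^sub>B c"
        have "downward (b \<bullet>\<^sub>B c)"
          using downward_level_comp[OF Z(2) down_mono_brauer[OF Z(3)]] Z(3) by (simp add: down_mono_def)
        then have "downward (flip a \<bullet>\<^sub>B a')" using flip_comp_factor(2)[OF Z(1) X(1-3)] eq X(4) by simp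
        then have "s \<le> r"
          using downward_rank(1)[OF brauer_comp[OF flip_brauer[OF up_mono_brauer[OF Z(1)]] up_mono_brauer[OF X(1)]]] by simp
        then show False using \<open>r < s\<close> by simp
      qed
      then show ?thesis unfolding K_def Z(4) L_map_coeff[OF d x Z(1-3)] by simp
    qed
  qed (use inverse in blast)+
qed

end

section \<open>The matrix algebras\<close>

text \<open>Covers matrices, as a constant family over pairs of indices, and the direct sum. The
  monoid axioms are what finite sums in the target need before its algebra axioms have been
  transported.\<close>

lemma product_abelian_monoid:
  assumes A: "\<And>i. i \<in> I \<Longrightarrow> abelian_monoid (A i)"
    and M: "carrier M = (\<Pi>\<^sub>E i\<in>I. carrier (A i))" "zero M = (\<lambda>i\<in>I. \<zero>\<^bsub>A i\<^esub>)"
      "add M = (\<lambda>x y. \<lambda>i\<in>I. x i \<oplus>\<^bsub>A i\<^esub> y i)"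
  shows "abelian_monoid M"
proof (rule abelian_monoidI; unfold M)
  note E = abelian_monoidE[OF A]
  show "(\<lambda>i\<in>I. x i \<oplus>\<^bsub>A i\<^esub> y i) \<in> (\<Pi>\<^sub>E i\<in>I. carrier (A i))"
    if "x \<in> (\<Pi>\<^sub>E i\<in>I. carrier (A i))" "y \<in> (\<Pi>\<^sub>E i\<in>I. carrier (A i))" for x y
    using that E(1) by (auto simp: PiE_iff)
  show "(\<lambda>i\<in>I. \<zero>\<^bsub>A i\<^esub>) \<in> (\<Pi>\<^sub>E i\<in>I. carrier (A i))" using E(2) by auto
  show "(\<lambda>i\<in>I. (\<lambda>i\<in>I. x i \<oplus>\<^bsub>A i\<^esub> y i) i \<oplus>\<^bsub>A i\<^esub> z i) = (\<lambda>i\<in>I. x i \<oplus>\<^bsub>A i\<^esub> (\<lambda>i\<in>I. y i \<oplus>\<^bsub>A i\<^esub> z i) i)"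
    if "x \<in> (\<Pi>\<^sub>E i\<in>I. carrier (A i))" "y \<in> (\<Pi>\<^sub>E i\<in>I. carrier (A i))" "z \<in> (\<Pi>\<^sub>E i\<in>I. carrier (A i))" for x y z
    by (rule restrict_ext) (use that E(3) in \<open>simp add: PiE_iff\<close>)
  show "(\<lambda>i\<in>I. (\<lambda>i\<in>I. \<zero>\<^bsub>A i\<^esub>) i \<oplus>\<^bsub>A i\<^esub> x i) = x" if "x \<in> (\<Pi>\<^sub>E i\<in>I. carrier (A i))" for x
  proof -
    have "(\<lambda>i\<in>I. (\<lambda>i\<in>I. \<zero>\<^bsub>A i\<^esub>) i \<oplus>\<^bsub>A i\<^esub> x i) = (\<lambda>i\<in>I. x i)"
      by (rule restrict_ext) (use that E(4) in \<open>simp add: PiE_iff\<close>)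
    then show ?thesis using PiE_restrict[OF that] by simp
  qed
  show "(\<lambda>i\<in>I. x i \<oplus>\<^bsub>A i\<^esub> y i) = (\<lambda>i\<in>I. y i \<oplus>\<^bsub>A i\<^esub> x i)"
    if "x \<in> (\<Pi>\<^sub>E i\<in>I. carrier (A i))" "y \<in> (\<Pi>\<^sub>E i\<in>I. carrier (A i))" for x y
    by (rule restrict_ext) (use that E(5) in \<open>simp add: PiE_iff\<close>)
qed

text \<open>The diagram belonging to \<open>\<sigma>\<close> times the matrix unit at row
  \<open>i\<close> and column \<open>j\<close>. Flipping \<open>j\<close> lets the same upward
  diagrams index rows and columns.\<close>

definition entry_diagram :: "nat \<Rightarrow> diagram \<Rightarrow> (nat \<Rightarrow> nat) \<Rightarrow> diagram \<Rightarrow> diagram" where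
  "entry_diagram r i \<sigma> j = i \<bullet>\<^sub>B perm_diagram r \<sigma> \<bullet>\<^sub>B flip j"

lemma entry_diagram_brauer:
  "i \<in> up_mono r p \<Longrightarrow> j \<in> up_mono r p \<Longrightarrow> \<sigma> permutes {1..r} \<Longrightarrow> entry_diagram r i \<sigma> j \<in> brauer p p"
  unfolding entry_diagram_def by (rule factor_brauer[OF _ perm_diagram_level flip_up_mono])

lemma entry_diagram_inject:
  assumes "i \<in> up_mono r p" "j \<in> up_mono r p" "\<sigma> permutes {1..r}" "i' \<in> up_mono s p" "j' \<in> up_mono s p" "\<tau> permutes {1..s}"
    and "entry_diagram r i \<sigma> j = entry_diagram s i' \<tau> j'"
  shows "r = s \<and> i = i' \<and> \<sigma> = \<tau> \<and> j = j'"
proof -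
  have "r = s \<and> i = i' \<and> perm_diagram r \<sigma> = perm_diagram s \<tau> \<and> flip j = flip j'"
    using assms(7) unfolding entry_diagram_def
    by (rule factorization_unique[OF assms(1,4) perm_diagram_level[OF assms(3)] perm_diagram_level[OF assms(6)]
          flip_up_mono[OF assms(2)] flip_up_mono[OF assms(5)]])
  then show ?thesis using perm_diagram_inject[of \<sigma> r \<tau>] assms(3,6) flip_flip by metis
qed

lemma entry_diagram_cases:
  assumes "x \<in> brauer p p"
  obtains r i \<sigma> j where "i \<in> up_mono r p" "j \<in> up_mono r p" "\<sigma> permutes {1..r}" "x = entry_diagram r i \<sigma> j" "r \<preceq> p"
proof -
  obtain r a b c where X: "a \<in> up_mono r p" "b \<in> level_diagrams r" "c \<in> down_mono p r" "x = a \<bullet>\<^sub>B b \<bullet>\<^sub>B c"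
    using factorization_exists[OF assms] .
  obtain \<sigma> where "\<sigma> permutes {1..r}" "b = perm_diagram r \<sigma>" using X(2) level_iff_perm by blast
  then show thesis
    using that[of a r "flip c" \<sigma>] X flip_down_mono[OF X(3)] up_mono_preceq[OF X(1)] by (simp add: entry_diagram_def flip_flip)
qed

lemma factorization_entry_diagram:
  assumes "i \<in> up_mono r p" "j \<in> up_mono r p" "\<sigma> permutes {1..r}"
  shows "factorization p p (entry_diagram r i \<sigma> j) = (r, i, perm_diagram r \<sigma>, flip j)"
  unfolding entry_diagram_def
  by (rule factorization_eq[OF assms(1) perm_diagram_level[OF assms(3)] flip_up_mono[OF assms(2)]])

section \<open>The product in matrix coordinates\<close>

context cring
begin

text \<open>The rule for products of matrix units whose entries are permutations.\<close>

lemma matrix_mult_entry: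
  assumes i: "i \<in> up_mono r p" "j \<in> up_mono r p" "\<tau> permutes {1..r}"
    and k: "k \<in> up_mono s p" "l \<in> up_mono s p" "\<rho> permutes {1..s}"
  shows "matrix_mult R p (entry_diagram r i \<tau> j) (entry_diagram s k \<rho> l) =
    (if j = k then basis R (entry_diagram r i (\<tau> \<circ> \<rho>) l) else (\<lambda>_. \<zero>))"
proof (cases "j = k")
  case True
  then have "s = r" using up_mono_source_unique i(2) k(1) by blast
  then show ?thesis
    using matrix_mult_eq[OF i(1) perm_diagram_level[OF i(3)] flip_up_mono[OF i(2)] k(1) perm_diagram_level[OF k(3)] flip_up_mono[OF k(2)], of R]
      True k(3) by (simp add: entry_diagram_def flip_flip perm_diagram_comp[OF i(3)])
next
  case False
  then show ?thesis
    using matrix_mult_eq[OF i(1) perm_diagram_level[OF i(3)] flip_up_mono[OF i(2)] k(1) perm_diagram_level[OF k(3)] flip_up_mono[OF k(2)], of R]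
    by (simp add: entry_diagram_def flip_flip)
qed

text \<open>By the rule for matrix units, a contribution at position \<open>(i, k)\<close> comes
  from row \<open>i\<close> times column \<open>k\<close> with a common inner index. This bounds the
  support of the sums in \<open>matrix_ext_entry\<close>.\<close>

lemma matrix_mult_support:
  assumes x: "x \<in> brauer p p" and y: "y \<in> brauer p p"
    and i: "i \<in> up_mono r p" "k \<in> up_mono r p" "\<sigma> permutes {1..r}"
    and ne: "matrix_mult R p x y (entry_diagram r i \<sigma> k) \<noteq> \<zero>"
  obtains j \<tau> \<rho> where "j \<in> up_mono r p" "\<tau> permutes {1..r}" "\<rho> permutes {1..r}"
    "x = entry_diagram r i \<tau> j" "y = entry_diagram r j \<rho> k"
proof -
  obtain s a \<tau> j where X: "a \<in> up_mono s p" "j \<in> up_mono s p" "\<tau> permutes {1..s}" "x = entry_diagram s a \<tau> j"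
    using entry_diagram_cases[OF x] by metis
  obtain t b \<rho> l where Y: "b \<in> up_mono t p" "l \<in> up_mono t p" "\<rho> permutes {1..t}" "y = entry_diagram t b \<rho> l"
    using entry_diagram_cases[OF y] by metis
  have jb: "j = b" using ne unfolding X(4) Y(4) matrix_mult_entry[OF X(1-3) Y(1-3)] by (auto split: if_splits)
  then have ts: "t = s" using up_mono_source_unique X(2) Y(1) by blast
  have "entry_diagram r i \<sigma> k = entry_diagram s a (\<tau> \<circ> \<rho>) l"
    using ne jb unfolding X(4) Y(4) matrix_mult_entry[OF X(1-3) Y(1-3)] by (auto simp: basis_def split: if_splits)
  then have "r = s \<and> i = a \<and> \<sigma> = \<tau> \<circ> \<rho> \<and> k = l"
    using entry_diagram_inject[OF i X(1) _ permutes_compose[OF _ X(3)]] Y(2,3) ts by blast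
  then show thesis using that[of j \<tau> \<rho>] X Y jb ts by blast
qed

abbreviation (input) perms :: "nat \<Rightarrow> (nat \<Rightarrow> nat) set" where
  "perms r \<equiv> carrier (sym_group r)"

abbreviation (input) sym_ext where
  "sym_ext r \<equiv> bilinear_ext R (perms r) (perms r) (\<lambda>x y. basis R (x \<otimes>\<^bsub>sym_group r\<^esub> y))"

section \<open>The direct sum of matrix algebras, coefficient by coefficient\<close>

lemma sym_algebra_simps:
  "carrier (group_algebra R (sym_group r)) = free_carrier R (perms r)"
  "zero (group_algebra R (sym_group r)) = (\<lambda>x. \<zero>)"
  "add (group_algebra R (sym_group r)) = (\<lambda>v w x. v x \<oplus> w x)"
  "module.smult (group_algebra R (sym_group r)) = scale R"
  "one (group_algebra R (sym_group r)) = basis R id"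
  "monoid.mult (group_algebra R (sym_group r)) = sym_ext r"
  by (simp_all add: group_algebra_def free_algebra_simps sym_group_one)

lemma sym_algebra_monoid: "abelian_monoid (group_algebra R (sym_group r))"
  unfolding group_algebra_def by (rule free_algebra_monoid)

lemma matrix_summand_simps:
  "carrier (matrix_summand R p r) = (up_mono r p \<times> up_mono r p) \<rightarrow>\<^sub>E free_carrier R (perms r)"
  "zero (matrix_summand R p r) = (\<lambda>_\<in>up_mono r p \<times> up_mono r p. \<lambda>x. \<zero>)"
  "add (matrix_summand R p r) = (\<lambda>M N. \<lambda>ij\<in>up_mono r p \<times> up_mono r p. \<lambda>x. M ij x \<oplus> N ij x)"
  "module.smult (matrix_summand R p r) = (\<lambda>a M. \<lambda>ij\<in>up_mono r p \<times> up_mono r p. scale R a (M ij))"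
  "one (matrix_summand R p r) = (\<lambda>(i, j)\<in>up_mono r p \<times> up_mono r p. if i = j then basis R id else (\<lambda>x. \<zero>))"
  "monoid.mult (matrix_summand R p r) = (\<lambda>M N. \<lambda>(i, k)\<in>up_mono r p \<times> up_mono r p.
     \<Oplus>\<^bsub>group_algebra R (sym_group r)\<^esub>j\<in>up_mono r p. sym_ext r (M (i, j)) (N (j, k)))"
  by (simp_all add: matrix_summand_def matrix_algebra_def sym_algebra_simps cong del: if_weak_cong)

lemma matrix_sum_simps:
  "carrier (matrix_sum_algebra R p) = (\<Pi>\<^sub>E r\<in>{r. r \<preceq> p}. carrier (matrix_summand R p r))"
  "zero (matrix_sum_algebra R p) = (\<lambda>r\<in>{r. r \<preceq> p}. \<zero>\<^bsub>matrix_summand R p r\<^esub>)"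
  "add (matrix_sum_algebra R p) = (\<lambda>x y. \<lambda>r\<in>{r. r \<preceq> p}. x r \<oplus>\<^bsub>matrix_summand R p r\<^esub> y r)"
  "module.smult (matrix_sum_algebra R p) = (\<lambda>a x. \<lambda>r\<in>{r. r \<preceq> p}. a \<odot>\<^bsub>matrix_summand R p r\<^esub> x r)"
  "one (matrix_sum_algebra R p) = (\<lambda>r\<in>{r. r \<preceq> p}. \<one>\<^bsub>matrix_summand R p r\<^esub>)"
  "monoid.mult (matrix_sum_algebra R p) = (\<lambda>x y. \<lambda>r\<in>{r. r \<preceq> p}. x r \<otimes>\<^bsub>matrix_summand R p r\<^esub> y r)"
  by (simp_all add: matrix_sum_algebra_def direct_sum_algebra_def)

lemma matrix_summand_monoid: "abelian_monoid (matrix_summand R p r)"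
  by (rule product_abelian_monoid[of "up_mono r p \<times> up_mono r p" "\<lambda>_. group_algebra R (sym_group r)"])
    (simp_all add: sym_algebra_monoid matrix_summand_simps sym_algebra_simps)

lemma matrix_sum_monoid: "abelian_monoid (matrix_sum_algebra R p)"
  by (rule product_abelian_monoid[of "{r. r \<preceq> p}" "matrix_summand R p"])
    (simp_all add: matrix_summand_monoid matrix_sum_simps)

lemma matrix_sumD:
  assumes x: "x \<in> carrier (matrix_sum_algebra R p)" and r: "r \<preceq> p" and ij: "i \<in> up_mono r p" "j \<in> up_mono r p"
  shows "x r (i, j) \<in> free_carrier R (perms r)"
proof -
  have "x r \<in> carrier (matrix_summand R p r)" using x r by (simp add: matrix_sum_simps PiE_iff)
  then show ?thesis using ij by (simp add: matrix_summand_simps PiE_iff)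
qed

lemma matrix_sumI:
  assumes "\<And>r i j. r \<preceq> p \<Longrightarrow> i \<in> up_mono r p \<Longrightarrow> j \<in> up_mono r p \<Longrightarrow> x r (i, j) \<in> free_carrier R (perms r)"
    and "x \<in> extensional {r. r \<preceq> p}" "\<And>r. r \<preceq> p \<Longrightarrow> x r \<in> extensional (up_mono r p \<times> up_mono r p)"
  shows "x \<in> carrier (matrix_sum_algebra R p)"
  using assms by (auto simp: matrix_sum_simps matrix_summand_simps PiE_iff)

text \<open>Off the index sets nothing can differ: families and matrices are extensional functions,
  and group algebra elements vanish off the permutations.\<close>

lemma matrix_sum_ext:
  assumes x: "x \<in> carrier (matrix_sum_algebra R p)" and y: "y \<in> carrier (matrix_sum_algebra R p)"
    and eq: "\<And>r i j \<sigma>. r \<preceq> p \<Longrightarrow> i \<in> up_mono r p \<Longrightarrow> j \<in> up_mono r p \<Longrightarrow> \<sigma> permutes {1..r} \<Longrightarrow> x r (i, j) \<sigma> = y r (i, j) \<sigma>"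
  shows "x = y"
proof (rule PiE_ext[OF x[unfolded matrix_sum_simps] y[unfolded matrix_sum_simps]])
  fix r assume "r \<in> {r. r \<preceq> p}"
  then have r: "r \<preceq> p" by simp
  then have "x r \<in> carrier (matrix_summand R p r)" "y r \<in> carrier (matrix_summand R p r)"
    using x y by (simp_all add: matrix_sum_simps PiE_iff)
  then show "x r = y r"
    unfolding matrix_summand_simps
  proof (rule PiE_ext)
    fix ij assume "ij \<in> up_mono r p \<times> up_mono r p"
    then obtain i j where ij: "ij = (i, j)" "i \<in> up_mono r p" "j \<in> up_mono r p" by blast
    show "x r ij = y r ij"
    proof
      fix \<sigma>
      show "x r ij \<sigma> = y r ij \<sigma>"
      proof (cases "\<sigma> \<in> perms r")
        case True
        then have "\<sigma> permutes {1..r}" by (simp only: sym_carrier)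
        then show ?thesis using eq[OF r ij(2,3)] ij(1) by simp
      next
        case False
        then show ?thesis
          using free_carrier_off[OF matrix_sumD[OF x r ij(2,3)]] free_carrier_off[OF matrix_sumD[OF y r ij(2,3)]] ij(1) by simp
      qed
    qed
  qed
qed

lemma matrix_sum_apply:
  assumes r: "r \<preceq> p" and ij: "i \<in> up_mono r p" "j \<in> up_mono r p"
  shows "(x \<oplus>\<^bsub>matrix_sum_algebra R p\<^esub> y) r (i, j) \<sigma> = x r (i, j) \<sigma> \<oplus> y r (i, j) \<sigma>"
    and "\<zero>\<^bsub>matrix_sum_algebra R p\<^esub> r (i, j) \<sigma> = \<zero>"
    and "(a \<odot>\<^bsub>matrix_sum_algebra R p\<^esub> x) r (i, j) \<sigma> = a \<otimes> x r (i, j) \<sigma>"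
    and "\<one>\<^bsub>matrix_sum_algebra R p\<^esub> r (i, j) \<sigma> = (if i = j \<and> \<sigma> = id then \<one> else \<zero>)"
    and "(x \<otimes>\<^bsub>matrix_sum_algebra R p\<^esub> y) r (i, j) =
      (\<Oplus>\<^bsub>group_algebra R (sym_group r)\<^esub>k\<in>up_mono r p. sym_ext r (x r (i, k)) (y r (k, j)))"
  using assms by (simp_all add: matrix_sum_simps matrix_summand_simps scale_def basis_def)

lemma sym_ext_closed:
  "v \<in> free_carrier R (perms r) \<Longrightarrow> w \<in> free_carrier R (perms r) \<Longrightarrow> sym_ext r v w \<in> free_carrier R (perms r)"
  by (rule bilinear_closed[OF group_mult_closed])

lemma matrix_sum_smult_closed:
  assumes a: "a \<in> carrier R" and x: "x \<in> carrier (matrix_sum_algebra R p)"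
  shows "a \<odot>\<^bsub>matrix_sum_algebra R p\<^esub> x \<in> carrier (matrix_sum_algebra R p)"
proof (rule matrix_sumI)
  fix r i j assume *: "r \<preceq> p" "i \<in> up_mono r p" "j \<in> up_mono r p"
  show "(a \<odot>\<^bsub>matrix_sum_algebra R p\<^esub> x) r (i, j) \<in> free_carrier R (perms r)"
    using free_scale[OF a matrix_sumD[OF x *]] * by (simp add: matrix_sum_simps matrix_summand_simps)
qed (simp_all add: matrix_sum_simps matrix_summand_simps)

lemma matrix_sum_mult_closed:
  assumes x: "x \<in> carrier (matrix_sum_algebra R p)" and y: "y \<in> carrier (matrix_sum_algebra R p)"
  shows "x \<otimes>\<^bsub>matrix_sum_algebra R p\<^esub> y \<in> carrier (matrix_sum_algebra R p)"
proof (rule matrix_sumI)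
  fix r i j assume *: "r \<preceq> p" "i \<in> up_mono r p" "j \<in> up_mono r p"
  show "(x \<otimes>\<^bsub>matrix_sum_algebra R p\<^esub> y) r (i, j) \<in> free_carrier R (perms r)"
    unfolding matrix_sum_apply(5)[OF *] group_algebra_def
    by (rule finsum_free_closed) (use * in \<open>auto intro!: sym_ext_closed matrix_sumD[OF x] matrix_sumD[OF y]\<close>)
qed (simp_all add: matrix_sum_simps matrix_summand_simps case_prod_unfold)

lemma matrix_sum_one_closed: "\<one>\<^bsub>matrix_sum_algebra R p\<^esub> \<in> carrier (matrix_sum_algebra R p)"
proof (rule matrix_sumI)
  fix r i j assume *: "r \<preceq> p" "i \<in> up_mono r p" "j \<in> up_mono r p"
  have "id \<in> perms r" by (simp only: sym_carrier permutes_id)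
  then show "\<one>\<^bsub>matrix_sum_algebra R p\<^esub> r (i, j) \<in> free_carrier R (perms r)"
    using * free_basis[of id "perms r"] free_zero[of "perms r"] by (simp add: matrix_sum_simps matrix_summand_simps)
qed (simp_all add: matrix_sum_simps matrix_summand_simps case_prod_unfold)

text \<open>The term of \<open>f\<close> is a matrix unit carrying a single permutation. For a fixed
  position, read as a function of \<open>f\<close>, its coefficient is a basis vector; this exchange
  of roles collapses the sum in \<open>to_matrices\<close> to one coefficient of
  \<open>v\<close>.\<close>

lemma to_matrices_summand:
  assumes f: "f \<in> brauer p p"
  defines "t \<equiv> (case factorization p p f of (r, fu, f0, fd) \<Rightarrow>
           summand_inj {r. r \<preceq> p} (matrix_summand R p) r
             (elem_matrix (up_mono r p) (group_algebra R (sym_group r)) fu (flip fd)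
                (basis R (diagram_perm r f0))))"
  shows "t \<in> carrier (matrix_sum_algebra R p)"
    and "r \<preceq> p \<Longrightarrow> i \<in> up_mono r p \<Longrightarrow> j \<in> up_mono r p \<Longrightarrow> \<sigma> permutes {1..r} \<Longrightarrow>
      t r (i, j) \<sigma> = basis R (entry_diagram r i \<sigma> j) f"
proof -
  obtain s a \<tau> b where F: "a \<in> up_mono s p" "b \<in> up_mono s p" "\<tau> permutes {1..s}" "f = entry_diagram s a \<tau> b" "s \<preceq> p"
    using entry_diagram_cases[OF f] .
  have t: "t = summand_inj {r. r \<preceq> p} (matrix_summand R p) s
      (elem_matrix (up_mono s p) (group_algebra R (sym_group s)) a b (basis R \<tau>))"
    unfolding t_def F(4) factorization_entry_diagram[OF F(1-3)]
    by (simp add: flip_flip diagram_perm_perm_diagram[OF F(3)])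
  have app: "t r (i, j) = (if r = s \<and> i = a \<and> j = b then basis R \<tau> else (\<lambda>x. \<zero>))"
    if "r \<preceq> p" "i \<in> up_mono r p" "j \<in> up_mono r p" for r i j
    unfolding t summand_inj_def elem_matrix_def using that F(1,2)
    by (cases "r = s") (simp_all add: matrix_summand_simps sym_algebra_simps)
  show "t \<in> carrier (matrix_sum_algebra R p)"
  proof (rule matrix_sumI)
    fix r i j assume *: "r \<preceq> p" "i \<in> up_mono r p" "j \<in> up_mono r p"
    have "\<tau> \<in> perms s" using F(3) by (simp only: sym_carrier)
    then show "t r (i, j) \<in> free_carrier R (perms r)"
      unfolding app[OF *] using free_basis[of \<tau> "perms s"] free_zero[of "perms r"] by simp
  next
    show "t \<in> extensional {r. r \<preceq> p}" by (simp add: t summand_inj_def)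
    show "t r \<in> extensional (up_mono r p \<times> up_mono r p)" if "r \<preceq> p" for r
      using that by (simp add: t summand_inj_def elem_matrix_def matrix_summand_simps)
  qed
  assume *: "r \<preceq> p" "i \<in> up_mono r p" "j \<in> up_mono r p" "\<sigma> permutes {1..r}"
  show "t r (i, j) \<sigma> = basis R (entry_diagram r i \<sigma> j) f"
    unfolding app[OF *(1-3)] F(4)
    using entry_diagram_inject[OF F(1-3) *(2-4)] by (auto simp: basis_def)
qed

lemma to_matrices_closed:
  assumes v: "v \<in> free_carrier R (brauer p p)"
  shows "to_matrices R p v \<in> carrier (matrix_sum_algebra R p)"
  unfolding to_matrices_def
  by (rule abelian_monoid.finsum_closed[OF matrix_sum_monoid])
    (intro Pi_I matrix_sum_smult_closed free_carrierD[OF v] to_matrices_summand(1))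

lemma to_matrices_apply:
  assumes v: "v \<in> free_carrier R (brauer p p)"
    and r: "r \<preceq> p" "i \<in> up_mono r p" "j \<in> up_mono r p" "\<sigma> permutes {1..r}"
  shows "to_matrices R p v r (i, j) \<sigma> = v (entry_diagram r i \<sigma> j)"
proof -
  \<comment> \<open>Taking one coefficient is additive, so it may be moved inside the sum.\<close>
  let ?N = "matrix_sum_algebra R p"
  note e = entry_diagram_brauer[OF r(2-4)]
  have "to_matrices R p v r (i, j) \<sigma> = (\<Oplus>f\<in>brauer p p. (v f \<odot>\<^bsub>?N\<^esub>
        (case factorization p p f of (r, fu, f0, fd) \<Rightarrow>
           summand_inj {r. r \<preceq> p} (matrix_summand R p) r
             (elem_matrix (up_mono r p) (group_algebra R (sym_group r)) fu (flip fd)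
                (basis R (diagram_perm r f0))))) r (i, j) \<sigma>)"
    unfolding to_matrices_def
  proof (rule finsum_additive[OF matrix_sum_monoid abelian_monoid_axioms, where e = "\<lambda>x. x r (i, j) \<sigma>"])
    show "x r (i, j) \<sigma> \<in> carrier R" if "x \<in> carrier ?N" for x
      by (rule free_carrierD[OF matrix_sumD[OF that r(1-3)]])
  qed (simp_all only: matrix_sum_apply[OF r(1-3)] Pi_I matrix_sum_smult_closed free_carrierD[OF v] to_matrices_summand(1))
  also have "\<dots> = (\<Oplus>f\<in>brauer p p. v f \<otimes> basis R (entry_diagram r i \<sigma> j) f)"
    by (rule finsum_cong')
      (simp_all add: matrix_sum_apply[OF r(1-3)] to_matrices_summand(2)[OF _ r] free_carrierD[OF v] basis_carrier)
  also have "\<dots> = v (entry_diagram r i \<sigma> j) \<otimes> basis R (entry_diagram r i \<sigma> j) (entry_diagram r i \<sigma> j)"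
    by (rule finsum_eq_single[OF finite_brauer e]) (auto simp: basis_def free_carrierD[OF v])
  also have "\<dots> = v (entry_diagram r i \<sigma> j)" by (simp add: basis_def free_carrierD[OF v])
  finally show ?thesis .
qed

text \<open>The sums over pairs of diagrams shrink to an inner index and two permutations. The right
  side is written so as to coincide with the product of matrices over the group algebra, expanded in
  the same order.\<close>

lemma matrix_ext_entry:
  assumes v: "v \<in> free_carrier R (brauer p p)" and w: "w \<in> free_carrier R (brauer p p)"
    and i: "i \<in> up_mono r p" and k: "k \<in> up_mono r p" and \<sigma>: "\<sigma> permutes {1..r}"
  shows "matrix_ext p v w (entry_diagram r i \<sigma> k) =
    (\<Oplus>j\<in>up_mono r p. \<Oplus>\<tau>\<in>perms r. \<Oplus>\<rho>\<in>perms r.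
      v (entry_diagram r i \<tau> j) \<otimes> w (entry_diagram r j \<rho> k) \<otimes> basis R (\<tau> \<otimes>\<^bsub>sym_group r\<^esub> \<rho>) \<sigma>)"
proof -
  let ?X = "brauer p p" and ?z = "entry_diagram r i \<sigma> k" and ?S = "perms r" and ?I = "up_mono r p"
  let ?m = "\<lambda>x y. v x \<otimes> w y \<otimes> matrix_mult R p x y ?z"
  have mc: "?m x y \<in> carrier R" if "x \<in> ?X" "y \<in> ?X" for x y
    using free_carrierD[OF v] free_carrierD[OF w] free_carrierD[OF matrix_mult_closed[OF that]] by simp
  have inX: "entry_diagram r a \<tau> b \<in> ?X" if "a \<in> ?I" "b \<in> ?I" "\<tau> \<in> ?S" for a b \<tau>
    using entry_diagram_brauer that by (simp only: sym_carrier)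
  have inner: "(\<Oplus>y\<in>?X. ?m (entry_diagram r i \<tau> j) y) =
      (\<Oplus>\<rho>\<in>?S. v (entry_diagram r i \<tau> j) \<otimes> w (entry_diagram r j \<rho> k) \<otimes> basis R (\<tau> \<otimes>\<^bsub>sym_group r\<^esub> \<rho>) \<sigma>)"
    if j: "j \<in> ?I" and \<tau>: "\<tau> \<in> ?S" for j \<tau>
  proof -
    have \<tau>p: "\<tau> permutes {1..r}" using \<tau> by (simp only: sym_carrier)
    have "(\<Oplus>y\<in>?X. ?m (entry_diagram r i \<tau> j) y) = (\<Oplus>\<rho>\<in>?S. ?m (entry_diagram r i \<tau> j) (entry_diagram r j \<rho> k))"
    proof (rule finsum_support_reindex[OF finite_brauer])
      show "inj_on (\<lambda>\<rho>. entry_diagram r j \<rho> k) ?S"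
        by (rule inj_onI) (use entry_diagram_inject[OF j k _ j k] in \<open>simp only: sym_carrier\<close>)
      show "(\<lambda>\<rho>. entry_diagram r j \<rho> k) ` ?S \<subseteq> ?X" using inX[OF j k] by blast
      show "?m (entry_diagram r i \<tau> j) \<in> ?X \<rightarrow> carrier R" using mc[OF inX[OF i j \<tau>]] by blast
      fix y assume y: "y \<in> ?X" "y \<notin> (\<lambda>\<rho>. entry_diagram r j \<rho> k) ` ?S"
      have "matrix_mult R p (entry_diagram r i \<tau> j) y ?z = \<zero>"
      proof (rule ccontr)
        assume "matrix_mult R p (entry_diagram r i \<tau> j) y ?z \<noteq> \<zero>"
        then obtain j' \<tau>' \<rho> where *: "j' \<in> ?I" "\<tau>' permutes {1..r}" "\<rho> permutes {1..r}"
          "entry_diagram r i \<tau> j = entry_diagram r i \<tau>' j'" "y = entry_diagram r j' \<rho> k"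
          using matrix_mult_support[OF inX[OF i j \<tau>] y(1) i k \<sigma>] by metis
        have "j' = j" using entry_diagram_inject[OF i j \<tau>p i *(1,2,4)] by simp
        moreover have "\<rho> \<in> ?S" using *(3) by (simp only: sym_carrier)
        ultimately show False using y(2) *(5) by blast
      qed
      then show "?m (entry_diagram r i \<tau> j) y = \<zero>" using free_carrierD[OF v] free_carrierD[OF w] by simp
    qed
    also have "\<dots> = (\<Oplus>\<rho>\<in>?S. v (entry_diagram r i \<tau> j) \<otimes> w (entry_diagram r j \<rho> k) \<otimes> basis R (\<tau> \<otimes>\<^bsub>sym_group r\<^esub> \<rho>) \<sigma>)"
    proof (rule finsum_cong'[OF refl])
      fix \<rho> assume "\<rho> \<in> ?S"
      then have \<rho>: "\<rho> permutes {1..r}" by (simp only: sym_carrier)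
      have "entry_diagram r i \<sigma> k = entry_diagram r i (\<tau> \<circ> \<rho>) k \<longleftrightarrow> \<sigma> = \<tau> \<circ> \<rho>"
        using entry_diagram_inject[OF i k \<sigma> i k permutes_compose[OF \<rho> \<tau>p]] by auto
      then have "matrix_mult R p (entry_diagram r i \<tau> j) (entry_diagram r j \<rho> k) ?z = basis R (\<tau> \<otimes>\<^bsub>sym_group r\<^esub> \<rho>) \<sigma>"
        unfolding matrix_mult_entry[OF i j \<tau>p j k \<rho>] sym_group_mult by (simp add: basis_def)
      then show "?m (entry_diagram r i \<tau> j) (entry_diagram r j \<rho> k) =
          v (entry_diagram r i \<tau> j) \<otimes> w (entry_diagram r j \<rho> k) \<otimes> basis R (\<tau> \<otimes>\<^bsub>sym_group r\<^esub> \<rho>) \<sigma>" by simp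
    qed (simp add: free_carrierD[OF v] free_carrierD[OF w] basis_carrier)
    finally show ?thesis .
  qed
  have "matrix_ext p v w ?z = (\<Oplus>x\<in>?X. \<Oplus>y\<in>?X. ?m x y)" unfolding bilinear_ext_def ..
  \<comment> \<open>A pair \<open>q\<close> of column index and permutation parametrizes the
    diagrams \<open>x\<close> lying in row \<open>i\<close>; all other \<open>x\<close> contribute
    zero.\<close>
  also have "\<dots> = (\<Oplus>q\<in>?I \<times> ?S. \<Oplus>y\<in>?X. ?m (entry_diagram r i (snd q) (fst q)) y)"
  proof (rule finsum_support_reindex[OF finite_brauer])
    show "inj_on (\<lambda>q. entry_diagram r i (snd q) (fst q)) (?I \<times> ?S)"
    proof (rule inj_onI)
      fix q q' assume q: "q \<in> ?I \<times> ?S" "q' \<in> ?I \<times> ?S" and eq: "entry_diagram r i (snd q) (fst q) = entry_diagram r i (snd q') (fst q')"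
      have "fst q \<in> ?I" "snd q permutes {1..r}" "fst q' \<in> ?I" "snd q' permutes {1..r}"
        using q by (simp_all only: sym_carrier mem_Times_iff)
      then have "snd q = snd q' \<and> fst q = fst q'" using entry_diagram_inject[OF i _ _ i _ _ eq] by blast
      then show "q = q'" by (simp add: prod_eq_iff)
    qed
    show "(\<lambda>q. entry_diagram r i (snd q) (fst q)) ` (?I \<times> ?S) \<subseteq> ?X" using inX[OF i] by auto
    show "(\<lambda>x. \<Oplus>y\<in>?X. ?m x y) \<in> ?X \<rightarrow> carrier R" using mc by (intro Pi_I finsum_closed)
    fix x assume x: "x \<in> ?X" "x \<notin> (\<lambda>q. entry_diagram r i (snd q) (fst q)) ` (?I \<times> ?S)"
    have "?m x y = \<zero>" if y: "y \<in> ?X" for y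
    proof -
      have "matrix_mult R p x y ?z = \<zero>"
      proof (rule ccontr)
        assume "matrix_mult R p x y ?z \<noteq> \<zero>"
        then obtain j \<tau> \<rho> where *: "j \<in> ?I" "\<tau> permutes {1..r}" "x = entry_diagram r i \<tau> j"
          using matrix_mult_support[OF x(1) y i k \<sigma>] by metis
        then have "(j, \<tau>) \<in> ?I \<times> ?S" by (simp only: sym_carrier mem_Times_iff fst_conv snd_conv)
        then show False using x(2) *(3) by force
      qed
      then show ?thesis using free_carrierD[OF v] free_carrierD[OF w] by simp
    qed
    then have "(\<Oplus>y\<in>?X. ?m x y) = (\<Oplus>y\<in>?X. \<zero>)" by (intro finsum_cong') auto
    then show "(\<Oplus>y\<in>?X. ?m x y) = \<zero>" by (rule trans[OF _ finsum_zero])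
  qed
  also have "\<dots> = (\<Oplus>j\<in>?I. \<Oplus>\<tau>\<in>?S. \<Oplus>y\<in>?X. ?m (entry_diagram r i \<tau> j) y)"
    by (rule finsum_cartesian[OF finite_up_mono finite_sym]) (use mc inX[OF i] in \<open>auto intro!: finsum_closed\<close>)
  also have "\<dots> = (\<Oplus>j\<in>?I. \<Oplus>\<tau>\<in>?S. \<Oplus>\<rho>\<in>?S.
      v (entry_diagram r i \<tau> j) \<otimes> w (entry_diagram r j \<rho> k) \<otimes> basis R (\<tau> \<otimes>\<^bsub>sym_group r\<^esub> \<rho>) \<sigma>)"
    by (intro finsum_cong'[OF refl] Pi_I finsum_closed m_closed inner
        free_carrierD[OF v] free_carrierD[OF w] basis_carrier)
  finally show ?thesis .
qed

lemma to_matrices_mult: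
  assumes v: "v \<in> free_carrier R (brauer p p)" and w: "w \<in> free_carrier R (brauer p p)"
  shows "to_matrices R p (matrix_ext p v w) = to_matrices R p v \<otimes>\<^bsub>matrix_sum_algebra R p\<^esub> to_matrices R p w"
proof (rule matrix_sum_ext)
  have vw: "matrix_ext p v w \<in> free_carrier R (brauer p p)"
    by (rule bilinear_closed[OF matrix_mult_closed v w])
  note tv = to_matrices_closed[OF v] and tw = to_matrices_closed[OF w]
  show "to_matrices R p (matrix_ext p v w) \<in> carrier (matrix_sum_algebra R p)" by (rule to_matrices_closed[OF vw])
  show "to_matrices R p v \<otimes>\<^bsub>matrix_sum_algebra R p\<^esub> to_matrices R p w \<in> carrier (matrix_sum_algebra R p)"
    by (rule matrix_sum_mult_closed[OF tv tw])
  fix r i k \<sigma> assume r: "r \<preceq> p" and i: "i \<in> up_mono r p" and k: "k \<in> up_mono r p" and \<sigma>: "\<sigma> permutes {1..r}"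
  let ?I = "up_mono r p" and ?S = "perms r"
  have cl: "(\<lambda>j. sym_ext r (to_matrices R p v r (i, j)) (to_matrices R p w r (j, k))) \<in> ?I \<rightarrow> free_carrier R ?S"
    using sym_ext_closed matrix_sumD[OF tv r i] matrix_sumD[OF tw r _ k] by blast
  have "(to_matrices R p v \<otimes>\<^bsub>matrix_sum_algebra R p\<^esub> to_matrices R p w) r (i, k) \<sigma> =
      (\<Oplus>j\<in>?I. sym_ext r (to_matrices R p v r (i, j)) (to_matrices R p w r (j, k)) \<sigma>)"
    unfolding matrix_sum_apply(5)[OF r i k] group_algebra_def by (rule finsum_free[OF cl])
  also have "\<dots> = (\<Oplus>j\<in>?I. \<Oplus>\<tau>\<in>?S. \<Oplus>\<rho>\<in>?S.
      v (entry_diagram r i \<tau> j) \<otimes> w (entry_diagram r j \<rho> k) \<otimes> basis R (\<tau> \<otimes>\<^bsub>sym_group r\<^esub> \<rho>) \<sigma>)"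
    unfolding bilinear_ext_def
  proof (intro finsum_cong'[OF refl] Pi_I finsum_closed m_closed free_carrierD[OF v] free_carrierD[OF w] basis_carrier)
    fix j \<tau> \<rho> assume j: "j \<in> ?I" and "\<tau> \<in> ?S" "\<rho> \<in> ?S"
    then have p: "\<tau> permutes {1..r}" "\<rho> permutes {1..r}" by (simp_all only: sym_carrier)
    show "to_matrices R p v r (i, j) \<tau> \<otimes> to_matrices R p w r (j, k) \<rho> \<otimes> basis R (\<tau> \<otimes>\<^bsub>sym_group r\<^esub> \<rho>) \<sigma> =
        v (entry_diagram r i \<tau> j) \<otimes> w (entry_diagram r j \<rho> k) \<otimes> basis R (\<tau> \<otimes>\<^bsub>sym_group r\<^esub> \<rho>) \<sigma>"
      by (simp only: to_matrices_apply[OF v r i j p(1)] to_matrices_apply[OF w r j k p(2)])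
  qed
  also have "\<dots> = to_matrices R p (matrix_ext p v w) r (i, k) \<sigma>"
    by (simp only: to_matrices_apply[OF vw r i k \<sigma>] matrix_ext_entry[OF v w i k \<sigma>])
  finally show "to_matrices R p (matrix_ext p v w) r (i, k) \<sigma> =
      (to_matrices R p v \<otimes>\<^bsub>matrix_sum_algebra R p\<^esub> to_matrices R p w) r (i, k) \<sigma>" by (rule sym)
qed

text \<open>Each \<open>f \<bullet>\<^sub>B flip f\<close> is the diagonal matrix unit at
  \<open>f\<close> with the identity permutation, so at most the summand \<open>f = i\<close> is
  seen at position \<open>(i, j)\<close>.\<close>

lemma to_matrices_one: "to_matrices R p (matrix_one R p) = \<one>\<^bsub>matrix_sum_algebra R p\<^esub>"
proof (rule matrix_sum_ext[OF to_matrices_closed[OF matrix_one_closed] matrix_sum_one_closed])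
  fix r i j \<sigma> assume r: "r \<preceq> p" and i: "i \<in> up_mono r p" and j: "j \<in> up_mono r p" and \<sigma>: "\<sigma> permutes {1..r}"
  let ?z = "entry_diagram r i \<sigma> j"
  have cl: "(\<lambda>f. basis R (f \<bullet>\<^sub>B flip f)) \<in> all_up p \<rightarrow> free_carrier R (brauer p p)"
    by (intro Pi_I free_basis up_flip_brauer)
  have val: "basis R (f \<bullet>\<^sub>B flip f) ?z = (if f = i \<and> i = j \<and> \<sigma> = id then \<one> else \<zero>)" if "f \<in> all_up p" for f
  proof -
    obtain s where s: "f \<in> up_mono s p" using \<open>f \<in> all_up p\<close> all_upE by blast
    have e: "f \<bullet>\<^sub>B flip f = entry_diagram s f id f"
      unfolding entry_diagram_def up_mono_flip_self[OF s] id_diagram_eq ..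
    have "?z = entry_diagram s f id f \<longleftrightarrow> f = i \<and> i = j \<and> \<sigma> = id"
    proof
      assume "?z = entry_diagram s f id f"
      then show "f = i \<and> i = j \<and> \<sigma> = id" using entry_diagram_inject[OF i j \<sigma> s s permutes_id] by blast
    next
      assume "f = i \<and> i = j \<and> \<sigma> = id"
      then show "?z = entry_diagram s f id f" using up_mono_source_unique[OF s] i by auto
    qed
    then show ?thesis unfolding e by (simp add: basis_def)
  qed
  have "matrix_one R p ?z = (\<Oplus>f\<in>all_up p. basis R (f \<bullet>\<^sub>B flip f) ?z)"
    unfolding matrix_one_eq[where m = "\<lambda>x y. undefined" and e = undefined] by (rule finsum_free[OF cl])
  also have "\<dots> = basis R (i \<bullet>\<^sub>B flip i) ?z"
    by (rule finsum_eq_single[OF finite_all_up all_up_mem[OF i] basis_carrier]) (simp add: val)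
  also have "\<dots> = (if i = j \<and> \<sigma> = id then \<one> else \<zero>)" by (simp add: val all_up_mem[OF i])
  finally show "to_matrices R p (matrix_one R p) r (i, j) \<sigma> = \<one>\<^bsub>matrix_sum_algebra R p\<^esub> r (i, j) \<sigma>"
    unfolding to_matrices_apply[OF matrix_one_closed r i j \<sigma>] matrix_sum_apply(4)[OF r i j] .
qed

lemma to_matrices_bij: "bij_betw (to_matrices R p) (free_carrier R (brauer p p)) (carrier (matrix_sum_algebra R p))"
proof (rule bij_betw_imageI)
  show "inj_on (to_matrices R p) (free_carrier R (brauer p p))"
  proof (rule inj_onI)
    fix v w assume v: "v \<in> free_carrier R (brauer p p)" and w: "w \<in> free_carrier R (brauer p p)"
      and eq: "to_matrices R p v = to_matrices R p w"
    show "v = w"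
    proof
      fix x
      show "v x = w x"
      proof (cases "x \<in> brauer p p")
        case True
        then obtain r i \<sigma> j where x: "i \<in> up_mono r p" "j \<in> up_mono r p" "\<sigma> permutes {1..r}" "x = entry_diagram r i \<sigma> j" "r \<preceq> p"
          by (rule entry_diagram_cases)
        then show ?thesis using to_matrices_apply[OF v x(5,1-3)] to_matrices_apply[OF w x(5,1-3)] eq by simp
      next
        case False
        then show ?thesis using free_carrier_off[OF v] free_carrier_off[OF w] by simp
      qed
    qed
  qed
  show "to_matrices R p ` free_carrier R (brauer p p) = carrier (matrix_sum_algebra R p)"
  proof (rule subset_antisym; rule subsetI)
    fix y assume "y \<in> to_matrices R p ` free_carrier R (brauer p p)"
    then show "y \<in> carrier (matrix_sum_algebra R p)" using to_matrices_closed by blast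
  next
    fix y assume y: "y \<in> carrier (matrix_sum_algebra R p)"
    \<comment> \<open>The inverse relabelling: the coefficient of a diagram is read off at the
      position given by its outer factors.\<close>
    define v where "v x = (if x \<in> brauer p p then
      (case factorization p p x of (r, a, b, c) \<Rightarrow> y r (a, flip c) (diagram_perm r b)) else \<zero>)" for x
    have ve: "v (entry_diagram r i \<sigma> j) = y r (i, j) \<sigma>"
      if "i \<in> up_mono r p" "j \<in> up_mono r p" "\<sigma> permutes {1..r}" for r i j \<sigma>
      unfolding v_def factorization_entry_diagram[OF that]
      using entry_diagram_brauer[OF that] by (simp add: flip_flip diagram_perm_perm_diagram[OF that(3)])
    have v: "v \<in> free_carrier R (brauer p p)"
    proof (rule free_carrierI)
      fix x assume "x \<in> brauer p p"
      then obtain r i \<sigma> j where x: "i \<in> up_mono r p" "j \<in> up_mono r p" "\<sigma> permutes {1..r}" "x = entry_diagram r i \<sigma> j" "r \<preceq> p"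
        by (rule entry_diagram_cases)
      show "v x \<in> carrier R" unfolding x(4) ve[OF x(1-3)] by (rule free_carrierD[OF matrix_sumD[OF y x(5,1,2)]])
    qed (simp add: v_def)
    have "to_matrices R p v = y"
      by (rule matrix_sum_ext[OF to_matrices_closed[OF v] y]) (simp only: to_matrices_apply[OF v] ve)
    then show "y \<in> to_matrices R p ` free_carrier R (brauer p p)" using v by blast
  qed
qed

section \<open>The algebra isomorphisms\<close>

lemma to_matrices_iso: "to_matrices R p \<in> algebra_iso R (matrix_brauer_algebra R p) (matrix_sum_algebra R p)"
proof (rule assoc_algebra_transport[OF matrix_brauer_algebra_assoc]; unfold matrix_brauer_algebra_eq free_algebra_simps)
  let ?N = "matrix_sum_algebra R p" and ?F = "free_carrier R (brauer p p)"
  show "bij_betw (to_matrices R p) ?F (carrier ?N)" by (rule to_matrices_bij)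
  show "to_matrices R p (matrix_ext p v w) = to_matrices R p v \<otimes>\<^bsub>?N\<^esub> to_matrices R p w" if "v \<in> ?F" "w \<in> ?F" for v w
    by (rule to_matrices_mult[OF that])
  show "to_matrices R p (\<lambda>x. v x \<oplus> w x) = to_matrices R p v \<oplus>\<^bsub>?N\<^esub> to_matrices R p w" if v: "v \<in> ?F" and w: "w \<in> ?F" for v w
    by (rule matrix_sum_ext[OF to_matrices_closed[OF free_add[OF v w]]
          abelian_monoid.a_closed[OF matrix_sum_monoid to_matrices_closed[OF v] to_matrices_closed[OF w]]])
      (simp only: matrix_sum_apply to_matrices_apply[OF v] to_matrices_apply[OF w] to_matrices_apply[OF free_add[OF v w]])
  show "to_matrices R p (matrix_one R p) = \<one>\<^bsub>?N\<^esub>" by (rule to_matrices_one)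
  show "to_matrices R p (\<lambda>x. \<zero>) = \<zero>\<^bsub>?N\<^esub>"
    by (rule matrix_sum_ext[OF to_matrices_closed[OF free_zero] abelian_monoid.zero_closed[OF matrix_sum_monoid]])
      (simp only: matrix_sum_apply to_matrices_apply[OF free_zero])
  show "to_matrices R p (scale R a v) = a \<odot>\<^bsub>?N\<^esub> to_matrices R p v" if a: "a \<in> carrier R" and v: "v \<in> ?F" for a v
    by (rule matrix_sum_ext[OF to_matrices_closed[OF free_scale[OF a v]] matrix_sum_smult_closed[OF a to_matrices_closed[OF v]]])
      (simp only: matrix_sum_apply to_matrices_apply[OF v] to_matrices_apply[OF free_scale[OF a v]], simp add: scale_def)
qed

lemma L_map_iso:
  assumes d: "\<delta> \<in> carrier R" and ns: "non_singular R \<delta> p"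
  shows "L_map R \<delta> p \<in> algebra_iso R (brauer_algebra R \<delta> p) (matrix_brauer_algebra R p)"
proof (rule assoc_algebra_transport[OF brauer_algebra_assoc[OF d]];
    unfold brauer_algebra_eq matrix_brauer_algebra_eq free_algebra_simps brauer_mult_eq[symmetric])
  note L = L_map_lin[OF d, of p]
  let ?F = "free_carrier R (brauer p p)"
  show "bij_betw (L_map R \<delta> p) ?F ?F" by (rule L_map_bij[OF d ns])
  show "L_map R \<delta> p (brauer_mult R \<delta> p p p v w) = matrix_ext p (L_map R \<delta> p v) (L_map R \<delta> p w)"
    if "v \<in> ?F" "w \<in> ?F" for v w by (rule L_map_mult[OF d that])
  show "L_map R \<delta> p (\<lambda>x. v x \<oplus> w x) = (\<lambda>x. L_map R \<delta> p v x \<oplus> L_map R \<delta> p w x)" if "v \<in> ?F" "w \<in> ?F" for v w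
    by (rule lin_add[OF L that])
  show "L_map R \<delta> p (basis R (id_diagram p)) = matrix_one R p" by (rule L_map_one[OF d])
  show "L_map R \<delta> p (\<lambda>x. \<zero>) = (\<lambda>x. \<zero>)" by (rule lin_zero[OF L])
  show "L_map R \<delta> p (scale R a v) = scale R a (L_map R \<delta> p v)" if "a \<in> carrier R" "v \<in> ?F" for a v
    by (rule lin_scale[OF L that])
qed

end

theorem corollary8p6:
  fixes R :: "'k ring" and \<delta> :: 'k and p :: nat
  assumes "cring R"
    and "\<delta> \<in> carrier R"
    and "non_singular R \<delta> p"
  shows "L_map R \<delta> p \<in> algebra_iso R (brauer_algebra R \<delta> p) (matrix_brauer_algebra R p)
    \<and> to_matrices R p \<in> algebra_iso R (matrix_brauer_algebra R p)
        (direct_sum_algebra {r. r \<preceq> p}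
          (\<lambda>r. matrix_algebra (up_mono r p) (group_algebra R (sym_group r))))
    \<and> to_matrices R p \<circ> L_map R \<delta> p \<in> algebra_iso R (brauer_algebra R \<delta> p)
        (direct_sum_algebra {r. r \<preceq> p}
          (\<lambda>r. matrix_algebra (up_mono r p) (group_algebra R (sym_group r))))"
proof -
  have N: "matrix_sum_algebra R p = direct_sum_algebra {r. r \<preceq> p}
      (\<lambda>r. matrix_algebra (up_mono r p) (group_algebra R (sym_group r)))"
    unfolding matrix_sum_algebra_def matrix_summand_def ..
  note L = cring.L_map_iso[OF assms] and T = cring.to_matrices_iso[OF assms(1), of p, unfolded N]
  show ?thesis using L T algebra_iso_comp[OF L T] by blast
qed

end
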